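(* Assume that $n \in \mathbb{N}$, $\gamma \in (0,1)$, and $n > 2\gamma$. Then there exists an optimal constant $C_{n,\gamma} > 0$ depending only on $n$ and $\gamma$ such that $$\|\mathcal{K}_{n,\gamma}f\|_{L^{\frac{2(n-2\gamma+2)}{n-2\gamma}}(\mathbb{R}^N_+;x_N^{m_0})} \le C_{n,\gamma}\,\|f\|_{L^{\frac{2n}{n-2\gamma}}(\mathbb{R}^n)} \quad \text{for all } f \in L^{\frac{2n}{n-2\gamma}}(\mathbb{R}^n).$$ Furthermore, the equality holds if and only if there are numbers $c \in \mathbb{R}$, $\lambda > 0$, and $\bar{x}_0 \in \mathbb{R}^n$ such that $$f(\bar{x}) = c\left(\frac{\lambda}{\lambda^2 + |\bar{x}-\bar{x}_0|^2}\right)^{\frac{n-2\gamma}{2}} \quad \text{for all } \bar{x} \in \mathbb{R}^n.$$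
   Context: $N = n+1$, $m_0 = 1-2\gamma \in (-1,1)$, and $\mathbb{R}^N_+ = \mathbb{R}^n \times (0,\infty)$ with points $x = (\bar{x},x_N)$. The $\gamma$-harmonic extension of $f$ is $$(\mathcal{K}_{n,\gamma}f)(x) = \int_{\mathbb{R}^n} \mathcal{K}_{n,\gamma}(x,\bar{w})f(\bar{w})\, d\bar{w}, \qquad \mathcal{K}_{n,\gamma}(x,\bar{w}) = \kappa_{n,\gamma}\frac{x_N^{2\gamma}}{(|\bar{x}-\bar{w}|^2+x_N^2)^{\frac{n+2\gamma}{2}}}, \qquad x \in \mathbb{R}^N_+,$$ where $\kappa_{n,\gamma} = \pi^{-n/2}\,\Gamma(\frac{n+2\gamma}{2})/\Gamma(\gamma)$, so that $\mathcal{K}_{n,\gamma}1 = 1$. $L^q(\mathbb{R}^N_+;x_N^{m_0})$ is the $L^q$-space on $\mathbb{R}^N_+$ with respect to the measure $x_N^{m_0}dx$. Functions in $L^p$ spaces are identified if they agree almost everywhere. *)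

theory Defs imports "HOL-Analysis.Analysis" begin

definition Lp_space :: "'a measure \<Rightarrow> real \<Rightarrow> ('a \<Rightarrow> real) set" where
  "Lp_space M p = {f \<in> borel_measurable M. integrable M (\<lambda>x. \<bar>f x\<bar> powr p)}"

text \<open>Only meaningful on \<open>Lp_space M p\<close>: the Bochner integral of a non-integrable function is 0.\<close>

definition Lp_norm :: "'a measure \<Rightarrow> real \<Rightarrow> ('a \<Rightarrow> real) \<Rightarrow> real" where
  "Lp_norm M p f = (LINT x|M. \<bar>f x\<bar> powr p) powr (1 / p)"

text \<open>A point of the upper half-space of dimension \<open>CARD('n) + 1\<close> is a pair of its horizontal
  part and its (positive) last coordinate.\<close>

definition upper_half_space :: "((real ^ 'n) \<times> real) set" where
  "upper_half_space = UNIV \<times> {0<..}"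

definition weighted_measure :: "real \<Rightarrow> ((real ^ 'n) \<times> real) measure" where
  "weighted_measure \<gamma> =
     density (lebesgue_on upper_half_space) (\<lambda>x. ennreal (snd x powr (1 - 2 * \<gamma>)))"

text \<open>Normalisation under which the kernel below has integral 1, so the extension of 1 is 1.\<close>

definition kappa :: "nat \<Rightarrow> real \<Rightarrow> real" where
  "kappa n \<gamma> = pi powr (- real n / 2) * Gamma ((real n + 2 * \<gamma>) / 2) / Gamma \<gamma>"

definition ext_kernel :: "real \<Rightarrow> (real ^ 'n) \<times> real \<Rightarrow> real ^ 'n \<Rightarrow> real" where
  "ext_kernel \<gamma> x w =
     kappa CARD('n) \<gamma> *
       (snd x powr (2 * \<gamma>) /
        ((norm (fst x - w))\<^sup>2 + (snd x)\<^sup>2) powr ((real CARD('n) + 2 * \<gamma>) / 2))"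

definition harmonic_ext :: "real \<Rightarrow> (real ^ 'n \<Rightarrow> real) \<Rightarrow> (real ^ 'n) \<times> real \<Rightarrow> real" where
  "harmonic_ext \<gamma> f x = (LINT w|lebesgue. ext_kernel \<gamma> x w * f w)"

end

theory Submission
  imports Defs "HOL-Library.Diagonal_Subsequence"
begin

text \<open>
  \<^bold>\<open>Why the theorem holds.\<close> Write \<open>a = n - 2 \<gamma>\<close>, \<open>b = n + 2 \<gamma>\<close> and let \<open>U f\<close> be the potential of \<open>f\<close> with the
  kernel \<open>G x w = (x\<^sub>N / \<bar>x - w\<bar>\<^sup>2)\<^bsup>b/2\<^esup>\<close>. Up to the factor \<open>\<kappa>\<close> it is the extension of \<open>f\<close> multiplied
  by \<open>x\<^sub>N\<^bsup>a/2\<^esup>\<close>, and the weighted norm of the extension to the power \<open>q\<close> is \<open>\<kappa>\<^bsup>q\<^esup>\<close> times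
  \<open>E f = \<integral> \<bar>U f\<bar>\<^bsup>q\<^esup>\<close> over the half-space with the hyperbolic measure \<open>x\<^sub>N\<^bsup>-n-1\<^esup> dx\<close>. In this
  form the problem is conformally invariant: a reflection in a hyperplane or an inversion in a sphere of
  \<open>\<real>\<^sup>n\<close>, with conformal factor \<open>\<rho>\<close>, extends to a hyperbolic isometry, and
  \<open>f \<mapsto> \<rho>\<^bsup>a\<^esup> (f \<circ> \<sigma>)\<close> preserves both \<open>E f\<close> and \<open>N f = \<integral> \<bar>f\<bar>\<^bsup>p\<^esup>\<close>.

  \<^bold>\<open>Polarization.\<close> Such a reflection splits \<open>\<real>\<^sup>n\<close> into two halves. Replace \<open>f \<ge> 0\<close> on one half by the
  maximum, on the other by the minimum of \<open>f\<close> and its reflected copy. This keeps \<open>N f\<close>; and since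
  \<open>G x w\<close> is larger when \<open>x\<close> and \<open>w\<close> lie on the same side, \<open>E f\<close> strictly increases unless \<open>f\<close> is
  one-sided, that is, unless on one half \<open>f\<close> lies entirely above or entirely below its reflected copy
  (\<open>polarization_dichotomy\<close>). Hence extremal functions are one-sided with respect to all reflections.

  \<^bold>\<open>Rigidity.\<close> If \<open>f\<close> is one-sided and both halves carry the same mass of \<open>f\<^bsup>p\<^esup>\<close>, then \<open>f\<close> equals its
  reflected copy. Bisecting the mass by coordinate hyperplanes gives a point \<open>x\<^sub>0\<close> about which \<open>f\<close> is
  even, and bisecting it by a sphere around \<open>x\<^sub>0\<close> gives a radius \<open>\<mu>\<close>. The composition of that inversion
  with the point reflection exchanges the two sides of every sphere with centre \<open>y\<close> and squared radius
  \<open>\<mu>\<^sup>2 + \<bar>y - x\<^sub>0\<bar>\<^sup>2\<close> (the great spheres, in the model where \<open>\<real>\<^sup>n\<close> is a round sphere), so all of these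
  bisect the mass as well. The quotient of \<open>f\<close> by the bubble of \<open>(x\<^sub>0, \<mu>)\<close> is therefore invariant under
  all inversions in great spheres, and these move any point to any other: the quotient is constant
  (\<open>bubble_if_one_sided\<close>).

  \<^bold>\<open>Existence.\<close> The noncompactness of the conformal group is avoided by maximizing \<open>E\<close> only over the
  functions with \<open>0 \<le> f \<le> M h\<close> and \<open>N f \<le> 1\<close>, where \<open>h\<close> is the bubble of \<open>(0, 1)\<close>. There \<open>U f\<close> is
  dominated by \<open>M U h\<close>, so \<open>E\<close> is continuous under weak limits and attains its maximum
  (\<open>maximizer_exists\<close>). The class is mapped to itself by polarization towards the half on which \<open>h\<close>
  lies above its own reflected copy, so the maximizer is still one-sided with respect to every reflection,
  hence a bubble. All bubbles have the same \<open>N\<close> and the same \<open>E\<close>, so the maximum does not exceed a value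
  independent of \<open>M\<close>; letting \<open>M\<close> tend to infinity proves the inequality for all \<open>f \<ge> 0\<close> (\<open>E_le\<close>).
  Polarizing an extremal function of the full problem shows that it is a bubble
  (\<open>bubble_if_extremal\<close>). Functions of varying sign lose strictly in \<open>\<bar>U f\<bar> \<le> U \<bar>f\<bar>\<close>
  (\<open>one_sign_if_V_eq\<close>).
\<close>

section \<open>Inversions and their Jacobian\<close>

text \<open>The change of variables theorem for Cartesian vectors asks for a well-ordered index type. This is a
  copy of an arbitrary finite type that carries the order of the natural numbers.\<close>

typedef (overloaded) ('a::finite) fin_ord = "{..<CARD('a)}"
  by (rule exI[of _ 0]) (auto simp: card_gt_0_iff)
instantiation fin_ord :: (finite) linorder begin
definition less_eq_fin_ord :: "'a fin_ord \<Rightarrow> 'a fin_ord \<Rightarrow> bool" where "x \<le> y \<longleftrightarrow> Rep_fin_ord x \<le> Rep_fin_ord y"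
definition less_fin_ord :: "'a fin_ord \<Rightarrow> 'a fin_ord \<Rightarrow> bool" where "x < y \<longleftrightarrow> Rep_fin_ord x < Rep_fin_ord y"
instance by standard (auto simp: less_eq_fin_ord_def less_fin_ord_def Rep_fin_ord_inject)
end
lemma card_fin_ord: "CARD('a::finite fin_ord) = CARD('a)"
  by (metis type_definition.card type_definition_fin_ord card_lessThan)
instance fin_ord :: (finite) finite
  by standard (metis Abs_fin_ord_cases finite_imageI finite_lessThan finite_subset image_eqI subsetI top_greatest UNIV_I)
instance fin_ord :: (finite) wellorder
proof
  fix P :: "'a fin_ord \<Rightarrow> bool" and a
  assume *: "\<And>x. (\<And>y. y < x \<Longrightarrow> P y) \<Longrightarrow> P x"
  show "P a"
    by (induction "Rep_fin_ord a" arbitrary: a rule: less_induct) (use * in \<open>auto simp: less_fin_ord_def\<close>)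
qed

text \<open>Division by zero turns the centre into a fixed point, which makes the map an involution of the
  whole space.\<close>

definition inversion :: "'a::real_inner \<Rightarrow> real \<Rightarrow> 'a \<Rightarrow> 'a" where
  "inversion y r z = y + (r / norm (z - y))\<^sup>2 *\<^sub>R (z - y)"

lemma inversion_center [simp]: "inversion y r y = y"
  by (simp add: inversion_def)

lemma norm_inversion_center: "r \<noteq> 0 \<Longrightarrow> norm (inversion y r z - y) = r\<^sup>2 / norm (z - y)"
  by (cases "z = y") (auto simp: inversion_def power2_eq_square)

lemma inversion_eq_center_iff: "r \<noteq> 0 \<Longrightarrow> inversion y r z = y \<longleftrightarrow> z = y"
  by (auto simp: inversion_def)

lemma inversion_inversion [simp]:
  assumes "r \<noteq> 0" shows "inversion y r (inversion y r z) = z"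
proof (cases "z = y")
  case False
  then have n: "norm (z - y) \<noteq> 0" by simp
  have "inversion y r (inversion y r z) =
      y + (r / norm (inversion y r z - y))\<^sup>2 *\<^sub>R (inversion y r z - y)"
    by (simp add: inversion_def[of y r "inversion y r z"])
  also have "\<dots> = y + ((norm (z - y) / r)\<^sup>2 * (r / norm (z - y))\<^sup>2) *\<^sub>R (z - y)"
    using assms n by (simp add: norm_inversion_center inversion_def power2_eq_square)
  also have "(norm (z - y) / r)\<^sup>2 * (r / norm (z - y))\<^sup>2 = 1"
    using assms n by (simp add: power2_eq_square)
  finally show ?thesis by simp
qed simp

lemma norm_inversion_diff:
  assumes "z \<noteq> y" "w \<noteq> y"
  shows "(norm (inversion y r z - inversion y r w))\<^sup>2
           = (r\<^sup>2 * norm (z - w) / (norm (z - y) * norm (w - y)))\<^sup>2"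
proof -
  define u v where "u = z - y" and "v = w - y"
  have uv: "norm u \<noteq> 0" "norm v \<noteq> 0" using assms by (auto simp: u_def v_def)
  have 1: "inversion y r z - inversion y r w = (r / norm u)\<^sup>2 *\<^sub>R u - (r / norm v)\<^sup>2 *\<^sub>R v"
    by (simp add: inversion_def u_def v_def)
  have n: "u \<bullet> u = (norm u)\<^sup>2" "v \<bullet> v = (norm v)\<^sup>2" "v \<bullet> u = u \<bullet> v"
    by (auto simp: power2_norm_eq_inner inner_commute)
  have zw: "(norm (z - w))\<^sup>2 = (norm u)\<^sup>2 - 2 * (u \<bullet> v) + (norm v)\<^sup>2"
    unfolding power2_norm_eq_inner u_def v_def by (simp add: algebra_simps inner_commute)
  have "(norm (inversion y r z - inversion y r w))\<^sup>2 =
    ((r / norm u)\<^sup>2)\<^sup>2 * (norm u)\<^sup>2 - 2 * ((r / norm u)\<^sup>2 * (r / norm v)\<^sup>2 * (u \<bullet> v)) + ((r / norm v)\<^sup>2)\<^sup>2 * (norm v)\<^sup>2"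
    unfolding 1 power2_norm_eq_inner[of "_ - _"]
    by (simp add: inner_diff_left inner_diff_right n power2_eq_square[of "_\<^sup>2"] algebra_simps)
  also have "\<dots> = r^4 * ((norm u)\<^sup>2 - 2 * (u \<bullet> v) + (norm v)\<^sup>2) / ((norm u)\<^sup>2 * (norm v)\<^sup>2)"
    using uv by (simp add: field_simps power2_eq_square power4_eq_xxxx)
  also have "\<dots> = (r\<^sup>2 * norm (z - w) / (norm u * norm v))\<^sup>2"
    unfolding zw[symmetric] by (simp add: power2_eq_square power4_eq_xxxx mult_ac)
  finally show ?thesis by (simp add: u_def v_def)
qed

text \<open>The derivative is a reflection in the hyperplane orthogonal to \<open>z - y\<close>, scaled by the squared
  ratio; hence the Jacobian determinant is a power of that ratio.\<close>

lemma has_derivative_inversion: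
  assumes "z \<noteq> y"
  shows "(inversion y r has_derivative
     (\<lambda>v. (r / norm (z - y))\<^sup>2 *\<^sub>R (v - (2 * ((z - y) \<bullet> v) / (norm (z - y))\<^sup>2) *\<^sub>R (z - y)))) (at z)"
proof -
  have eq: "inversion y r = (\<lambda>z. y + (r\<^sup>2 / ((z - y) \<bullet> (z - y))) *\<^sub>R (z - y))"
    by (simp add: fun_eq_iff inversion_def power_divide power2_norm_eq_inner)
  have nz: "(z - y) \<bullet> (z - y) \<noteq> 0" using assms by simp
  have q: "((\<lambda>z. (z - y) \<bullet> (z - y)) has_derivative (\<lambda>v. 2 * ((z - y) \<bullet> v))) (at z)"
    by (auto intro!: derivative_eq_intros simp: fun_eq_iff inner_commute)
  have d: "((\<lambda>z. r\<^sup>2 / ((z - y) \<bullet> (z - y))) has_derivative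
      (\<lambda>v. - (r\<^sup>2 * (2 * ((z - y) \<bullet> v)) / ((z - y) \<bullet> (z - y))\<^sup>2))) (at z)"
    by (rule has_derivative_eq_rhs[OF has_derivative_divide'[OF has_derivative_const q nz]])
       (simp add: fun_eq_iff power2_eq_square)
  have e: "((\<lambda>z. z - y) has_derivative (\<lambda>v. v)) (at z)"
    by (auto intro!: derivative_eq_intros)
  show ?thesis unfolding eq
    by (rule has_derivative_eq_rhs[OF has_derivative_add[OF has_derivative_const has_derivative_scaleR[OF d e]]])
       (auto simp: fun_eq_iff power_divide power2_norm_eq_inner scaleR_diff_right power2_eq_square[of "(z - y) \<bullet> (z - y)"])
qed

lemma orthogonal_transformation_reflection:
  fixes u :: "'a::euclidean_space"
  assumes "u \<noteq> 0"
  shows "orthogonal_transformation (\<lambda>v. v - (2 * (u \<bullet> v) / (norm u)\<^sup>2) *\<^sub>R u)"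
proof -
  have "linear (\<lambda>v. v - (2 * (u \<bullet> v) / (norm u)\<^sup>2) *\<^sub>R u)"
    by (rule linearI) (auto simp: algebra_simps inner_add_right add_divide_distrib)
  moreover have "(v - (2 * (u \<bullet> v) / (norm u)\<^sup>2) *\<^sub>R u) \<bullet> (w - (2 * (u \<bullet> w) / (norm u)\<^sup>2) *\<^sub>R u) = v \<bullet> w" for v w
    using assms
    by (simp add: inner_diff_left inner_diff_right power2_norm_eq_inner inner_commute field_simps)
  ultimately show ?thesis by (simp add: orthogonal_transformation_def)
qed

lemma borel_measurable_inversion [measurable]:
  "inversion (y::'a::euclidean_space) r \<in> borel_measurable borel"
  unfolding inversion_def[abs_def] by measurable

lemma inversion_image_eq_vimage:
  assumes "r \<noteq> 0" shows "inversion y r ` B = inversion y r -` B"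
  using assms by (auto intro!: image_eqI[of _ _ "inversion y r _"])

lemma det_scaleR_cart:
  fixes A :: "real^'m^'m"
  shows "det (c *\<^sub>R A) = c ^ CARD('m) * det A"
proof -
  have "c *\<^sub>R A = (\<chi> i. c *s A $ i)" by (simp add: vec_eq_iff)
  then show ?thesis using det_rows_mul[of "\<lambda>_. c" "\<lambda>i. A $ i"] by simp
qed

text \<open>A set of finite measure is the image, under the inversion, of its own inverse image, and its measure
  is the integral of the Jacobian over that inverse image.\<close>

lemma emeasure_inversion_finite:
  fixes y :: "real ^ 'm::{finite,wellorder}"
  assumes r: "r > 0" and B: "B \<in> sets borel" "emeasure lborel B < \<infinity>" "y \<notin> B"
  shows "emeasure lborel B = (\<integral>\<^sup>+z. ennreal ((r / norm (z - y)) ^ (2 * CARD('m))) * indicator B (inversion y r z) \<partial>lborel)"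
proof -
  let ?S = "inversion y r ` B"
  let ?f' = "\<lambda>z v. (r / norm (z - y))\<^sup>2 *\<^sub>R (v - (2 * ((z - y) \<bullet> v) / (norm (z - y))\<^sup>2) *\<^sub>R (z - y))"
  have S_eq: "?S = inversion y r -` B" using r by (simp add: inversion_image_eq_vimage)
  have Sb: "?S \<in> sets borel"
    unfolding S_eq using B(1) measurable_sets[OF borel_measurable_inversion[of y r], of B] by simp
  have yS: "z \<noteq> y" if "z \<in> ?S" for z using that B r by (auto simp: inversion_eq_center_iff)
  have imS: "inversion y r ` ?S = B" using r by (force simp: image_image)
  have det: "\<bar>det (matrix (?f' z))\<bar> = (r / norm (z - y)) ^ (2 * CARD('m))" if "z \<noteq> y" for z
  proof -
    have lin: "linear (\<lambda>v. v - (2 * ((z - y) \<bullet> v) / (norm (z - y))\<^sup>2) *\<^sub>R (z - y))"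
      using orthogonal_transformation_reflection[of "z - y"] that by (simp add: orthogonal_transformation_def)
    have "det (matrix (?f' z)) = det (((r / norm (z - y))\<^sup>2) *\<^sub>R matrix (\<lambda>v. v - (2 * ((z - y) \<bullet> v) / (norm (z - y))\<^sup>2) *\<^sub>R (z - y)))"
      by (rule arg_cong[of _ _ det]) (simp add: matrix_def vec_eq_iff)
    also have "\<dots> = ((r / norm (z - y))\<^sup>2) ^ CARD('m) * det (matrix (\<lambda>v. v - (2 * ((z - y) \<bullet> v) / (norm (z - y))\<^sup>2) *\<^sub>R (z - y)))"
      by (rule det_scaleR_cart)
    finally show ?thesis
      using orthogonal_transformation_det[OF orthogonal_transformation_reflection[of "z - y"]] that
      by (simp add: abs_mult power_mult)
  qed
  have "B \<in> lmeasurable" using B by (simp add: fmeasurable_def)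
  then have "((\<lambda>z. \<bar>det (matrix (?f' z))\<bar>) has_integral measure lebesgue B) ?S"
    using has_measure_differentiable_image[of ?S "inversion y r" ?f' "measure lebesgue B"] Sb imS
      has_derivative_at_withinI[OF has_derivative_inversion[OF yS]] r
    by (auto simp: inj_on_def)
  then have "((\<lambda>z. (r / norm (z - y)) ^ (2 * CARD('m))) has_integral measure lebesgue B) ?S"
    by (rule has_integral_eq[rotated]) (use det yS in auto)
  then have "integral\<^sup>N lborel (\<lambda>z. ennreal ((r / norm (z - y)) ^ (2 * CARD('m))) * indicator ?S z) = ennreal (measure lebesgue B)"
    by (intro nn_integral_has_integral_lebesgue') (use r in auto)
  also have "ennreal (measure lebesgue B) = emeasure lborel B"
    using B by (simp add: emeasure_eq_ennreal_measure)
  also have "indicator ?S = (\<lambda>z. indicator B (inversion y r z) :: ennreal)"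
    unfolding S_eq by (auto simp: indicator_def)
  finally show ?thesis by simp
qed

text \<open>Bounded pieces exhaust a Borel set up to the centre, which is a null set; so the inversion pushes the
  measure with the Jacobian as density forward to the Lebesgue measure.\<close>

lemma nn_integral_inversion_cart:
  fixes y :: "real ^ 'm::{finite,wellorder}"
  assumes r: "r > 0" and g[measurable]: "g \<in> borel_measurable borel"
  shows "(\<integral>\<^sup>+z. g z \<partial>lborel) = (\<integral>\<^sup>+z. ennreal ((r / norm (z - y)) ^ (2 * CARD('m))) * g (inversion y r z) \<partial>lborel)"
proof -
  let ?J = "\<lambda>z. ennreal ((r / norm (z - y)) ^ (2 * CARD('m)))"
  define M where "M = distr (density lborel ?J) borel (inversion y r)"
  have M: "emeasure M A = (\<integral>\<^sup>+z. ?J z * indicator A (inversion y r z) \<partial>lborel)" if [measurable]: "A \<in> sets borel" for A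
    unfolding M_def
    by (subst emeasure_distr) (auto simp: emeasure_density indicator_def vimage_def intro!: nn_integral_cong)
  have [simp]: "sets M = sets borel" by (simp add: M_def)
  have "lborel = M"
  proof (rule measure_eqI)
    fix A :: "(real, 'm) vec set" assume "A \<in> sets lborel"
    then have A[measurable]: "A \<in> sets borel" by simp
    define A' where "A' = A - {y}"
    define B where "B n = A \<inter> (cball y (real n) - {y})" for n
    have B[measurable]: "B n \<in> sets borel" for n unfolding B_def by measurable
    have inc: "incseq B" by (auto simp: B_def incseq_def)
    have U: "(\<Union>n. B n) = A'"
      unfolding A'_def B_def using real_arch_simple by (fastforce simp: mem_cball)
    have [measurable]: "A' \<in> sets borel" by (simp add: A'_def)
    have fin: "emeasure lborel (B n) < \<infinity>" for n
      by (rule le_less_trans[OF emeasure_mono[of _ "cball y (real n)"] emeasure_bounded_finite[OF bounded_cball]])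
         (auto simp: B_def)
    have "emeasure lborel (B n) = emeasure M (B n)" for n
      using emeasure_inversion_finite[OF r B fin, of y n] by (simp add: M B_def)
    then have "(SUP n. emeasure lborel (B n)) = (SUP n. emeasure M (B n))" by simp
    then have 1: "emeasure lborel A' = emeasure M A'"
      using inc by (subst (asm) (1 2) SUP_emeasure_incseq) (auto simp: U)
    have "emeasure lborel A = emeasure lborel A'"
      unfolding A'_def by (intro emeasure_Diff_null_set[symmetric]) (auto simp: null_sets_def)
    moreover have "emeasure M A = emeasure M A'"
      using r by (subst (1 2) M)
        (auto intro!: nn_integral_cong simp: A'_def indicator_def inversion_eq_center_iff)
    ultimately show "emeasure lborel A = emeasure M A" using 1 by simp
  qed simp
  then have "(\<integral>\<^sup>+z. g z \<partial>lborel) = (\<integral>\<^sup>+z. g z \<partial>M)" by simp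
  also have "\<dots> = (\<integral>\<^sup>+z. ?J z * g (inversion y r z) \<partial>lborel)"
    unfolding M_def by (subst nn_integral_distr) (auto simp: nn_integral_density)
  finally show ?thesis .
qed

text \<open>Transports statements about Cartesian vectors to every Euclidean space of the same dimension, in
  particular to pairs of a boundary point and a height.\<close>

lemma euclidean_isometry_cart:
  assumes card: "CARD('m::finite) = DIM('a::euclidean_space)"
  obtains T :: "real ^ ('m::finite) \<Rightarrow> 'a::euclidean_space" where "linear T" "\<And>v. norm (T v) = norm v" "surj T"
    "distr lborel borel T = lborel"
proof -
  obtain \<beta> :: "'m \<Rightarrow> 'a" where \<beta>: "bij_betw \<beta> UNIV Basis"
    using finite_same_card_bij[of "UNIV :: 'm set" "Basis :: 'a set"] card by auto
  define T :: "real ^ 'm \<Rightarrow> 'a" where "T v = (\<Sum>i\<in>UNIV. v $ i *\<^sub>R \<beta> i)" for v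
  have bas: "\<beta> i \<in> Basis" for i using \<beta> by (auto simp: bij_betw_def)
  have im: "\<beta> ` UNIV = Basis" and inj: "inj \<beta>" using \<beta> by (auto simp: bij_betw_def)
  have inner_b: "\<beta> i \<bullet> \<beta> j = (if i = j then 1 else 0)" for i j
    using bas inj by (auto simp: inner_Basis inj_def)
  have Tb: "T v \<bullet> \<beta> j = v $ j" for v j
    by (simp add: T_def inner_sum_left inner_b if_distrib cong: if_cong)
  have lin: "linear T"
    by (rule linearI) (auto simp: T_def scaleR_add_left sum.distrib scaleR_sum_right)
  have nrm: "norm (T v) = norm v" for v
  proof -
    have "T v \<bullet> T v = (\<Sum>j\<in>UNIV. v $ j * (T v \<bullet> \<beta> j))"
      by (subst (2) T_def) (simp add: inner_sum_right)
    also have "\<dots> = v \<bullet> v" by (simp add: Tb inner_vec_def)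
    finally show ?thesis by (simp add: norm_eq_sqrt_inner)
  qed
  have sj: "surj T"
  proof (rule surjI)
    fix x :: 'a
    have "T (\<chi> i. x \<bullet> \<beta> i) = (\<Sum>i\<in>UNIV. (x \<bullet> \<beta> i) *\<^sub>R \<beta> i)" by (simp add: T_def)
    also have "\<dots> = (\<Sum>b\<in>Basis. (x \<bullet> b) *\<^sub>R b)"
      using sum.reindex[OF inj, of "\<lambda>b. (x \<bullet> b) *\<^sub>R b"] im by simp
    finally show "T (\<chi> i. x \<bullet> \<beta> i) = x" by (simp add: euclidean_representation)
  qed
  have [measurable]: "T \<in> borel_measurable borel"
    using lin by (simp add: borel_measurable_continuous_onI linear_continuous_on linear_linear)
  have "lborel = distr lborel borel T"
  proof (rule lborel_eqI)
    fix l u :: 'a assume lu: "\<And>b. b \<in> Basis \<Longrightarrow> l \<bullet> b \<le> u \<bullet> b"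
    let ?l = "\<chi> i. l \<bullet> \<beta> i" and ?u = "\<chi> i. u \<bullet> \<beta> i"
    have mb: "x \<in> box l u \<longleftrightarrow> (\<forall>i. l \<bullet> \<beta> i < x \<bullet> \<beta> i \<and> x \<bullet> \<beta> i < u \<bullet> \<beta> i)" for x
      by (simp add: mem_box im[symmetric])
    have "T -` box l u = box ?l ?u"
      unfolding set_eq_iff vimage_eq mb mem_box_cart Tb by simp
    then have "emeasure (distr lborel borel T) (box l u) = emeasure lborel (box ?l ?u)"
      by (subst emeasure_distr) auto
    also have "\<dots> = (\<Prod>b\<in>Basis. (?u - ?l) \<bullet> b)"
      by (rule emeasure_lborel_box) (use lu bas in \<open>auto simp: Basis_vec_def inner_axis\<close>)
    also have "(\<Prod>b\<in>Basis. (?u - ?l) \<bullet> b) = (\<Prod>i\<in>UNIV. (?u - ?l) $ i)"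
    proof -
      have B: "(Basis :: (real^'m) set) = (\<lambda>i. axis i 1) ` UNIV" by (auto simp: Basis_vec_def)
      have "inj (\<lambda>i::'m. axis i (1::real))" by (auto simp: inj_def axis_eq_axis)
      then show ?thesis unfolding B by (subst prod.reindex) (auto simp: inner_axis)
    qed
    also have "\<dots> = (\<Prod>b\<in>Basis. (u - l) \<bullet> b)"
      using prod.reindex[OF inj, of "\<lambda>b. (u - l) \<bullet> b"] im by (simp add: inner_diff_left)
    finally show "emeasure (distr lborel borel T) (box l u) = (\<Prod>b\<in>Basis. (u - l) \<bullet> b)" .
  qed simp
  then show thesis using that lin nrm sj by simp
qed

lemma nn_integral_inversion_aux:
  fixes y :: "'a::euclidean_space"
  assumes card: "CARD('m::{finite,wellorder}) = DIM('a)"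
  assumes r: "r > 0" and g[measurable]: "g \<in> borel_measurable borel"
  shows "(\<integral>\<^sup>+z. g z \<partial>lborel) = (\<integral>\<^sup>+z. ennreal ((r / norm (z - y)) ^ (2 * DIM('a))) * g (inversion y r z) \<partial>lborel)"
proof -
  obtain T :: "(real, 'm) vec \<Rightarrow> 'a" where T: "linear T" "\<And>v. norm (T v) = norm v" "surj T"
    and D: "distr lborel borel T = lborel"
    using euclidean_isometry_cart[OF card] by metis
  obtain y' where y': "y = T y'" using T(3) by (metis surjD)
  have [measurable]: "T \<in> borel_measurable borel"
    using T(1) by (simp add: borel_measurable_continuous_onI linear_continuous_on linear_linear)
  have *: "(\<integral>\<^sup>+z. f z \<partial>lborel) = (\<integral>\<^sup>+v. f (T v) \<partial>lborel)" if [measurable]: "f \<in> borel_measurable borel" for f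
    by (subst D[symmetric]) (simp add: nn_integral_distr)
  have n: "norm (T v - y) = norm (v - y')" for v
    unfolding y' using T by (metis linear_diff)
  have i: "inversion y r (T v) = T (inversion y' r v)" for v
    unfolding inversion_def n by (simp add: y' linear_add[OF T(1)] linear_diff[OF T(1)] linear_scale[OF T(1)])
  have "(\<integral>\<^sup>+z. g z \<partial>lborel) = (\<integral>\<^sup>+v. g (T v) \<partial>lborel)" by (rule *) simp
  also have "\<dots> = (\<integral>\<^sup>+v. ennreal ((r / norm (v - y')) ^ (2 * CARD('m))) * g (T (inversion y' r v)) \<partial>lborel)"
    by (rule nn_integral_inversion_cart) (use r in auto)
  also have "\<dots> = (\<integral>\<^sup>+v. ennreal ((r / norm (T v - y)) ^ (2 * DIM('a))) * g (inversion y r (T v)) \<partial>lborel)"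
    by (simp add: n i card)
  also have "\<dots> = (\<integral>\<^sup>+z. ennreal ((r / norm (z - y)) ^ (2 * DIM('a))) * g (inversion y r z) \<partial>lborel)"
    by (rule *[symmetric]) measurable
  finally show ?thesis .
qed

lemma nn_integral_inversion:
  fixes y :: "real ^ 'n::finite"
  assumes "r > 0" "g \<in> borel_measurable borel"
  shows "(\<integral>\<^sup>+z. g z \<partial>lborel) = (\<integral>\<^sup>+z. ennreal ((r / norm (z - y)) ^ (2 * CARD('n))) * g (inversion y r z) \<partial>lborel)"
  using nn_integral_inversion_aux[where 'm = "'n fin_ord" and y = y, OF _ assms] by (simp add: card_fin_ord)

lemma nn_integral_inversion_pair:
  fixes y :: "(real ^ 'n::finite) \<times> real"
  assumes "r > 0" "g \<in> borel_measurable borel"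
  shows "(\<integral>\<^sup>+z. g z \<partial>lborel) = (\<integral>\<^sup>+z. ennreal ((r / norm (z - y)) ^ (2 * (CARD('n) + 1))) * g (inversion y r z) \<partial>lborel)"
  using nn_integral_inversion_aux[where 'm = "'n option fin_ord" and y = y, OF _ assms] by (simp add: card_fin_ord)

section \<open>The kernel in hyperbolic normalisation\<close>

text \<open>Compared with dyadic balls: at distance about \<open>2\<^sup>k\<close> the integrand is of order \<open>2\<^bsup>-ks\<^esup>\<close>, and the ball of
  radius \<open>2\<^sup>k\<close> has measure of order \<open>2\<^bsup>k DIM\<^esup>\<close>, which leaves a geometric series.\<close>

lemma nn_integral_decay_finite:
  assumes s: "s > real DIM('a::euclidean_space)"
  shows "(\<integral>\<^sup>+w. ennreal ((1 + (norm (w::'a))\<^sup>2) powr (- s / 2)) \<partial>lborel) < \<infinity>"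
proof -
  \<comment> \<open>the ratio of the geometric series of shell contributions\<close>
  define \<theta> where "\<theta> = 2 powr (- s) * 2 ^ DIM('a)"
  have \<theta>: "0 \<le> \<theta>" "\<theta> < 1"
    using powr_less_mono[of "real DIM('a) - s" 0 2] s
    by (auto simp: \<theta>_def powr_realpow[symmetric] powr_add[symmetric])
  have pt: "ennreal ((1 + (norm w)\<^sup>2) powr (- s / 2)) \<le>
      (\<Sum>k. ennreal (2 powr s * (2 powr (- s)) ^ k) * indicator (cball 0 (2 ^ k)) w)" for w :: 'a
  proof -
    \<comment> \<open>a single term of the series, the one for the smallest dyadic ball around \<open>w\<close>, already suffices\<close>
    define k where "k = (LEAST k. norm w \<le> 2 ^ k)"
    have ex: "\<exists>k. norm w \<le> 2 ^ k"
      using real_arch_pow[of 2 "norm w"] by (auto intro: less_imp_le)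
    then have k: "norm w \<le> 2 ^ k" unfolding k_def by (rule LeastI_ex)
    have "(1 + (norm w)\<^sup>2) powr (- s / 2) \<le> 2 powr s * (2 powr (- s)) ^ k"
    proof (cases k)
      case 0
      have "(1 + (norm w)\<^sup>2) powr (- s / 2) \<le> 1 powr (- s / 2)"
        by (rule powr_mono2') (use s in auto)
      also have "\<dots> \<le> 2 powr s" using s by (simp add: ge_one_powr_ge_zero)
      finally show ?thesis using 0 by simp
    next
      case (Suc j)
      then have "\<not> norm w \<le> 2 ^ j" unfolding k_def by (metis lessI not_less_Least)
      then have "(2 ^ j)\<^sup>2 \<le> (norm w)\<^sup>2" by (intro power_mono) auto
      then have "(2 ^ j)\<^sup>2 \<le> 1 + (norm w)\<^sup>2" by linarith
      then have "(1 + (norm w)\<^sup>2) powr (- s / 2) \<le> ((2 ^ j)\<^sup>2) powr (- s / 2)"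
        by (intro powr_mono2') (use s in auto)
      also have "\<dots> = 2 powr (- s * real j)"
        by (simp add: powr_realpow[symmetric] powr_powr power2_eq_square powr_add[symmetric] mult.commute)
      also have "\<dots> = 2 powr s * (2 powr (- s)) ^ k"
        using Suc by (simp add: powr_realpow[symmetric] powr_powr powr_add[symmetric] algebra_simps)
      finally show ?thesis .
    qed
    then have "ennreal ((1 + (norm w)\<^sup>2) powr (- s / 2)) \<le>
       (\<Sum>i\<in>{k}. ennreal (2 powr s * (2 powr (- s)) ^ i) * indicator (cball 0 (2 ^ i)) w)"
      using k by (simp add: ennreal_leI)
    also have "\<dots> \<le> (\<Sum>k. ennreal (2 powr s * (2 powr (- s)) ^ k) * indicator (cball 0 (2 ^ k)) w)"
      by (rule sum_le_suminf) auto
    finally show ?thesis .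
  qed
  define c where "c = 2 powr s * unit_ball_vol (real DIM('a))"
  have "(\<integral>\<^sup>+w. ennreal ((1 + (norm (w::'a))\<^sup>2) powr (- s / 2)) \<partial>lborel)
      \<le> (\<integral>\<^sup>+w. (\<Sum>k. ennreal (2 powr s * (2 powr (- s)) ^ k) * indicator (cball 0 (2 ^ k)) (w::'a)) \<partial>lborel)"
    by (rule nn_integral_mono) (rule pt)
  also have "\<dots> = (\<Sum>k. \<integral>\<^sup>+w. ennreal (2 powr s * (2 powr (- s)) ^ k) * indicator (cball 0 (2 ^ k)) (w::'a) \<partial>lborel)"
    by (rule nn_integral_suminf) (rule borel_measurable_times_ennreal[OF borel_measurable_const borel_measurable_indicator], simp)
  also have "\<dots> = (\<Sum>k. ennreal (c * \<theta> ^ k))"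
  proof (rule suminf_cong)
    fix k
    have "(\<integral>\<^sup>+w. ennreal (2 powr s * (2 powr (- s)) ^ k) * indicator (cball 0 (2 ^ k)) (w::'a) \<partial>lborel)
      = ennreal (2 powr s * (2 powr (- s)) ^ k) * ennreal (unit_ball_vol (real DIM('a)) * (2 ^ k) ^ DIM('a))"
      by (subst nn_integral_cmult_indicator) (simp_all add: emeasure_cball)
    also have "\<dots> = ennreal (c * \<theta> ^ k)"
      unfolding c_def \<theta>_def power_mult_distrib
      by (subst ennreal_mult[symmetric]) (simp_all add: power_mult[symmetric] mult.commute)
    finally show "(\<integral>\<^sup>+w. ennreal (2 powr s * (2 powr (- s)) ^ k) * indicator (cball 0 (2 ^ k)) (w::'a) \<partial>lborel)
      = ennreal (c * \<theta> ^ k)" .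
  qed
  also have "\<dots> = ennreal (\<Sum>k. c * \<theta> ^ k)"
    using \<theta> by (intro suminf_ennreal2) (auto simp: c_def intro!: summable_mult summable_geometric)
  finally show ?thesis by (simp add: order_le_less_trans)
qed

text \<open>The Borel sets of a pair type are the product of the Borel sets of its components; the two rules let
  the measurability prover use this for coordinates of Borel functions.\<close>

lemma measurable_fst_borel [measurable (raw)]:
  fixes f :: "'c \<Rightarrow> 'a::second_countable_topology \<times> 'b::second_countable_topology"
  assumes "f \<in> borel_measurable M" shows "(\<lambda>x. fst (f x)) \<in> borel_measurable M"
  using assms unfolding borel_prod[symmetric] by measurable

lemma measurable_snd_borel [measurable (raw)]:
  fixes f :: "'c \<Rightarrow> 'a::second_countable_topology \<times> 'b::second_countable_topology"
  assumes "f \<in> borel_measurable M" shows "(\<lambda>x. snd (f x)) \<in> borel_measurable M"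
  using assms unfolding borel_prod[symmetric] by measurable

text \<open>With a fixed sum, a strictly convex power sum grows when the pair is spread out: the gain from \<open>\<alpha>\<close> to
  \<open>A\<close> and the loss from \<open>\<beta>\<close> to \<open>B\<close> are slopes over intervals of equal length, and the slope of the gain is
  taken at larger arguments.\<close>

lemma powr_sum_majorization:
  fixes \<alpha> \<beta> A B q :: real
  assumes q: "q > 1" and nn: "0 \<le> \<alpha>" "0 \<le> \<beta>" "0 \<le> B" and sum: "A + B = \<alpha> + \<beta>"
  shows "\<alpha> \<le> A \<Longrightarrow> \<beta> \<le> A \<Longrightarrow> \<alpha> powr q + \<beta> powr q \<le> A powr q + B powr q"
    and "\<alpha> < A \<Longrightarrow> \<beta> < A \<Longrightarrow> \<alpha> powr q + \<beta> powr q < A powr q + B powr q"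
proof -
  have main: "\<alpha> powr q + \<beta> powr q < A powr q + B powr q"
    if h: "\<alpha> < A" "\<beta> < A" "\<beta> \<le> \<alpha>" "0 \<le> \<beta>" "0 \<le> B" "A + B = \<alpha> + \<beta>" for \<alpha> \<beta> A B :: real
  proof -
    have mvt: "\<exists>u. x < u \<and> u < y \<and> y powr q - x powr q = (y - x) * (q * u powr (q - 1))"
      if xy: "0 \<le> x" "x < y" for x y
    proof -
      have der: "((\<lambda>t. t powr q) has_real_derivative q * t powr (q - 1)) (at t)" if "t > 0" for t
        using that by (auto intro!: derivative_eq_intros)
      have "continuous_on {x..y} (\<lambda>t. t powr q)"
        using xy q by (intro continuous_on_powr' continuous_intros) auto
      moreover have "(\<lambda>t. t powr q) differentiable (at z)" if "x < z" for z
        using der[of z] that xy unfolding real_differentiable_def by (meson le_less_trans)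
      ultimately obtain l z where z: "x < z" "z < y" "((\<lambda>t. t powr q) has_real_derivative l) (at z)"
          "y powr q - x powr q = (y - x) * l"
        using MVT[OF xy(2), of "\<lambda>t. t powr q"] by blast
      have "l = q * z powr (q - 1)" using z xy by (intro DERIV_unique[OF z(3) der]) auto
      then show ?thesis using z by blast
    qed
    obtain u where u: "\<alpha> < u" "u < A" "A powr q - \<alpha> powr q = (A - \<alpha>) * (q * u powr (q - 1))"
      using mvt[of \<alpha> A] h by auto
    obtain v where v: "B < v" "v < \<beta>" "\<beta> powr q - B powr q = (\<beta> - B) * (q * v powr (q - 1))"
      using mvt[of B \<beta>] h by auto
    have "v powr (q - 1) < u powr (q - 1)"
      using u v h q by (intro powr_less_mono2) auto
    moreover have "\<beta> - B = A - \<alpha>" "0 < A - \<alpha>" using h by linarith+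
    ultimately have "(\<beta> - B) * (q * v powr (q - 1)) < (A - \<alpha>) * (q * u powr (q - 1))"
      using q by (simp add: mult_strict_left_mono)
    then show ?thesis using u v by linarith
  qed
  show strict: "\<alpha> powr q + \<beta> powr q < A powr q + B powr q" if "\<alpha> < A" "\<beta> < A"
    using main[of \<alpha> A \<beta> B] main[of \<beta> A \<alpha> B] that nn sum by (cases "\<beta> \<le> \<alpha>") (auto simp: add.commute)
  show "\<alpha> powr q + \<beta> powr q \<le> A powr q + B powr q" if "\<alpha> \<le> A" "\<beta> \<le> A"
  proof (cases "\<alpha> = A \<or> \<beta> = A")
    case True
    then show ?thesis using sum by (auto simp: add.commute)
  next
    case False
    then show ?thesis using strict that by (auto intro: less_imp_le)
  qed
qed

text \<open>The equality case of monotonicity of the integral.\<close>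

lemma AE_eq_if_nn_integral_eq:
  assumes [measurable]: "f \<in> borel_measurable M" "g \<in> borel_measurable M"
    and le: "AE x in M. f x \<le> g x" and eq: "integral\<^sup>N M f = integral\<^sup>N M g" and fin: "integral\<^sup>N M f \<noteq> \<infinity>"
  shows "AE x in M. f x = g x"
proof -
  have "AE x in M. g x \<le> f x"
    using nn_integral_less[OF assms(1,2) fin le] eq by auto
  with le show ?thesis by eventually_elim (rule antisym)
qed

text \<open>The numbers \<open>a\<close> and \<open>b\<close> are the conformal weights of functions on the boundary and of the kernel; the
  exponents \<open>p\<close> and \<open>q\<close> are the ones for which \<open>N\<close> and \<open>E\<close> below are conformally invariant, because
  \<open>a p = 2 n\<close> and \<open>a q = 2 (a + 2)\<close>.\<close>

locale poisson_setting =
  fixes \<gamma> n a b p q :: real and dim :: "'n::finite itself"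
  assumes \<gamma>: "0 < \<gamma>" "\<gamma> < 1"
    and n_def: "n = real CARD('n)"
    and a_def: "a = n - 2 * \<gamma>" and a_pos: "0 < a"
    and b_def: "b = n + 2 * \<gamma>"
    and p_def: "p = 2 * n / a"
    and q_def: "q = 2 * (a + 2) / a"
begin

lemma n_ge_1: "1 \<le> n" unfolding n_def by (simp add: Suc_le_eq)
lemma b_gt_n: "n < b" using \<gamma> by (simp add: b_def)
lemma b_pos: "0 < b" using \<gamma> n_ge_1 by (simp add: b_def)
lemma p_gt_2: "2 < p" using \<gamma> a_pos by (simp add: p_def a_def field_simps)
lemma q_gt_2: "2 < q" using a_pos by (simp add: q_def field_simps)
lemma a_times_p: "a * p = 2 * n" using a_pos by (simp add: p_def)
lemma a_times_q: "a * q = 2 * (a + 2)" using a_pos by (simp add: q_def)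
lemma a_plus_b: "a + b = 2 * n" by (simp add: a_def b_def)

text \<open>The extension kernel without its constant and multiplied by \<open>x\<^sub>N\<^bsup>a/2\<^esup>\<close>. The pair \<open>(w, 0)\<close> places the
  boundary point \<open>w\<close> in the closed half-space, where inversions act on points and boundary points alike.\<close>

definition G :: "(real^'n) \<times> real \<Rightarrow> real^'n \<Rightarrow> real" where
  "G x w = (snd x / (norm (x - (w, 0)))\<^sup>2) powr (b / 2)"

definition U :: "(real^'n \<Rightarrow> real) \<Rightarrow> (real^'n) \<times> real \<Rightarrow> real" where
  "U f x = (LINT w|lborel. G x w * f w)"

text \<open>The volume of the hyperbolic half-space: inversions centred at the boundary preserve it.\<close>

definition hyp :: "((real^'n) \<times> real) measure" where
  "hyp = density lborel (\<lambda>x. ennreal (indicator {0<..} (snd x) * snd x powr (- (n + 1))))"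

text \<open>The weighted norm of the extension to the power \<open>q\<close>, up to the power \<open>q\<close> of the constant \<open>\<kappa>\<close>.\<close>

definition E :: "(real^'n \<Rightarrow> real) \<Rightarrow> ennreal" where
  "E f = (\<integral>\<^sup>+x. ennreal (U f x powr q) \<partial>hyp)"

definition N :: "(real^'n \<Rightarrow> real) \<Rightarrow> ennreal" where
  "N f = (\<integral>\<^sup>+w. ennreal (f w powr p) \<partial>lborel)"

definition admissible :: "(real^'n \<Rightarrow> real) \<Rightarrow> bool" where
  "admissible f \<longleftrightarrow> f \<in> borel_measurable borel \<and> (\<forall>w. 0 \<le> f w) \<and> N f < \<infinity>"

lemma norm_sq_halfspace: "(norm (x - (w, 0)))\<^sup>2 = (norm (fst x - w))\<^sup>2 + (snd x)\<^sup>2"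
  for x :: "(real^'n) \<times> real"
  by (simp add: norm_prod_def)

lemma measurable_G [measurable]: "(\<lambda>z. G (f z) (g z)) \<in> borel_measurable M"
  if [measurable]: "f \<in> borel_measurable M" "g \<in> borel_measurable M"
  unfolding G_def by measurable

lemma sets_hyp [simp, measurable_cong]: "sets hyp = sets borel" by (simp add: hyp_def)
lemma space_hyp [simp]: "space hyp = UNIV" by (simp add: hyp_def)

lemma measurable_U [measurable]: "U f \<in> borel_measurable borel" if [measurable]: "f \<in> borel_measurable borel"
  unfolding U_def by measurable

lemma AE_hyp: "AE x in hyp. 0 < snd x"
  unfolding hyp_def by (subst AE_density) (auto split: split_indicator_asm)

lemma nn_integral_hyp:
  assumes [measurable]: "g \<in> borel_measurable borel"
  shows "(\<integral>\<^sup>+x. g x \<partial>hyp) = (\<integral>\<^sup>+x. ennreal (indicator {0<..} (snd x) * snd x powr (- (n + 1))) * g x \<partial>lborel)"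
  unfolding hyp_def by (rule nn_integral_density) measurable

lemma G_nonneg [simp]: "0 \<le> G x w" by (simp add: G_def)

lemma G_pos: "0 < snd x \<Longrightarrow> 0 < G x w"
  by (auto simp: G_def prod_eq_iff)

lemma G_le: assumes t: "0 < snd x" shows "G x w \<le> (1 / snd x) powr (b / 2)"
proof -
  have "snd x / ((norm (fst x - w))\<^sup>2 + (snd x)\<^sup>2) \<le> snd x / (snd x)\<^sup>2"
    using t by (intro divide_left_mono) (auto intro!: mult_pos_pos add_nonneg_pos)
  also have "\<dots> = 1 / snd x" by (simp add: power2_eq_square)
  finally show ?thesis unfolding G_def norm_sq_halfspace
    using b_pos t by (intro powr_mono2) auto
qed

text \<open>By translation and scaling with the height the kernel at \<open>x\<close> becomes the kernel at \<open>(0, 1)\<close>.\<close>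

lemma nn_integral_G_eq:
  assumes t: "0 < snd x"
  shows "(\<integral>\<^sup>+w. ennreal (G x w) \<partial>lborel) =
    ennreal (snd x powr (a / 2)) * (\<integral>\<^sup>+w. ennreal ((1 + (norm (w::real^'n))\<^sup>2) powr (- b / 2)) \<partial>lborel)"
proof -
  let ?t = "snd x"
  have "(\<integral>\<^sup>+w. ennreal (G x w) \<partial>lborel) =
     (\<integral>\<^sup>+w. ennreal (\<bar>?t\<bar> ^ CARD('n)) * ennreal (G x (fst x + ?t *\<^sub>R w)) \<partial>lborel)"
    using t by (subst lborel_affine[of ?t "fst x"]) (auto simp: nn_integral_density nn_integral_distr)
  also have "\<dots> = (\<integral>\<^sup>+w. ennreal (?t powr (a / 2)) * ennreal ((1 + (norm (w::real^'n))\<^sup>2) powr (- b / 2)) \<partial>lborel)"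
  proof (rule nn_integral_cong)
    fix w :: "real^'n"
    have "(norm (fst x - (fst x + ?t *\<^sub>R w)))\<^sup>2 + ?t\<^sup>2 = ?t\<^sup>2 * (1 + (norm w)\<^sup>2)"
      by (simp add: power_mult_distrib algebra_simps)
    then have "G x (fst x + ?t *\<^sub>R w) = ((?t * (1 + (norm w)\<^sup>2)) powr (-1)) powr (b / 2)"
      unfolding G_def norm_sq_halfspace using t
      by (simp add: powr_minus_divide power2_eq_square add_pos_nonneg)
    also have "\<dots> = (?t * (1 + (norm w)\<^sup>2)) powr (- b / 2)"
      unfolding powr_powr by simp
    also have "\<dots> = ?t powr (- b / 2) * (1 + (norm w)\<^sup>2) powr (- b / 2)"
      by (rule powr_mult)
    finally have "?t ^ CARD('n) * G x (fst x + ?t *\<^sub>R w) = ?t powr n * (?t powr (- b / 2) * (1 + (norm w)\<^sup>2) powr (- b / 2))"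
      using t by (simp add: n_def powr_realpow)
    also have "\<dots> = ?t powr (n + - b / 2) * (1 + (norm w)\<^sup>2) powr (- b / 2)"
      unfolding mult.assoc[symmetric] powr_add ..
    also have "n + - b / 2 = a / 2" using a_plus_b by linarith
    finally show "ennreal (\<bar>?t\<bar> ^ CARD('n)) * ennreal (G x (fst x + ?t *\<^sub>R w)) =
       ennreal (?t powr (a / 2)) * ennreal ((1 + (norm w)\<^sup>2) powr (- b / 2))"
      using t by (simp add: ennreal_mult[symmetric])
  qed
  also have "\<dots> = ennreal (?t powr (a / 2)) * (\<integral>\<^sup>+w. ennreal ((1 + (norm (w::real^'n))\<^sup>2) powr (- b / 2)) \<partial>lborel)"
    by (rule nn_integral_cmult) measurable
  finally show ?thesis .
qed

lemma integrable_G: assumes t: "0 < snd x" shows "integrable lborel (G x)"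
proof (rule integrableI_nonneg)
  show "(\<integral>\<^sup>+w. ennreal (G x w) \<partial>lborel) < \<infinity>"
    unfolding nn_integral_G_eq[OF t] using nn_integral_decay_finite[where s = b and 'a = "real^'n"] b_gt_n
    by (simp add: n_def ennreal_mult_less_top)
qed auto

lemma integrable_powr_p: "admissible f \<Longrightarrow> integrable lborel (\<lambda>w. f w powr p)"
  unfolding admissible_def N_def by (intro integrableI_nonneg) auto

text \<open>From \<open>f \<le> 1 + f\<^bsup>p\<^esup>\<close>: for a fixed \<open>x\<close> the kernel is both integrable and bounded in \<open>w\<close>.\<close>

lemma integrable_G_mult: assumes t: "0 < snd x" and f: "admissible f" shows "integrable lborel (\<lambda>w. G x w * f w)"
proof (rule Bochner_Integration.integrable_bound)
  let ?C = "(1 / snd x) powr (b / 2)"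
  show "integrable lborel (\<lambda>w. G x w + ?C * f w powr p)"
    using integrable_G[OF t] integrable_powr_p[OF f] by simp
  have [measurable]: "f \<in> borel_measurable borel" using f by (simp add: admissible_def)
  show "(\<lambda>w. G x w * f w) \<in> borel_measurable lborel" by measurable
  show "AE w in lborel. norm (G x w * f w) \<le> norm (G x w + ?C * f w powr p)"
  proof (rule AE_I2)
    fix w
    have f0: "0 \<le> f w" using f by (simp add: admissible_def)
    have "f w \<le> 1 + f w powr p"
    proof (cases "f w \<le> 1")
      case False
      then have "f w powr 1 \<le> f w powr p" using p_gt_2 by (intro powr_mono) auto
      then show ?thesis using False by simp
    qed (simp add: add_increasing2)
    then have "G x w * f w \<le> G x w * (1 + f w powr p)" by (intro mult_left_mono) auto
    also have "\<dots> \<le> G x w + ?C * f w powr p"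
      using G_le[OF t, of w] by (simp add: distrib_left mult_right_mono)
    finally show "norm (G x w * f w) \<le> norm (G x w + ?C * f w powr p)" using f0 by simp
  qed
qed

lemma U_nonneg: "admissible f \<Longrightarrow> 0 \<le> U f x"
  unfolding U_def admissible_def by (intro integral_nonneg_AE) auto

lemma ennreal_U:
  assumes "0 < snd x" "admissible f" shows "ennreal (U f x) = (\<integral>\<^sup>+w. ennreal (G x w * f w) \<partial>lborel)"
  unfolding U_def using integrable_G_mult[OF assms] assms
  by (intro nn_integral_eq_integral[symmetric]) (auto simp: admissible_def)

end

section \<open>Polarization in a conformal reflection\<close>

text \<open>The common features of hyperplane reflections and inversions. The map \<open>\<sigma>\<close> acts on the boundary with
  conformal factor \<open>\<rho>\<close>, and \<open>s\<close> is its extension to the half-space; \<open>S\<close> and \<open>H\<close> are the chosen halves.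
  Conformal covariance of the kernel is \<open>G_\<sigma>\<close>. That a point of \<open>H\<close> is closer, as seen by the kernel, to
  points of \<open>S\<close> than its mirror image is \<open>G_s_less\<close>; all rearrangement effects come from this axiom.\<close>

locale conformal_reflection = poisson_setting \<gamma> n a b p q dim
  for \<gamma> n a b p q :: real and dim :: "'n::finite itself" +
  fixes S :: "(real^'n) set" and H :: "((real^'n) \<times> real) set"
    and \<sigma> :: "real^'n \<Rightarrow> real^'n" and s :: "(real^'n) \<times> real \<Rightarrow> (real^'n) \<times> real"
    and \<rho> :: "real^'n \<Rightarrow> real"
  assumes S_meas [measurable]: "S \<in> sets borel" and H_meas [measurable]: "H \<in> sets borel"
    and \<sigma>_meas [measurable]: "\<sigma> \<in> borel_measurable borel"
    and s_meas [measurable]: "s \<in> borel_measurable borel"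
    and \<rho>_meas [measurable]: "\<rho> \<in> borel_measurable borel"
    and \<rho>_pos: "0 < \<rho> w" and \<sigma>_\<sigma> [simp]: "\<sigma> (\<sigma> w) = w" and \<rho>_\<sigma>: "\<rho> (\<sigma> w) * \<rho> w = 1"
    and S_disj: "w \<in> S \<Longrightarrow> \<sigma> w \<notin> S" and S_cover: "AE w in lborel. w \<in> S \<or> \<sigma> w \<in> S"
    and nn_integral_\<sigma>: "g \<in> borel_measurable borel \<Longrightarrow>
      (\<integral>\<^sup>+w. g w \<partial>lborel) = (\<integral>\<^sup>+w. ennreal (\<rho> w powr (2 * n)) * g (\<sigma> w) \<partial>lborel)"
    and s_pos: "0 < snd x \<Longrightarrow> 0 < snd (s x)" and s_s: "0 < snd x \<Longrightarrow> s (s x) = x"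
    and H_disj: "0 < snd x \<Longrightarrow> x \<in> H \<Longrightarrow> s x \<notin> H" and H_cover: "AE x in hyp. x \<in> H \<or> s x \<in> H"
    and nn_integral_s: "g' \<in> borel_measurable borel \<Longrightarrow> (\<integral>\<^sup>+x. g' x \<partial>hyp) = (\<integral>\<^sup>+x. g' (s x) \<partial>hyp)"
    and G_\<sigma>: "0 < snd x \<Longrightarrow> w \<in> S \<Longrightarrow> G x (\<sigma> w) * \<rho> w powr b = G (s x) w"
    and G_s_less: "0 < snd x \<Longrightarrow> x \<in> H \<Longrightarrow> w \<in> S \<Longrightarrow> G (s x) w < G x w"
    and H_nonnull: "emeasure hyp H \<noteq> 0"
begin

text \<open>With the weight \<open>a\<close> the action on functions preserves \<open>N\<close>, and \<open>U\<close> turns it into composition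
  with \<open>s\<close>.\<close>

definition reflect :: "(real^'n \<Rightarrow> real) \<Rightarrow> real^'n \<Rightarrow> real" where
  "reflect f w = \<rho> w powr a * f (\<sigma> w)"

definition polarize :: "(real^'n \<Rightarrow> real) \<Rightarrow> real^'n \<Rightarrow> real" where
  "polarize f w = (if w \<in> S then max (f w) (reflect f w) else min (f w) (reflect f w))"

lemma measurable_reflect [measurable]: "reflect f \<in> borel_measurable borel" if [measurable]: "f \<in> borel_measurable borel"
  unfolding reflect_def[abs_def] by measurable

lemma measurable_polarize [measurable]: "polarize f \<in> borel_measurable borel" if [measurable]: "f \<in> borel_measurable borel"
  unfolding polarize_def[abs_def] by measurable

lemma reflect_reflect [simp]: "reflect (reflect f) w = f w"
proof -
  have "reflect (reflect f) w = (\<rho> (\<sigma> w) * \<rho> w) powr a * f w"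
    by (simp add: reflect_def powr_mult)
  then show ?thesis by (simp add: \<rho>_\<sigma>)
qed

lemma reflect_mono: "f (\<sigma> w) \<le> g (\<sigma> w) \<Longrightarrow> reflect f w \<le> reflect g w"
  by (simp add: reflect_def mult_left_mono)

lemma reflect_nonneg: "(\<And>w. 0 \<le> f w) \<Longrightarrow> 0 \<le> reflect f w"
  by (simp add: reflect_def)

lemma reflect_polarize: "w \<in> S \<Longrightarrow> reflect (polarize f) w = min (f w) (reflect f w)"
proof -
  assume w: "w \<in> S"
  have c: "0 \<le> \<rho> w powr a" by simp
  have "reflect (polarize f) w = \<rho> w powr a * min (f (\<sigma> w)) (reflect f (\<sigma> w))"
    using S_disj[OF w] by (simp add: reflect_def[of "polarize f"] polarize_def)
  also have "\<dots> = min (reflect f w) (reflect (reflect f) w)"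
    by (simp only: reflect_def[of f w] reflect_def[of "reflect f" w] min_mult_distrib_left c if_True)
  finally show ?thesis by (simp add: min.commute)
qed

text \<open>The change of variables shows that inverse images of null sets are null sets, as \<open>\<rho>\<close> is positive.\<close>

lemma AE_\<sigma>: assumes "AE w in lborel. P w" shows "AE w in lborel. P (\<sigma> w)"
proof -
  obtain Z where Z: "{w. \<not> P w} \<subseteq> Z" "Z \<in> sets borel" "emeasure lborel Z = 0"
    using assms by (auto elim!: AE_E)
  have [measurable]: "Z \<in> sets borel" by fact
  have "(\<integral>\<^sup>+w. ennreal (\<rho> w powr (2 * n)) * indicator Z (\<sigma> w) \<partial>lborel) = (\<integral>\<^sup>+w. indicator Z w \<partial>lborel)"
    by (rule nn_integral_\<sigma>[symmetric]) measurable
  also have "\<dots> = 0" using Z by simp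
  finally have "AE w in lborel. ennreal (\<rho> w powr (2 * n)) * indicator Z (\<sigma> w) = 0"
    by (subst (asm) nn_integral_0_iff_AE) auto
  then show ?thesis
  proof eventually_elim
    case (elim w)
    then have "\<sigma> w \<notin> Z" using \<rho>_pos[of w] by (auto simp: indicator_def split: if_splits)
    then show ?case using Z(1) by auto
  qed
qed

text \<open>All integrals over the boundary are folded onto the half \<open>S\<close>.\<close>

lemma nn_integral_fold:
  assumes [measurable]: "g \<in> borel_measurable borel"
  shows "(\<integral>\<^sup>+w. g w * indicator (- S) w \<partial>lborel) = (\<integral>\<^sup>+w. ennreal (\<rho> w powr (2 * n)) * g (\<sigma> w) * indicator S w \<partial>lborel)"
    and "(\<integral>\<^sup>+w. g w \<partial>lborel) = (\<integral>\<^sup>+w. (g w + ennreal (\<rho> w powr (2 * n)) * g (\<sigma> w)) * indicator S w \<partial>lborel)"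
proof -
  have "(\<integral>\<^sup>+w. g w * indicator (- S) w \<partial>lborel)
      = (\<integral>\<^sup>+w. ennreal (\<rho> w powr (2 * n)) * (g (\<sigma> w) * indicator (- S) (\<sigma> w)) \<partial>lborel)"
    by (rule nn_integral_\<sigma>) measurable
  also have "\<dots> = (\<integral>\<^sup>+w. ennreal (\<rho> w powr (2 * n)) * g (\<sigma> w) * indicator S w \<partial>lborel)"
    using S_cover by (intro nn_integral_cong_AE) (auto elim!: eventually_mono dest: S_disj simp: indicator_def)
  finally show 1: "(\<integral>\<^sup>+w. g w * indicator (- S) w \<partial>lborel) = (\<integral>\<^sup>+w. ennreal (\<rho> w powr (2 * n)) * g (\<sigma> w) * indicator S w \<partial>lborel)" .
  have "(\<integral>\<^sup>+w. g w \<partial>lborel) = (\<integral>\<^sup>+w. g w * indicator S w + g w * indicator (- S) w \<partial>lborel)"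
    by (rule nn_integral_cong) (auto simp: indicator_def)
  also have "\<dots> = (\<integral>\<^sup>+w. g w * indicator S w \<partial>lborel) + (\<integral>\<^sup>+w. g w * indicator (- S) w \<partial>lborel)"
    by (rule nn_integral_add) measurable
  also have "\<dots> = (\<integral>\<^sup>+w. g w * indicator S w + ennreal (\<rho> w powr (2 * n)) * g (\<sigma> w) * indicator S w \<partial>lborel)"
    unfolding 1 by (rule nn_integral_add[symmetric]) measurable
  finally show "(\<integral>\<^sup>+w. g w \<partial>lborel) = (\<integral>\<^sup>+w. (g w + ennreal (\<rho> w powr (2 * n)) * g (\<sigma> w)) * indicator S w \<partial>lborel)"
    by (simp add: distrib_right)
qed

lemma nn_integral_hyp_fold:
  assumes [measurable]: "g \<in> borel_measurable borel"
  shows "(\<integral>\<^sup>+x. g x \<partial>hyp) = (\<integral>\<^sup>+x. (g x + g (s x)) * indicator H x \<partial>hyp)"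
proof -
  have [measurable]: "g \<in> borel_measurable hyp" "s \<in> hyp \<rightarrow>\<^sub>M borel" "H \<in> sets hyp"
    using assms by (simp_all add: measurable_cong_sets[OF sets_hyp refl])
  have "(\<integral>\<^sup>+x. g x * indicator (- H) x \<partial>hyp) = (\<integral>\<^sup>+x. g (s x) * indicator (- H) (s x) \<partial>hyp)"
    by (rule nn_integral_s) measurable
  also have "\<dots> = (\<integral>\<^sup>+x. g (s x) * indicator H x \<partial>hyp)"
  proof (rule nn_integral_cong_AE)
    show "AE x in hyp. g (s x) * indicator (- H) (s x) = g (s x) * indicator H x"
      using H_cover AE_hyp
    proof eventually_elim
      case (elim x)
      then show ?case using H_disj[of x] by (auto simp: indicator_def)
    qed
  qed
  finally have 1: "(\<integral>\<^sup>+x. g x * indicator (- H) x \<partial>hyp) = (\<integral>\<^sup>+x. g (s x) * indicator H x \<partial>hyp)" .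
  have "(\<integral>\<^sup>+x. g x \<partial>hyp) = (\<integral>\<^sup>+x. g x * indicator H x + g x * indicator (- H) x \<partial>hyp)"
    by (rule nn_integral_cong) (auto simp: indicator_def)
  also have "\<dots> = (\<integral>\<^sup>+x. g x * indicator H x \<partial>hyp) + (\<integral>\<^sup>+x. g x * indicator (- H) x \<partial>hyp)"
    by (rule nn_integral_add) measurable
  also have "\<dots> = (\<integral>\<^sup>+x. g x * indicator H x + g (s x) * indicator H x \<partial>hyp)"
    unfolding 1 by (rule nn_integral_add[symmetric]) measurable
  finally show ?thesis by (simp add: distrib_right)
qed

lemma \<rho>_powr_reflect: "(\<And>w. 0 \<le> f w) \<Longrightarrow> \<rho> w powr (2 * n) * f (\<sigma> w) powr p = reflect f w powr p"
  by (simp add: reflect_def powr_mult powr_powr a_times_p)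

lemma N_fold:
  assumes [measurable]: "f \<in> borel_measurable borel" and nn: "\<And>w. 0 \<le> f w"
  shows "N f = (\<integral>\<^sup>+w. ennreal (f w powr p + reflect f w powr p) * indicator S w \<partial>lborel)"
  unfolding N_def
  by (subst nn_integral_fold(2)) (auto simp: ennreal_mult[symmetric] \<rho>_powr_reflect nn)

lemma polarize_nonneg: "(\<And>w. 0 \<le> f w) \<Longrightarrow> 0 \<le> polarize f w"
  using reflect_nonneg[of f w] by (simp add: polarize_def le_max_iff_disj)

lemma N_polarize:
  assumes [measurable]: "f \<in> borel_measurable borel" and nn: "\<And>w. 0 \<le> f w"
  shows "N (polarize f) = N f"
proof -
  have "N (polarize f) = (\<integral>\<^sup>+w. ennreal (polarize f w powr p + reflect (polarize f) w powr p) * indicator S w \<partial>lborel)"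
    by (rule N_fold) (auto intro: polarize_nonneg nn)
  also have "\<dots> = (\<integral>\<^sup>+w. ennreal (f w powr p + reflect f w powr p) * indicator S w \<partial>lborel)"
    by (rule nn_integral_cong) (auto simp: indicator_def reflect_polarize polarize_def max_def min_def)
  also have "\<dots> = N f" by (rule N_fold[symmetric]) (use nn in auto)
  finally show ?thesis .
qed

lemma admissible_polarize: "admissible f \<Longrightarrow> admissible (polarize f)"
  unfolding admissible_def using N_polarize[of f] polarize_nonneg[of f] by auto

text \<open>The Jacobian \<open>\<rho>\<^bsup>2n\<^esup>\<close> of the folding splits into \<open>\<rho>\<^bsup>b\<^esup>\<close>, which the kernel absorbs, and \<open>\<rho>\<^bsup>a\<^esup>\<close>, which
  turns \<open>f\<close> into its reflected copy.\<close>

lemma U_fold: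
  assumes x: "0 < snd x" and f: "admissible f"
  shows "integrable lborel (\<lambda>w. (G x w * f w + G (s x) w * reflect f w) * indicator S w)"
    and "U f x = (LINT w|lborel. (G x w * f w + G (s x) w * reflect f w) * indicator S w)"
proof -
  have [measurable]: "f \<in> borel_measurable borel" and nn: "\<And>w. 0 \<le> f w" using f by (auto simp: admissible_def)
  let ?V = "\<lambda>w. (G x w * f w + G (s x) w * reflect f w) * indicator S w"
  have V0: "0 \<le> ?V w" for w using nn reflect_nonneg[of f w] by (simp add: indicator_def)
  have key: "\<rho> w powr (2 * n) * (G x (\<sigma> w) * f (\<sigma> w)) = G (s x) w * reflect f w" if "w \<in> S" for w
    unfolding G_\<sigma>[OF x that, symmetric] reflect_def a_plus_b[symmetric] by (simp add: powr_add)
  have eq: "(\<integral>\<^sup>+w. ennreal (?V w) \<partial>lborel) = ennreal (U f x)"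
    unfolding ennreal_U[OF x f]
    by (subst nn_integral_fold(2), measurable, rule nn_integral_cong)
       (use nn in \<open>auto simp: indicator_def ennreal_mult[symmetric] key reflect_nonneg ennreal_plus[symmetric] simp del: ennreal_plus\<close>)
  show int: "integrable lborel ?V"
    by (rule integrableI_nonneg) (auto simp: eq V0)
  have "ennreal (LINT w|lborel. ?V w) = ennreal (U f x)"
    using eq nn_integral_eq_integral[OF int] V0 by simp
  then show "U f x = (LINT w|lborel. ?V w)"
    using U_nonneg[OF f] V0 by (subst (asm) ennreal_inj) (auto intro: integral_nonneg_AE)
qed

lemma U_fold_s:
  assumes x: "0 < snd x" and f: "admissible f"
  shows "integrable lborel (\<lambda>w. (G (s x) w * f w + G x w * reflect f w) * indicator S w)"
    and "U f (s x) = (LINT w|lborel. (G (s x) w * f w + G x w * reflect f w) * indicator S w)"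
  using U_fold[OF s_pos[OF x] f] by (simp_all add: s_s[OF x])

text \<open>After folding, what polarization adds at \<open>x\<close> is the integral of \<open>G x w - G (s x) w > 0\<close> against the
  positive part of \<open>reflect f - f\<close> (compared with the value at \<open>x\<close>) or of \<open>f - reflect f\<close> (compared with
  the value at \<open>s x\<close>). If neither part vanishes, the new value at \<open>x\<close> exceeds both old values.\<close>

lemma U_polarize:
  assumes x: "0 < snd x" "x \<in> H" and f: "admissible f"
  shows "U (polarize f) x + U (polarize f) (s x) = U f x + U f (s x)"
    and "U f x \<le> U (polarize f) x" and "U f (s x) \<le> U (polarize f) x"
    and "\<not> (AE w in lborel. w \<in> S \<longrightarrow> reflect f w \<le> f w) \<Longrightarrow> U f x < U (polarize f) x"
    and "\<not> (AE w in lborel. w \<in> S \<longrightarrow> f w \<le> reflect f w) \<Longrightarrow> U f (s x) < U (polarize f) x"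
proof -
  have [measurable]: "f \<in> borel_measurable borel" using f by (auto simp: admissible_def)
  note P = admissible_polarize[OF f]
  note U = U_fold[OF x(1) f] U_fold_s[OF x(1) f] U_fold[OF x(1) P] U_fold_s[OF x(1) P]
  show "U (polarize f) x + U (polarize f) (s x) = U f x + U f (s x)"
    unfolding U(2,4,6,8)
    by (subst (1 2) Bochner_Integration.integral_add[symmetric], fact, fact, fact, fact,
        rule Bochner_Integration.integral_cong)
       (auto simp: indicator_def reflect_polarize polarize_def max_def min_def algebra_simps)
  let ?d1 = "\<lambda>w. (G x w - G (s x) w) * max 0 (reflect f w - f w) * indicator S w"
  let ?d2 = "\<lambda>w. (G x w - G (s x) w) * max 0 (f w - reflect f w) * indicator S w"
  have d1: "U (polarize f) x - U f x = (LINT w|lborel. ?d1 w)" "integrable lborel ?d1"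
  proof -
    have eq: "(G x w * polarize f w + G (s x) w * reflect (polarize f) w) * indicator S w
        - (G x w * f w + G (s x) w * reflect f w) * indicator S w = ?d1 w" for w
      by (auto simp: indicator_def reflect_polarize polarize_def max_def min_def algebra_simps)
    show "U (polarize f) x - U f x = (LINT w|lborel. ?d1 w)"
      unfolding U(2,6) eq[symmetric] by (rule Bochner_Integration.integral_diff[symmetric]) fact+
    show "integrable lborel ?d1"
      unfolding eq[symmetric] by (rule Bochner_Integration.integrable_diff) fact+
  qed
  have d2: "U (polarize f) x - U f (s x) = (LINT w|lborel. ?d2 w)" "integrable lborel ?d2"
  proof -
    have eq: "(G x w * polarize f w + G (s x) w * reflect (polarize f) w) * indicator S w
        - (G (s x) w * f w + G x w * reflect f w) * indicator S w = ?d2 w" for w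
      by (auto simp: indicator_def reflect_polarize polarize_def max_def min_def algebra_simps)
    show "U (polarize f) x - U f (s x) = (LINT w|lborel. ?d2 w)"
      unfolding U(4,6) eq[symmetric] by (rule Bochner_Integration.integral_diff[symmetric]) fact+
    show "integrable lborel ?d2"
      unfolding eq[symmetric] by (rule Bochner_Integration.integrable_diff) fact+
  qed
  have gl: "0 < G x w - G (s x) w" if "w \<in> S" for w using G_s_less[OF x that] by simp
  have nn: "0 \<le> ?d1 w" "0 \<le> ?d2 w" for w using gl[of w] by (auto simp: indicator_def)
  have "0 \<le> (LINT w|lborel. ?d1 w)" "0 \<le> (LINT w|lborel. ?d2 w)"
    using nn by (auto intro!: integral_nonneg_AE)
  then show le: "U f x \<le> U (polarize f) x" "U f (s x) \<le> U (polarize f) x" using d1 d2 by linarith+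
  show "U f x < U (polarize f) x" if "\<not> (AE w in lborel. w \<in> S \<longrightarrow> reflect f w \<le> f w)"
  proof (rule ccontr)
    assume "\<not> ?thesis"
    then have "(LINT w|lborel. ?d1 w) = 0" using le d1 by linarith
    then have "AE w in lborel. ?d1 w = 0"
      using integral_nonneg_eq_0_iff_AE[OF d1(2)] nn by simp
    then have "AE w in lborel. w \<in> S \<longrightarrow> reflect f w \<le> f w"
      by eventually_elim (use gl in \<open>force simp: max_def split: if_splits\<close>)
    with that show False by simp
  qed
  show "U f (s x) < U (polarize f) x" if "\<not> (AE w in lborel. w \<in> S \<longrightarrow> f w \<le> reflect f w)"
  proof (rule ccontr)
    assume "\<not> ?thesis"
    then have "(LINT w|lborel. ?d2 w) = 0" using le d2 by linarith
    then have "AE w in lborel. ?d2 w = 0"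
      using integral_nonneg_eq_0_iff_AE[OF d2(2)] nn by simp
    then have "AE w in lborel. w \<in> S \<longrightarrow> f w \<le> reflect f w"
      by eventually_elim (use gl in \<open>force simp: max_def split: if_splits\<close>)
    with that show False by simp
  qed
qed

lemma E_fold:
  assumes f: "admissible f"
  shows "E f = (\<integral>\<^sup>+x. ennreal (U f x powr q + U f (s x) powr q) * indicator H x \<partial>hyp)"
proof -
  have [measurable]: "f \<in> borel_measurable borel" using f by (auto simp: admissible_def)
  show ?thesis unfolding E_def by (subst nn_integral_hyp_fold) auto
qed

text \<open>The values at \<open>x\<close> and \<open>s x\<close> keep their sum while the larger one strictly grows, so by convexity of
  the power \<open>q\<close> the energy would strictly increase.\<close>

lemma polarization_dichotomy:
  assumes f: "admissible f" and fin: "E f < \<infinity>" and le: "E (polarize f) \<le> E f"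
  shows "(AE w in lborel. w \<in> S \<longrightarrow> reflect f w \<le> f w) \<or> (AE w in lborel. w \<in> S \<longrightarrow> f w \<le> reflect f w)"
proof (rule ccontr)
  assume "\<not> ?thesis"
  then have n: "\<not> (AE w in lborel. w \<in> S \<longrightarrow> reflect f w \<le> f w)" "\<not> (AE w in lborel. w \<in> S \<longrightarrow> f w \<le> reflect f w)"
    by auto
  have [measurable]: "f \<in> borel_measurable borel" using f by (auto simp: admissible_def)
  note P = admissible_polarize[OF f]
  let ?F = "\<lambda>f x. ennreal (U f x powr q + U f (s x) powr q) * indicator H x"
  have [measurable]: "s \<in> hyp \<rightarrow>\<^sub>M borel" "H \<in> sets hyp"
    by (simp_all add: measurable_cong_sets[OF sets_hyp refl])
  have lt: "U f x powr q + U f (s x) powr q < U (polarize f) x powr q + U (polarize f) (s x) powr q"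
    if "0 < snd x" "x \<in> H" for x
    using powr_sum_majorization(2)[of q "U f x" "U f (s x)" "U (polarize f) (s x)" "U (polarize f) x"]
      U_polarize[OF that f] n U_nonneg[OF f] U_nonneg[OF P] q_gt_2 by simp
  have "E f < E (polarize f)"
    unfolding E_fold[OF f] E_fold[OF P]
  proof (rule nn_integral_less)
    show "?F f \<in> borel_measurable hyp" "?F (polarize f) \<in> borel_measurable hyp" by measurable
    show "(\<integral>\<^sup>+x. ?F f x \<partial>hyp) \<noteq> \<infinity>" using fin E_fold[OF f] by simp
    show "AE x in hyp. ?F f x \<le> ?F (polarize f) x"
      using AE_hyp
    proof eventually_elim
      case (elim x)
      then show ?case using less_imp_le[OF lt[OF elim]] by (simp add: indicator_def ennreal_leI del: ennreal_plus)
    qed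
    show "\<not> (AE x in hyp. ?F (polarize f) x \<le> ?F f x)"
    proof
      assume "AE x in hyp. ?F (polarize f) x \<le> ?F f x"
      then have "AE x in hyp. x \<notin> H"
        using AE_hyp
      proof eventually_elim
        case (elim x)
        then show ?case using lt[OF elim(2)]
          by (auto simp: indicator_def ennreal_le_iff simp del: ennreal_plus)
      qed
      then have "emeasure hyp H = 0" by (subst (asm) AE_iff_measurable[of H]) auto
      then show False using H_nonnull by simp
    qed
  qed
  then show False using le by simp
qed

text \<open>The masses of the two halves are the integrals over \<open>S\<close> of \<open>f\<^bsup>p\<^esup>\<close> and of \<open>(reflect f)\<^bsup>p\<^esup>\<close>. Ordered
  functions with the same finite integral agree.\<close>

lemma symmetric_if_half:
  assumes f: "admissible f"
    and one_sided: "(AE w in lborel. w \<in> S \<longrightarrow> reflect f w \<le> f w) \<or> (AE w in lborel. w \<in> S \<longrightarrow> f w \<le> reflect f w)"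
    and half: "(\<integral>\<^sup>+w. ennreal (f w powr p) * indicator S w \<partial>lborel)
       = (\<integral>\<^sup>+w. ennreal (f w powr p) * indicator (- S) w \<partial>lborel)"
  shows "AE w in lborel. f w = reflect f w"
proof -
  have [measurable]: "f \<in> borel_measurable borel" and nn: "\<And>w. 0 \<le> f w" using f by (auto simp: admissible_def)
  let ?f = "\<lambda>w. ennreal (f w powr p) * indicator S w" and ?g = "\<lambda>w. ennreal (reflect f w powr p) * indicator S w"
  have p0: "0 < p" using p_gt_2 by simp
  have eq: "(\<integral>\<^sup>+w. ?f w \<partial>lborel) = (\<integral>\<^sup>+w. ?g w \<partial>lborel)"
    unfolding half by (subst nn_integral_fold(1)) (auto simp: ennreal_mult[symmetric] \<rho>_powr_reflect nn)
  have "(\<integral>\<^sup>+w. ?f w \<partial>lborel) \<le> N f"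
    unfolding N_def by (rule nn_integral_mono) (auto simp: indicator_def)
  then have fin: "(\<integral>\<^sup>+w. ?f w \<partial>lborel) \<noteq> \<infinity>" using f by (auto simp: admissible_def top_unique)
  have t0: "0 \<le> reflect f w" for w using nn by (rule reflect_nonneg)
  have inj: "f w = reflect f w" if "f w powr p = reflect f w powr p" for w
    using that nn[of w] t0[of w] p0 powr_inj[of p] by (metis less_irrefl powr_less_mono2 not_less_iff_gr_or_eq)
  have "AE w in lborel. ?f w = ?g w"
    using one_sided
  proof
    assume "AE w in lborel. w \<in> S \<longrightarrow> reflect f w \<le> f w"
    then have "AE w in lborel. ?g w \<le> ?f w"
      by eventually_elim (use p0 t0 in \<open>auto simp: indicator_def intro!: ennreal_leI powr_mono2\<close>)
    then have "AE w in lborel. ?g w = ?f w" by (intro AE_eq_if_nn_integral_eq) (use eq fin in auto)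
    then show ?thesis by eventually_elim simp
  next
    assume "AE w in lborel. w \<in> S \<longrightarrow> f w \<le> reflect f w"
    then have "AE w in lborel. ?f w \<le> ?g w"
      by eventually_elim (use p0 nn in \<open>auto simp: indicator_def intro!: ennreal_leI powr_mono2\<close>)
    then show ?thesis by (intro AE_eq_if_nn_integral_eq) (use eq fin in auto)
  qed
  then have S: "AE w in lborel. w \<in> S \<longrightarrow> f w = reflect f w"
    by eventually_elim (auto intro!: inj)
  show ?thesis
    using S AE_\<sigma>[OF S] S_cover
  proof eventually_elim
    case (elim w)
    show ?case
    proof (cases "w \<in> S")
      case False
      then have "f (\<sigma> w) = reflect f (\<sigma> w)" using elim by blast
      then have "reflect f w = reflect (reflect f) w" unfolding reflect_def[of f w] reflect_def[of "reflect f" w] by simp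
      then show ?thesis by simp
    qed (use elim in auto)
  qed
qed

lemma U_s_eq:
  assumes x: "0 < snd x" and f: "admissible f" and sym: "\<And>w. w \<in> S \<Longrightarrow> reflect f w = f w"
  shows "U f (s x) = U f x"
  unfolding U_fold(2)[OF x f] U_fold_s(2)[OF x f]
  by (rule Bochner_Integration.integral_cong) (auto simp: indicator_def sym)

end

section \<open>Inversions as conformal reflections\<close>

text \<open>The last product is positive exactly if \<open>z\<close> and \<open>v\<close> lie on the same side of the sphere. Every
  comparison of distances before and after an inversion is read off from this identity.\<close>

lemma norm_inversion_sub:
  assumes "z \<noteq> y"
  shows "(norm (inversion y r z - v))\<^sup>2 * (norm (z - y))\<^sup>2
     = r\<^sup>2 * (norm (z - v))\<^sup>2 + (r\<^sup>2 - (norm (z - y))\<^sup>2) * (r\<^sup>2 - (norm (v - y))\<^sup>2)"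
proof -
  define u w where "u = z - y" and "w = v - y"
  have u: "norm u \<noteq> 0" using assms by (simp add: u_def)
  have 1: "inversion y r z - v = (r / norm u)\<^sup>2 *\<^sub>R u - w"
    by (simp add: inversion_def u_def w_def)
  have 2: "z - v = u - w" by (simp add: u_def w_def)
  have e: "(norm (k *\<^sub>R u - w))\<^sup>2 = k\<^sup>2 * (norm u)\<^sup>2 - 2 * k * (u \<bullet> w) + (norm w)\<^sup>2" for k
    unfolding power2_norm_eq_inner
    by (simp add: inner_diff_left inner_diff_right inner_commute power2_eq_square algebra_simps)
  show ?thesis
    unfolding 1 2 e[of 1, simplified] e u_def[symmetric] w_def[symmetric]
    using u by (simp add: field_simps power2_eq_square)
qed

lemma AE_norm_neq: "AE w in lborel. norm (w - (y::'a::euclidean_space)) \<noteq> r"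
proof -
  have "{w. norm (w - y) = r} = sphere y r" by (auto simp: sphere_def dist_norm norm_minus_commute)
  moreover have "sphere y r \<in> null_sets lborel"
    using negligible_sphere[of y r] by (simp add: negligible_iff_null_sets null_sets_completion_iff borel_closed)
  ultimately show ?thesis by (intro AE_I'[of "sphere y r"]) auto
qed

lemma AE_neq: "AE w in lborel. w \<noteq> (y::'a::euclidean_space)"
  using AE_norm_neq[of y 0] by simp

lemma nn_integral_reflect_Basis:
  fixes k :: "'a::euclidean_space"
  assumes k: "k \<in> Basis" and [measurable]: "g \<in> borel_measurable borel"
  shows "(\<integral>\<^sup>+z. g z \<partial>lborel) = (\<integral>\<^sup>+z. g (z - (2 * (z \<bullet> k - c)) *\<^sub>R k) \<partial>lborel)"
proof -
  define d where "d j = (if j = k then - 1 else 1 :: real)" for j :: 'a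
  define T where "T x = (2 * c) *\<^sub>R k + (\<Sum>j\<in>Basis. (d j * (x \<bullet> j)) *\<^sub>R j)" for x
  have T: "T x = x - (2 * (x \<bullet> k - c)) *\<^sub>R k" for x
  proof -
    have "(\<Sum>j\<in>Basis. (d j * (x \<bullet> j)) *\<^sub>R j) = (\<Sum>j\<in>Basis. (x \<bullet> j) *\<^sub>R j - (if j = k then (2 * (x \<bullet> k)) *\<^sub>R k else 0))"
      by (rule sum.cong) (auto simp: d_def scaleR_left_diff_distrib[symmetric])
    also have "\<dots> = x - (2 * (x \<bullet> k)) *\<^sub>R k"
      using k by (simp add: sum_subtractf euclidean_representation)
    finally show ?thesis by (simp add: T_def algebra_simps)
  qed
  have Tm[measurable]: "T \<in> borel_measurable borel" unfolding T[abs_def] by measurable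
  have "lborel = density (distr lborel borel T) (\<lambda>_. (\<Prod>j\<in>Basis. \<bar>d j\<bar>))"
    unfolding T_def[abs_def] by (rule lborel_affine_euclidean) (auto simp: d_def)
  also have "(\<Prod>j\<in>Basis. \<bar>d j\<bar>) = 1" by (rule prod.neutral) (auto simp: d_def)
  finally have "lborel = distr lborel borel T" by (simp add: density_1 one_ennreal_def[symmetric])
  then have "(\<integral>\<^sup>+z. g z \<partial>lborel) = (\<integral>\<^sup>+z. g z \<partial>distr lborel borel T)" by simp
  also have "\<dots> = (\<integral>\<^sup>+z. g (T z) \<partial>lborel)" by (rule nn_integral_distr) measurable
  finally show ?thesis by (simp add: T)
qed

context poisson_setting begin

lemma AE_hypI: "AE x in lborel. P x \<Longrightarrow> AE x in hyp. P x"
  unfolding hyp_def by (subst AE_density) (auto elim!: eventually_mono)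

lemma hyp_open_nonnull:
  assumes A: "open A" "A \<noteq> {}" "\<And>x. x \<in> A \<Longrightarrow> 0 < snd x"
  shows "emeasure hyp A \<noteq> 0"
proof
  assume "emeasure hyp A = 0"
  then have "AE x in hyp. x \<notin> A" using A(1) by (subst AE_iff_measurable[of A]) auto
  then have "AE x in lborel. x \<notin> A"
    unfolding hyp_def by (subst (asm) AE_density) (auto elim!: eventually_mono dest: A(3))
  then have "A \<in> null_sets lborel" using A(1) by (subst (asm) AE_iff_null_sets[symmetric]) auto
  then have "negligible A" using A(1) by (simp add: negligible_iff_null_sets null_sets_completion_iff borel_open)
  then show False using open_not_negligible A by blast
qed

text \<open>Supplies points of the half-space at which a property holding almost everywhere is true.\<close>

lemma not_AE_hyp_outside: "\<not> (AE x in hyp. \<not> 0 < snd x)"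
proof
  let ?H = "{x :: (real^'n) \<times> real. 0 < snd x}"
  assume "AE x in hyp. \<not> 0 < snd x"
  moreover have op: "open ?H" by (intro open_Collect_less continuous_intros)
  ultimately have "emeasure hyp ?H = 0" by (subst (asm) AE_iff_measurable[of ?H]) auto
  moreover have "(0, 1) \<in> ?H" by simp
  then have "emeasure hyp ?H \<noteq> 0" by (intro hyp_open_nonnull[OF op]) blast+
  ultimately show False by simp
qed

text \<open>The sign \<open>e\<close> selects the interior (\<open>1\<close>) or the exterior (\<open>-1\<close>) as the preferred half. The centre
  belongs to neither half, since the inversion fixes it instead of sending it to infinity.\<close>

definition sphere_S :: "real \<Rightarrow> real^'n \<Rightarrow> real \<Rightarrow> (real^'n) set" where
  "sphere_S e y r = {w. w \<noteq> y \<and> 0 < e * (r\<^sup>2 - (norm (w - y))\<^sup>2)}"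

definition sphere_H :: "real \<Rightarrow> real^'n \<Rightarrow> real \<Rightarrow> ((real^'n) \<times> real) set" where
  "sphere_H e y r = {x. 0 < e * (r\<^sup>2 - (norm (x - (y, 0)))\<^sup>2)}"

text \<open>The value \<open>1\<close> at the centre keeps the factor positive and its product with the factor at the image
  equal to \<open>1\<close> everywhere.\<close>

definition sphere_\<rho> :: "real^'n \<Rightarrow> real \<Rightarrow> real^'n \<Rightarrow> real" where
  "sphere_\<rho> y r w = (if w = y then 1 else r / norm (w - y))"

lemma snd_inversion: "snd (inversion (y, 0) r x) = (r / norm (x - (y, 0)))\<^sup>2 * snd x"
  by (simp add: inversion_def)

lemma inversion_boundary: "inversion (y, 0) r (w, 0) = (inversion y r w, 0 :: real)"
  by (simp add: inversion_def norm_prod_def)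

lemma inversion_swaps_sides:
  assumes "z \<noteq> y" "0 < r"
  shows "r\<^sup>2 - (norm (inversion y r z - y))\<^sup>2 = - ((r / norm (z - y))\<^sup>2 * (r\<^sup>2 - (norm (z - y))\<^sup>2))"
  using assms by (simp add: norm_inversion_center field_simps power2_eq_square)

lemma inversion_side_iff:
  assumes "w \<noteq> y" "0 < r"
  shows "0 < e * (r\<^sup>2 - (norm (inversion y r w - y))\<^sup>2) \<longleftrightarrow> e * (r\<^sup>2 - (norm (w - y))\<^sup>2) < 0"
proof -
  have "e * (r\<^sup>2 - (norm (inversion y r w - y))\<^sup>2) = - ((r / norm (w - y))\<^sup>2 * (e * (r\<^sup>2 - (norm (w - y))\<^sup>2)))"
    using inversion_swaps_sides[OF assms] by simp
  moreover have "0 < (r / norm (w - y))\<^sup>2" using assms by simp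
  ultimately show ?thesis by (simp only: neg_0_less_iff_less mult_less_0_iff) auto
qed

lemma sphere_sides:
  assumes "norm (w - y) \<noteq> r" "0 < r" "e = 1 \<or> e = - 1"
  shows "0 < e * (r\<^sup>2 - (norm (w - y))\<^sup>2) \<or> e * (r\<^sup>2 - (norm (w - y))\<^sup>2) < 0"
proof -
  have "r\<^sup>2 \<noteq> (norm (w - y))\<^sup>2" using assms power2_eq_iff_nonneg[of r "norm (w - y)"] by auto
  then have "r\<^sup>2 < (norm (w - y))\<^sup>2 \<or> (norm (w - y))\<^sup>2 < r\<^sup>2" by linarith
  then show ?thesis using assms(3) by auto
qed

lemma halfspace_neq: "0 < snd x \<Longrightarrow> x \<noteq> (y, 0 :: real)" by auto

text \<open>An inversion multiplies heights by the square of its ratio and volumes by that ratio to the power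
  \<open>2 (n + 1)\<close>, so the density \<open>x\<^sub>N\<^bsup>-n-1\<^esup>\<close> compensates exactly.\<close>

lemma nn_integral_hyp_inversion:
  assumes r: "0 < r" and [measurable]: "g \<in> borel_measurable borel"
  shows "(\<integral>\<^sup>+x. g x \<partial>hyp) = (\<integral>\<^sup>+x. g (inversion (y, 0) r x) \<partial>hyp)"
proof -
  let ?W = "\<lambda>x :: (real^'n) \<times> real. indicator {0<..} (snd x) * snd x powr (- (n + 1)) :: real"
  let ?s = "inversion (y, 0) r"
  have [measurable]: "?W \<in> borel_measurable borel" by measurable
  have key: "(r / norm (x - (y, 0))) ^ (2 * (CARD('n) + 1)) * ?W (?s x) = ?W x" if x: "x \<noteq> (y, 0)" for x
  proof (cases "0 < snd x")
    case True
    define k where "k = r / norm (x - (y, 0))"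
    have k: "0 < k" using r x by (simp add: k_def)
    have "k ^ (2 * (CARD('n) + 1)) = k powr real (2 * (CARD('n) + 1))"
      using k by (rule powr_realpow[symmetric])
    also have "real (2 * (CARD('n) + 1)) = 2 * (n + 1)" by (simp add: n_def)
    finally have "k ^ (2 * (CARD('n) + 1)) = k powr (2 * (n + 1))" .
    moreover have "(k\<^sup>2 * snd x) powr (- (n + 1)) = k powr (- 2 * (n + 1)) * snd x powr (- (n + 1))"
      unfolding powr_mult using k by (simp add: powr_realpow[symmetric] powr_powr del: powr_numeral)
    ultimately have "k ^ (2 * (CARD('n) + 1)) * (k\<^sup>2 * snd x) powr (- (n + 1)) =
       (k powr (2 * (n + 1)) * k powr (- 2 * (n + 1))) * snd x powr (- (n + 1))" by simp
    also have "k powr (2 * (n + 1)) * k powr (- 2 * (n + 1)) = 1"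
      unfolding powr_add[symmetric] using k by simp
    finally have "k ^ (2 * (CARD('n) + 1)) * (k\<^sup>2 * snd x) powr (- (n + 1)) = snd x powr (- (n + 1))" by simp
    moreover have "0 < k\<^sup>2 * snd x" using k True by (intro mult_pos_pos zero_less_power)
    ultimately show ?thesis using True unfolding snd_inversion k_def[symmetric] by (simp add: indicator_def)
  next
    case False
    then have "\<not> 0 < snd (?s x)"
      unfolding snd_inversion by (simp add: not_less mult_nonneg_nonpos)
    then show ?thesis using False by (simp add: indicator_def)
  qed
  have "(\<integral>\<^sup>+x. g x \<partial>hyp) = (\<integral>\<^sup>+x. ennreal (?W x) * g x \<partial>lborel)"
    by (rule nn_integral_hyp) fact
  also have "\<dots> = (\<integral>\<^sup>+x. ennreal ((r / norm (x - (y, 0))) ^ (2 * (CARD('n) + 1))) * (ennreal (?W (?s x)) * g (?s x)) \<partial>lborel)"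
    by (rule nn_integral_inversion_pair[OF r]) measurable
  also have "\<dots> = (\<integral>\<^sup>+x. ennreal (?W x) * g (?s x) \<partial>lborel)"
  proof (rule nn_integral_cong_AE)
    show "AE x in lborel. ennreal ((r / norm (x - (y, 0))) ^ (2 * (CARD('n) + 1))) * (ennreal (?W (?s x)) * g (?s x))
       = ennreal (?W x) * g (?s x)"
      using AE_neq[of "(y, 0)"]
    proof eventually_elim
      case (elim x)
      show ?case unfolding key[OF elim, symmetric] using r
        by (subst ennreal_mult) (auto simp: mult.assoc)
    qed
  qed
  also have "\<dots> = (\<integral>\<^sup>+x. g (?s x) \<partial>hyp)"
    by (rule nn_integral_hyp[symmetric]) measurable
  finally show ?thesis .
qed

lemma G_inversion:
  assumes x: "0 < snd x" and w: "w \<noteq> y" and r: "0 < r"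
  shows "G x (inversion y r w) * (r / norm (w - y)) powr b = G (inversion (y, 0) r x) w"
proof -
  let ?X = "inversion (y, 0) r x" and ?d = "norm (w - y)" and ?D = "norm (x - (y, 0))"
  have d: "0 < ?d" using w by simp
  have D: "0 < ?D" using halfspace_neq[OF x] by simp
  have X0: "0 < snd ?X" unfolding snd_inversion using D r x by simp
  have ww: "(inversion (y,0) r (inversion y r w, 0 :: real)) = (w, 0)"
    unfolding inversion_boundary using r by simp
  have ne: "inversion y r w \<noteq> y" using w r by (simp add: inversion_eq_center_iff)
  have "(norm (?X - (w, 0)))\<^sup>2 = (r\<^sup>2 * norm (x - (inversion y r w, 0)) / (?D * norm ((inversion y r w, 0::real) - (y, 0))))\<^sup>2"
    using norm_inversion_diff[of x "(y,0)" "(inversion y r w, 0)" r] halfspace_neq[OF x] ne unfolding ww by auto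
  also have "norm ((inversion y r w, 0::real) - (y, 0)) = r\<^sup>2 / ?d"
    using norm_inversion_center[of r y w] r by (simp add: norm_prod_def)
  finally have eq: "(norm (?X - (w, 0)))\<^sup>2 = (?d / ?D)\<^sup>2 * (norm (x - (inversion y r w, 0)))\<^sup>2"
    using r by (simp add: power2_eq_square)
  have "snd ?X / (norm (?X - (w, 0)))\<^sup>2 = (r / ?d)\<^sup>2 * (snd x / (norm (x - (inversion y r w, 0)))\<^sup>2)"
    unfolding eq snd_inversion using d D by (simp add: field_simps power2_eq_square)
  then have "G ?X w = ((r / ?d)\<^sup>2 * (snd x / (norm (x - (inversion y r w, 0)))\<^sup>2)) powr (b / 2)"
    unfolding G_def by (rule arg_cong)
  also have "\<dots> = ((r / ?d)\<^sup>2) powr (b / 2) * G x (inversion y r w)"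
    unfolding G_def powr_mult ..
  also have "((r / ?d)\<^sup>2) powr (b / 2) = (r / ?d) powr b"
    using r d by (simp add: powr_realpow[symmetric] powr_powr del: powr_numeral)
  finally show ?thesis by simp
qed

text \<open>The strict inequality between kernels is \<open>norm_inversion_sub\<close> for a point of \<open>H\<close> and a boundary point
  of \<open>S\<close>, where both factors have the sign \<open>e\<close>.\<close>

lemma sphere_reflection:
  assumes r: "0 < r" and e: "e = 1 \<or> e = - 1"
  shows "conformal_reflection \<gamma> n a b p q (sphere_S e y r) (sphere_H e y r) (inversion y r) (inversion (y, 0) r) (sphere_\<rho> y r)"
proof
  show "sphere_S e y r \<in> sets borel" "sphere_H e y r \<in> sets borel" "sphere_\<rho> y r \<in> borel_measurable borel"
    unfolding sphere_S_def sphere_H_def sphere_\<rho>_def[abs_def] by measurable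
  show "inversion y r \<in> borel_measurable borel" "inversion (y, 0 :: real) r \<in> borel_measurable borel"
    by measurable
  show "0 < sphere_\<rho> y r w" for w using r by (simp add: sphere_\<rho>_def)
  show "inversion y r (inversion y r w) = w" for w using r by simp
  show "inversion (y, 0 :: real) r (inversion (y, 0) r w) = w" for w using r by simp
  show "sphere_\<rho> y r (inversion y r w) * sphere_\<rho> y r w = 1" for w
    using r by (auto simp: sphere_\<rho>_def inversion_eq_center_iff norm_inversion_center power2_eq_square)
  show "inversion y r w \<notin> sphere_S e y r" if "w \<in> sphere_S e y r" for w
    using that inversion_side_iff[OF _ r, of w y e] by (auto simp: sphere_S_def)
  show "AE w in lborel. w \<in> sphere_S e y r \<or> inversion y r w \<in> sphere_S e y r"
    using AE_norm_neq[of y r] AE_neq[of y]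
  proof eventually_elim
    case (elim w)
    then show ?case
      using sphere_sides[OF elim(1) r e] inversion_side_iff[OF elim(2) r, of e] r
      by (auto simp: sphere_S_def inversion_eq_center_iff)
  qed
  show "inversion (y, 0) r x \<notin> sphere_H e y r" if "0 < snd x" "x \<in> sphere_H e y r" for x
    using that inversion_side_iff[OF halfspace_neq[OF that(1), of y] r, of e] by (auto simp: sphere_H_def)
  show "AE x in hyp. x \<in> sphere_H e y r \<or> inversion (y, 0) r x \<in> sphere_H e y r"
    using AE_hypI[OF AE_norm_neq[of "(y, 0)" r]] AE_hypI[OF AE_neq[of "(y, 0)"]]
  proof eventually_elim
    case (elim x)
    then show ?case
      using sphere_sides[OF elim(1) r e] inversion_side_iff[OF elim(2) r, of e]
      by (auto simp: sphere_H_def)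
  qed
  show "0 < snd (inversion (y, 0::real) r x)" if "0 < snd x" for x
    unfolding snd_inversion using halfspace_neq[OF that, of y] r that by simp
  show "(\<integral>\<^sup>+x. g x \<partial>hyp) = (\<integral>\<^sup>+x. g (inversion (y, 0) r x) \<partial>hyp)" if "g \<in> borel_measurable borel" for g
    by (rule nn_integral_hyp_inversion[OF r that])
  show "(\<integral>\<^sup>+w. g w \<partial>lborel) = (\<integral>\<^sup>+w. ennreal (sphere_\<rho> y r w powr (2 * n)) * g (inversion y r w) \<partial>lborel)"
    if "g \<in> borel_measurable borel" for g
  proof -
    have "(\<integral>\<^sup>+w. g w \<partial>lborel) = (\<integral>\<^sup>+w. ennreal ((r / norm (w - y)) ^ (2 * CARD('n))) * g (inversion y r w) \<partial>lborel)"
      by (rule nn_integral_inversion[OF r that])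
    also have "\<dots> = (\<integral>\<^sup>+w. ennreal (sphere_\<rho> y r w powr (2 * n)) * g (inversion y r w) \<partial>lborel)"
    proof (rule nn_integral_cong_AE)
      show "AE w in lborel. ennreal ((r / norm (w - y)) ^ (2 * CARD('n))) * g (inversion y r w)
         = ennreal (sphere_\<rho> y r w powr (2 * n)) * g (inversion y r w)"
        using AE_neq[of y]
        by eventually_elim (use r in \<open>simp add: sphere_\<rho>_def n_def powr_realpow[symmetric]\<close>)
    qed
    finally show ?thesis .
  qed
  show "G x (inversion y r w) * sphere_\<rho> y r w powr b = G (inversion (y, 0) r x) w"
    if "0 < snd x" "w \<in> sphere_S e y r" for x w
    using that G_inversion[OF that(1) _ r, of w y] by (auto simp: sphere_S_def sphere_\<rho>_def)
  show "G (inversion (y, 0) r x) w < G x w" if x: "0 < snd x" "x \<in> sphere_H e y r" and w: "w \<in> sphere_S e y r" for x w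
  proof -
    let ?X = "inversion (y, 0) r x" and ?D = "norm (x - (y, 0))"
    have D: "0 < ?D" using halfspace_neq[OF x(1)] by simp
    have e2: "e * e = 1" using e by auto
    have "0 < (e * (r\<^sup>2 - ?D\<^sup>2)) * (e * (r\<^sup>2 - (norm (w - y))\<^sup>2))"
      by (rule mult_pos_pos) (use x w in \<open>auto simp: sphere_S_def sphere_H_def\<close>)
    also have "\<dots> = (e * e) * ((r\<^sup>2 - ?D\<^sup>2) * (r\<^sup>2 - (norm (w - y))\<^sup>2))" by (simp only: mult_ac)
    also have "\<dots> = (r\<^sup>2 - ?D\<^sup>2) * (r\<^sup>2 - (norm ((w, 0::real) - (y, 0)))\<^sup>2)" by (simp add: e2 norm_prod_def)
    also have "\<dots> = (norm (?X - (w, 0)))\<^sup>2 * ?D\<^sup>2 - r\<^sup>2 * (norm (x - (w, 0)))\<^sup>2"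
      using norm_inversion_sub[OF halfspace_neq[OF x(1)], of y r "(w, 0)"] by simp
    finally have lt: "r\<^sup>2 * (norm (x - (w, 0)))\<^sup>2 < (norm (?X - (w, 0)))\<^sup>2 * ?D\<^sup>2" by simp
    have pos: "0 < (norm (x - (w, 0)))\<^sup>2" "0 < (norm (?X - (w, 0)))\<^sup>2"
    proof -
      show 1: "0 < (norm (x - (w, 0)))\<^sup>2" using halfspace_neq[OF x(1)] by simp
      have "0 < r\<^sup>2 * (norm (x - (w, 0)))\<^sup>2" using 1 r by simp
      then have "0 < (norm (?X - (w, 0)))\<^sup>2 * ?D\<^sup>2" using lt by linarith
      then show "0 < (norm (?X - (w, 0)))\<^sup>2" by (auto simp: zero_less_mult_iff)
    qed
    have "snd ?X / (norm (?X - (w, 0)))\<^sup>2 = snd x * (r\<^sup>2 / ((norm (?X - (w, 0)))\<^sup>2 * ?D\<^sup>2))"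
      unfolding snd_inversion by (simp add: power_divide mult.commute)
    also have "\<dots> < snd x * (1 / (norm (x - (w, 0)))\<^sup>2)"
      using lt pos D x(1) by (intro mult_strict_left_mono) (auto simp: field_simps)
    finally have "snd ?X / (norm (?X - (w, 0)))\<^sup>2 < snd x / (norm (x - (w, 0)))\<^sup>2" by simp
    moreover have "0 \<le> snd ?X" unfolding snd_inversion using x(1) by simp
    ultimately show ?thesis unfolding G_def using b_pos by (intro powr_less_mono2) auto
  qed
  show "emeasure hyp (sphere_H e y r) \<noteq> 0"
  proof -
    let ?A = "sphere_H e y r \<inter> {x. 0 < snd x}"
    have op: "open ?A" unfolding sphere_H_def
      by (intro open_Int open_Collect_less continuous_intros)
    have "(y, r / 2) \<in> ?A \<or> (y, 2 * r) \<in> ?A"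
      using e r by (auto simp: sphere_H_def norm_prod_def power2_eq_square)
    then have "emeasure hyp ?A \<noteq> 0" by (intro hyp_open_nonnull op) auto
    then show ?thesis
      using emeasure_mono[of ?A "sphere_H e y r" hyp]
      by (auto simp: sphere_H_def)
  qed
qed

end

section \<open>Coordinate reflections and bubbles\<close>

text \<open>For a unit vector \<open>k\<close> this is the reflection in the hyperplane \<open>z \<bullet> k = c\<close>.\<close>

definition flip :: "'a::real_inner \<Rightarrow> real \<Rightarrow> 'a \<Rightarrow> 'a" where
  "flip k c z = z - (2 * (z \<bullet> k - c)) *\<^sub>R k"

lemma flip_inner: "norm k = 1 \<Longrightarrow> flip k c z \<bullet> k - c = - (z \<bullet> k - c)"
  by (simp add: flip_def inner_diff_left norm_eq_1)

lemma flip_flip [simp]: assumes "norm k = 1" shows "flip k c (flip k c z) = z"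
  unfolding flip_def[of k c "flip k c z"] flip_inner[OF assms]
  by (simp only: mult_minus_right scaleR_minus_left diff_minus_eq_add) (simp add: flip_def)

text \<open>The counterpart of \<open>norm_inversion_sub\<close> for hyperplanes.\<close>

lemma norm_flip_sub:
  assumes "norm k = 1"
  shows "(norm (flip k c z - v))\<^sup>2 = (norm (z - v))\<^sup>2 + 4 * (z \<bullet> k - c) * (v \<bullet> k - c)"
proof -
  have 1: "flip k c z - v = (z - v) - (2 * (z \<bullet> k - c)) *\<^sub>R k" by (simp add: flip_def)
  have e: "(norm (u - m *\<^sub>R k))\<^sup>2 = (norm u)\<^sup>2 - 2 * m * (u \<bullet> k) + m\<^sup>2" for u m
    unfolding power2_norm_eq_inner using assms
    by (simp add: inner_diff_left inner_diff_right inner_commute power2_eq_square norm_eq_1 algebra_simps)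
  show ?thesis unfolding 1 e by (simp add: inner_diff_left power2_eq_square algebra_simps)
qed

lemma norm_flip_flip:
  assumes k: "norm k = 1" shows "norm (flip k c z - flip k c v) = norm (z - v)"
proof -
  have "(norm (flip k c z - flip k c v))\<^sup>2 = (norm (z - flip k c v))\<^sup>2 + 4 * (z \<bullet> k - c) * (flip k c v \<bullet> k - c)"
    by (rule norm_flip_sub[OF k])
  also have "(norm (z - flip k c v))\<^sup>2 = (norm (v - z))\<^sup>2 + 4 * (v \<bullet> k - c) * (z \<bullet> k - c)"
    unfolding norm_minus_commute[of z] by (rule norm_flip_sub[OF k])
  also have "flip k c v \<bullet> k - c = - (v \<bullet> k - c)" by (rule flip_inner[OF k])
  finally have "(norm (flip k c z - flip k c v))\<^sup>2 = (norm (z - v))\<^sup>2"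
    by (simp add: norm_minus_commute algebra_simps)
  then show ?thesis by simp
qed

lemma borel_measurable_flip [measurable]: "flip (k::'a::euclidean_space) c \<in> borel_measurable borel"
  unfolding flip_def[abs_def] by measurable

lemma AE_inner_neq: "k \<in> Basis \<Longrightarrow> AE w in lborel. w \<bullet> (k::'a::euclidean_space) \<noteq> c"
proof -
  assume k: "k \<in> Basis"
  have "{w. w \<bullet> k = c} \<in> null_sets lborel"
    using negligible_standard_hyperplane[OF k, of c]
    by (simp add: negligible_iff_null_sets null_sets_completion_iff)
  then show ?thesis by (intro AE_I'[of "{w. w \<bullet> k = c}"]) auto
qed

context poisson_setting begin

abbreviation ax :: "'n \<Rightarrow> real^'n" where "ax i \<equiv> axis i 1"

definition plane_S :: "real \<Rightarrow> 'n \<Rightarrow> real \<Rightarrow> (real^'n) set" where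
  "plane_S e i c = {w. 0 < e * (w \<bullet> ax i - c)}"

definition plane_H :: "real \<Rightarrow> 'n \<Rightarrow> real \<Rightarrow> ((real^'n) \<times> real) set" where
  "plane_H e i c = {x. 0 < e * (x \<bullet> (ax i, 0) - c)}"

lemma ax_Basis: "ax i \<in> Basis" "(ax i, 0::real) \<in> Basis"
  by (auto simp: Basis_vec_def Basis_prod_def)

lemma norm_ax [simp]: "norm (ax i) = 1" "norm (ax i, 0::real) = 1"
  using norm_Basis[OF ax_Basis(1)] norm_Basis[OF ax_Basis(2)] by auto

lemma flip_boundary: "flip (ax i, 0) c (w, 0) = (flip (ax i) c w, 0 :: real)"
  by (simp add: flip_def)

lemma snd_flip: "snd (flip (ax i, 0) c x) = snd x"
  by (simp add: flip_def)

lemma plane_reflection: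
  assumes e: "e = 1 \<or> e = - 1"
  shows "conformal_reflection \<gamma> n a b p q (plane_S e i c) (plane_H e i c) (flip (ax i) c) (flip (ax i, 0) c) (\<lambda>_. 1)"
proof
  show "plane_S e i c \<in> sets borel" "plane_H e i c \<in> sets borel"
    unfolding plane_S_def plane_H_def by measurable
  show "flip (ax i) c \<in> borel_measurable borel" "flip (ax i, 0 :: real) c \<in> borel_measurable borel"
    by measurable
  show "(\<lambda>_. 1::real) \<in> borel_measurable borel" by simp
  show "(0::real) < 1" "(1::real) * 1 = 1" by auto
  show "flip (ax i) c (flip (ax i) c w) = w" for w by simp
  show "flip (ax i, 0::real) c (flip (ax i, 0) c w) = w" for w by simp
  show "flip (ax i) c w \<notin> plane_S e i c" if "w \<in> plane_S e i c" for w
    using that unfolding plane_S_def mem_Collect_eq flip_inner[OF norm_ax(1)] mult_minus_right by linarith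
  show "flip (ax i, 0) c x \<notin> plane_H e i c" if "0 < snd x" "x \<in> plane_H e i c" for x
    using that unfolding plane_H_def mem_Collect_eq flip_inner[OF norm_ax(2)] mult_minus_right by linarith
  have sides: "0 < e * (u - c) \<or> 0 < e * (- (u - c))" if "u \<noteq> c" for u using that e by auto
  show "AE w in lborel. w \<in> plane_S e i c \<or> flip (ax i) c w \<in> plane_S e i c"
    using AE_inner_neq[OF ax_Basis(1), of i c]
    by eventually_elim (unfold plane_S_def mem_Collect_eq flip_inner[OF norm_ax(1)], rule sides)
  show "AE x in hyp. x \<in> plane_H e i c \<or> flip (ax i, 0) c x \<in> plane_H e i c"
    using AE_hypI[OF AE_inner_neq[OF ax_Basis(2), of i c]]
    by eventually_elim (unfold plane_H_def mem_Collect_eq flip_inner[OF norm_ax(2)], rule sides)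
  show "0 < snd (flip (ax i, 0::real) c x)" if "0 < snd x" for x using that by (simp add: snd_flip)
  show "(\<integral>\<^sup>+w. g w \<partial>lborel) = (\<integral>\<^sup>+w. ennreal (1 powr (2 * n)) * g (flip (ax i) c w) \<partial>lborel)"
    if "g \<in> borel_measurable borel" for g
    using nn_integral_reflect_Basis[OF ax_Basis(1) that, of i c] by (simp add: flip_def)
  show "(\<integral>\<^sup>+x. g x \<partial>hyp) = (\<integral>\<^sup>+x. g (flip (ax i, 0) c x) \<partial>hyp)" if [measurable]: "g \<in> borel_measurable borel" for g
  proof -
    have "(\<integral>\<^sup>+x. g x \<partial>hyp) = (\<integral>\<^sup>+x. ennreal (indicator {0<..} (snd x) * snd x powr (- (n + 1))) * g x \<partial>lborel)"
      by (rule nn_integral_hyp) fact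
    also have "\<dots> = (\<integral>\<^sup>+x. ennreal (indicator {0<..} (snd x) * snd x powr (- (n + 1))) * g (flip (ax i, 0) c x) \<partial>lborel)"
      by (subst nn_integral_reflect_Basis[OF ax_Basis(2), of _ i c])
         (measurable, simp only: flip_def[symmetric] snd_flip)
    also have "\<dots> = (\<integral>\<^sup>+x. g (flip (ax i, 0) c x) \<partial>hyp)"
      by (rule nn_integral_hyp[symmetric]) measurable
    finally show ?thesis .
  qed
  show "G x (flip (ax i) c w) * 1 powr b = G (flip (ax i, 0) c x) w" if "0 < snd x" for x w
  proof -
    have "norm (flip (ax i, 0) c x - (w, 0)) = norm (x - (flip (ax i) c w, 0))"
      using norm_flip_flip[OF norm_ax(2), of i c x "(flip (ax i) c w, 0)"] by (simp add: flip_boundary)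
    then show ?thesis by (simp add: G_def snd_flip)
  qed
  show "G (flip (ax i, 0) c x) w < G x w" if x: "0 < snd x" "x \<in> plane_H e i c" and w: "w \<in> plane_S e i c" for x w
  proof -
    have "0 < (e * (x \<bullet> (ax i, 0) - c)) * (e * (w \<bullet> ax i - c))"
      by (rule mult_pos_pos) (use x w in \<open>auto simp: plane_S_def plane_H_def\<close>)
    also have "\<dots> = (x \<bullet> (ax i, 0) - c) * ((w, 0::real) \<bullet> (ax i, 0) - c)"
      using e by auto
    finally have lt: "(norm (x - (w, 0)))\<^sup>2 < (norm (flip (ax i, 0) c x - (w, 0)))\<^sup>2"
      unfolding norm_flip_sub[OF norm_ax(2)] mult.assoc by linarith
    moreover have pos: "0 < (norm (x - (w, 0)))\<^sup>2" using halfspace_neq[OF x(1)] by simp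
    ultimately have "snd x / (norm (flip (ax i, 0) c x - (w, 0)))\<^sup>2 < snd x / (norm (x - (w, 0)))\<^sup>2"
      using x(1) by (intro divide_strict_left_mono mult_pos_pos) auto
    then show ?thesis unfolding G_def snd_flip using b_pos x(1) by (intro powr_less_mono2) auto
  qed
  show "emeasure hyp (plane_H e i c) \<noteq> 0"
  proof -
    let ?A = "plane_H e i c \<inter> {x. 0 < snd x}"
    have op: "open ?A" unfolding plane_H_def
      by (intro open_Int open_Collect_less continuous_intros)
    have "((c + e) *\<^sub>R ax i, 1) \<in> ?A"
      using e by (auto simp: plane_H_def inner_axis_axis)
    then have "emeasure hyp ?A \<noteq> 0" by (intro hyp_open_nonnull op) auto
    then show ?thesis
      using emeasure_mono[of ?A "plane_H e i c" hyp]
      by (auto simp: plane_H_def)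
  qed
qed

definition bubble :: "real^'n \<Rightarrow> real \<Rightarrow> real^'n \<Rightarrow> real" where
  "bubble x0 \<mu> w = (\<mu> / (\<mu>\<^sup>2 + (norm (w - x0))\<^sup>2)) powr (a / 2)"

text \<open>A bubble has the form of the kernel \<open>G\<close> with \<open>(x0, \<mu>)\<close> as the point of the half-space and with exponent
  \<open>a / 2\<close>; this explains its behaviour under inversions.\<close>

lemma bubble_altdef: "bubble x0 \<mu> w = (\<mu> / (norm ((w, 0) - (x0, \<mu>)))\<^sup>2) powr (a / 2)"
  by (simp add: bubble_def norm_prod_def add.commute)

lemma bubble_pos: "0 < \<mu> \<Longrightarrow> 0 < bubble x0 \<mu> w"
  by (simp add: bubble_def add_pos_nonneg)

lemma measurable_bubble [measurable]: "bubble x0 \<mu> \<in> borel_measurable borel"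
  unfolding bubble_def[abs_def] by measurable

lemma bubble_le:
  assumes "0 < \<mu>" shows "bubble x0 \<mu> w \<le> (1 / \<mu>) powr (a / 2)"
proof -
  have "\<mu> / (\<mu>\<^sup>2 + (norm (w - x0))\<^sup>2) \<le> \<mu> / \<mu>\<^sup>2"
    using assms by (intro divide_left_mono) (auto intro!: mult_pos_pos add_pos_nonneg)
  also have "\<dots> = 1 / \<mu>" by (simp add: power2_eq_square)
  finally show ?thesis unfolding bubble_def using a_pos assms by (intro powr_mono2) auto
qed

text \<open>All bubbles arise from one by translation and dilation, which preserve \<open>N\<close> and \<open>E\<close>.\<close>

lemma bubble_similarity:
  assumes "0 < \<mu>" shows "bubble x0 \<mu> (x0 + \<mu> *\<^sub>R z) = \<mu> powr (- a / 2) * bubble 0 1 z"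
proof -
  have "\<mu>\<^sup>2 + (norm (x0 + \<mu> *\<^sub>R z - x0))\<^sup>2 = \<mu>\<^sup>2 * (1 + (norm z)\<^sup>2)"
    by (simp add: power_mult_distrib algebra_simps)
  then have eq: "\<mu> / (\<mu>\<^sup>2 + (norm (x0 + \<mu> *\<^sub>R z - x0))\<^sup>2) = \<mu> powr (-1) * (1 / (1 + (norm z)\<^sup>2))"
    using assms by (simp add: powr_minus_divide power2_eq_square)
  show ?thesis unfolding bubble_def eq powr_mult powr_powr by simp
qed

lemma nn_integral_similarity:
  fixes x0 :: "'a::euclidean_space"
  assumes "0 < \<mu>" and [measurable]: "g \<in> borel_measurable borel"
  shows "(\<integral>\<^sup>+z. g z \<partial>lborel) = (\<integral>\<^sup>+z. ennreal (\<mu> ^ DIM('a)) * g (x0 + \<mu> *\<^sub>R z) \<partial>lborel)"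
  using assms by (subst lborel_affine[of \<mu> x0]) (auto simp: nn_integral_density nn_integral_distr)

lemma N_bubble_eq: assumes \<mu>: "0 < \<mu>" shows "N (bubble x0 \<mu>) = N (bubble 0 1)"
proof -
  have "N (bubble x0 \<mu>) = (\<integral>\<^sup>+z. ennreal (\<mu> ^ CARD('n)) * ennreal (bubble x0 \<mu> (x0 + \<mu> *\<^sub>R z) powr p) \<partial>lborel)"
    unfolding N_def by (subst nn_integral_similarity[OF \<mu>, of _ x0]) auto
  also have "\<dots> = N (bubble 0 1)" unfolding N_def
  proof (rule nn_integral_cong)
    fix z
    have "\<mu> ^ CARD('n) * (\<mu> powr (- a / 2)) powr p = \<mu> powr n * \<mu> powr (- n)"
      using \<mu> a_times_p by (simp add: powr_powr n_def powr_realpow[symmetric])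
    also have "\<dots> = 1" using \<mu> by (simp add: powr_add[symmetric])
    finally have "\<mu> ^ CARD('n) * (bubble x0 \<mu> (x0 + \<mu> *\<^sub>R z) powr p) = bubble 0 1 z powr p"
      unfolding bubble_similarity[OF \<mu>] powr_mult by simp
    then show "ennreal (\<mu> ^ CARD('n)) * ennreal (bubble x0 \<mu> (x0 + \<mu> *\<^sub>R z) powr p) = ennreal (bubble 0 1 z powr p)"
      using \<mu> by (simp add: ennreal_mult[symmetric])
  qed
  finally show ?thesis .
qed

lemma admissible_bubble: assumes \<mu>: "0 < \<mu>" shows "admissible (bubble x0 \<mu>)"
proof -
  have "N (bubble 0 1) = (\<integral>\<^sup>+w. ennreal ((1 + (norm (w::real^'n))\<^sup>2) powr (- (2 * n) / 2)) \<partial>lborel)"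
    unfolding N_def
  proof (rule nn_integral_cong)
    fix w :: "real^'n"
    have "bubble 0 1 w = (1 + (norm w)\<^sup>2) powr (- (a / 2))"
      by (simp add: bubble_def powr_divide powr_minus_divide)
    then have "bubble 0 1 w powr p = (1 + (norm w)\<^sup>2) powr (- (a / 2) * p)"
      by (simp only: powr_powr)
    also have "- (a / 2) * p = - (2 * n) / 2" using a_times_p by simp
    finally show "ennreal (bubble 0 1 w powr p) = ennreal ((1 + (norm w)\<^sup>2) powr (- (2 * n) / 2))"
      by (rule arg_cong)
  qed
  also have "\<dots> < \<infinity>" using n_ge_1 by (intro nn_integral_decay_finite) (simp add: n_def)
  finally show ?thesis unfolding admissible_def N_bubble_eq[OF \<mu>] using bubble_pos[OF \<mu>] by (auto intro: less_imp_le)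
qed

lemma N_bubble_pos: assumes \<mu>: "0 < \<mu>" shows "0 < N (bubble x0 \<mu>)"
proof -
  have "N (bubble x0 \<mu>) \<noteq> 0"
  proof
    assume "N (bubble x0 \<mu>) = 0"
    then have "AE w in lborel. bubble x0 \<mu> w powr p = 0"
      unfolding N_def by (subst (asm) nn_integral_0_iff_AE) auto
    then have "AE w in (lborel :: (real^'n) measure). False"
      by (rule eventually_mono) (use bubble_pos[OF \<mu>, of x0] in \<open>simp add: less_imp_neq[symmetric]\<close>)
    then show False by (auto simp: eventually_ae_filter null_sets_def dest!: top.extremum_uniqueI)
  qed
  then show ?thesis by (simp add: zero_less_iff_neq_zero)
qed

lemma G_similarity:
  assumes \<mu>: "0 < \<mu>"
  shows "G ((x0, 0) + \<mu> *\<^sub>R x) (x0 + \<mu> *\<^sub>R z) = \<mu> powr (- b / 2) * G x z"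
proof -
  have "((x0, 0) + \<mu> *\<^sub>R x) - (x0 + \<mu> *\<^sub>R z, 0) = \<mu> *\<^sub>R (x - (z, 0))"
    by (simp add: prod_eq_iff algebra_simps)
  then have "(norm (((x0, 0) + \<mu> *\<^sub>R x) - (x0 + \<mu> *\<^sub>R z, 0)))\<^sup>2 = \<mu>\<^sup>2 * (norm (x - (z, 0)))\<^sup>2"
    by (simp add: power_mult_distrib)
  then have "snd ((x0, 0) + \<mu> *\<^sub>R x) / (norm (((x0, 0) + \<mu> *\<^sub>R x) - (x0 + \<mu> *\<^sub>R z, 0)))\<^sup>2
      = \<mu> powr (-1) * (snd x / (norm (x - (z, 0)))\<^sup>2)"
    using \<mu> by (simp add: power2_eq_square powr_minus_divide)
  then show ?thesis unfolding G_def by (simp only: powr_mult powr_powr) simp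
qed

lemma U_bubble_similarity:
  assumes \<mu>: "0 < \<mu>" and x: "0 < snd x"
  shows "U (bubble x0 \<mu>) ((x0, 0) + \<mu> *\<^sub>R x) = U (bubble 0 1) x"
proof -
  let ?x = "(x0, 0) + \<mu> *\<^sub>R x"
  have x': "0 < snd ?x" using \<mu> x by simp
  have "ennreal (U (bubble x0 \<mu>) ?x) = (\<integral>\<^sup>+z. ennreal (\<mu> ^ CARD('n)) * ennreal (G ?x (x0 + \<mu> *\<^sub>R z) * bubble x0 \<mu> (x0 + \<mu> *\<^sub>R z)) \<partial>lborel)"
    unfolding ennreal_U[OF x' admissible_bubble[OF \<mu>]] by (subst nn_integral_similarity[OF \<mu>, of _ x0]) auto
  also have "\<dots> = ennreal (U (bubble 0 1) x)"
    unfolding ennreal_U[OF x admissible_bubble[OF zero_less_one]]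
  proof (rule nn_integral_cong)
    fix z
    have "\<mu> ^ CARD('n) * (\<mu> powr (- b / 2) * \<mu> powr (- a / 2)) = \<mu> powr (n + (- b / 2 + - a / 2))"
      unfolding powr_add using \<mu> by (simp add: n_def powr_realpow)
    also have "n + (- b / 2 + - a / 2) = 0" using a_plus_b by linarith
    finally have "\<mu> ^ CARD('n) * (\<mu> powr (- b / 2) * \<mu> powr (- a / 2)) = 1" using \<mu> by simp
    then have "\<mu> ^ CARD('n) * (G ?x (x0 + \<mu> *\<^sub>R z) * bubble x0 \<mu> (x0 + \<mu> *\<^sub>R z)) = G x z * bubble 0 1 z"
      unfolding G_similarity[OF \<mu>] bubble_similarity[OF \<mu>]
      by (metis (no_types, lifting) mult.assoc mult.left_commute mult_1)
    then show "ennreal (\<mu> ^ CARD('n)) * ennreal (G ?x (x0 + \<mu> *\<^sub>R z) * bubble x0 \<mu> (x0 + \<mu> *\<^sub>R z)) = ennreal (G x z * bubble 0 1 z)"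
      using \<mu> by (subst ennreal_mult'[symmetric]) auto
  qed
  finally show ?thesis using U_nonneg admissible_bubble \<mu> by (subst (asm) ennreal_inj) auto
qed

lemma E_bubble_eq: assumes \<mu>: "0 < \<mu>" shows "E (bubble x0 \<mu>) = E (bubble 0 1)"
proof -
  let ?W = "\<lambda>x :: (real^'n) \<times> real. indicator {0<..} (snd x) * snd x powr (- (n + 1)) :: real"
  let ?T = "\<lambda>x. (x0, 0) + \<mu> *\<^sub>R x"
  have [measurable]: "?W \<in> borel_measurable borel" by measurable
  have "E (bubble x0 \<mu>) = (\<integral>\<^sup>+x. ennreal (?W x) * ennreal (U (bubble x0 \<mu>) x powr q) \<partial>lborel)"
    unfolding E_def by (rule nn_integral_hyp) measurable
  also have "\<dots> = (\<integral>\<^sup>+x. ennreal (\<mu> ^ DIM((real^'n) \<times> real)) * (ennreal (?W (?T x)) * ennreal (U (bubble x0 \<mu>) (?T x) powr q)) \<partial>lborel)"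
    by (rule nn_integral_similarity[OF \<mu>]) measurable
  also have "\<dots> = (\<integral>\<^sup>+x. ennreal (?W x) * ennreal (U (bubble 0 1) x powr q) \<partial>lborel)"
  proof (rule nn_integral_cong)
    fix x :: "(real^'n) \<times> real"
    show "ennreal (\<mu> ^ DIM((real^'n) \<times> real)) * (ennreal (?W (?T x)) * ennreal (U (bubble x0 \<mu>) (?T x) powr q))
       = ennreal (?W x) * ennreal (U (bubble 0 1) x powr q)"
    proof (cases "0 < snd x")
      case True
      have "\<mu> ^ DIM((real^'n) \<times> real) * (\<mu> * snd x) powr (- (n + 1)) = \<mu> powr ((n + 1) + - (n + 1)) * snd x powr (- (n + 1))"
        unfolding powr_add powr_mult by (simp only: powr_realpow[OF \<mu>, symmetric]) (simp add: n_def powr_add)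
      then have m: "\<mu> ^ DIM((real^'n) \<times> real) * ?W (?T x) = ?W x" using \<mu> True by (simp add: indicator_def)
      have "ennreal (\<mu> ^ DIM((real^'n) \<times> real)) * ennreal (?W (?T x)) = ennreal (?W x)"
        by (subst m[symmetric], rule ennreal_mult[symmetric]) (use \<mu> in auto)
      then show ?thesis unfolding U_bubble_similarity[OF \<mu> True] mult.assoc[symmetric] by (rule arg_cong)
    next
      case False
      then show ?thesis using \<mu> by (simp add: indicator_def zero_less_mult_iff)
    qed
  qed
  also have "\<dots> = E (bubble 0 1)"
    unfolding E_def by (rule nn_integral_hyp[symmetric]) measurable
  finally show ?thesis .
qed

end

section \<open>Reflected bubbles\<close>

context poisson_setting begin

abbreviation sphere_reflect :: "real^'n \<Rightarrow> real \<Rightarrow> (real^'n \<Rightarrow> real) \<Rightarrow> real^'n \<Rightarrow> real" where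
  "sphere_reflect y r f w \<equiv> sphere_\<rho> y r w powr a * f (inversion y r w)"

text \<open>The identity \<open>norm_inversion_sub\<close> for the points \<open>(w, 0)\<close> and \<open>(x0, \<mu>)\<close>. A bubble is symmetric in a sphere
  that contains \<open>(x0, \<mu>)\<close> after extension to the half-space, and otherwise lies above its reflected copy on
  the side of \<open>(x0, \<mu>)\<close>.\<close>

lemma sphere_reflect_bubble:
  assumes w: "w \<noteq> y" and r: "0 < r" and \<mu>: "0 < \<mu>"
  shows "sphere_reflect y r (bubble x0 \<mu>) w = (r\<^sup>2 * \<mu> / (r\<^sup>2 * (norm ((w, 0) - (x0, \<mu>)))\<^sup>2
     + (r\<^sup>2 - (norm (w - y))\<^sup>2) * (r\<^sup>2 - (\<mu>\<^sup>2 + (norm (y - x0))\<^sup>2)))) powr (a / 2)"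
proof -
  let ?d = "norm (w - y)"
  have d: "0 < ?d" using w by simp
  have "(norm ((x0, \<mu>) - (y, 0)))\<^sup>2 = \<mu>\<^sup>2 + (norm (y - x0))\<^sup>2"
    by (simp add: norm_prod_def norm_minus_commute)
  moreover have "(norm ((w, 0::real) - (y, 0)))\<^sup>2 = ?d\<^sup>2" by (simp add: norm_prod_def)
  moreover have "(norm (inversion (y, 0) r (w, 0) - (x0, \<mu>)))\<^sup>2 * (norm ((w, 0::real) - (y, 0)))\<^sup>2
     = r\<^sup>2 * (norm ((w, 0) - (x0, \<mu>)))\<^sup>2 + (r\<^sup>2 - (norm ((w, 0::real) - (y, 0)))\<^sup>2) * (r\<^sup>2 - (norm ((x0, \<mu>) - (y, 0)))\<^sup>2)"
    by (rule norm_inversion_sub) (use w in simp)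
  ultimately have eq: "(norm ((inversion y r w, 0) - (x0, \<mu>)))\<^sup>2 * ?d\<^sup>2
     = r\<^sup>2 * (norm ((w, 0) - (x0, \<mu>)))\<^sup>2 + (r\<^sup>2 - ?d\<^sup>2) * (r\<^sup>2 - (\<mu>\<^sup>2 + (norm (y - x0))\<^sup>2))"
    unfolding inversion_boundary by simp
  have "sphere_\<rho> y r w powr a = ((r / ?d)\<^sup>2) powr (a / 2)"
    using w r by (simp add: sphere_\<rho>_def powr_realpow[symmetric] powr_powr del: powr_numeral)
  then have "sphere_reflect y r (bubble x0 \<mu>) w = ((r / ?d)\<^sup>2 * (\<mu> / (norm ((inversion y r w, 0) - (x0, \<mu>)))\<^sup>2)) powr (a / 2)"
    unfolding bubble_altdef powr_mult by simp
  also have "(r / ?d)\<^sup>2 * (\<mu> / (norm ((inversion y r w, 0) - (x0, \<mu>)))\<^sup>2)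
    = r\<^sup>2 * \<mu> / ((norm ((inversion y r w, 0) - (x0, \<mu>)))\<^sup>2 * ?d\<^sup>2)"
    by (simp add: power_divide mult.commute)
  finally show ?thesis unfolding eq .
qed

lemma sphere_reflect_bubble_eq:
  assumes "w \<noteq> y" "0 < r" "0 < \<mu>" "r\<^sup>2 = \<mu>\<^sup>2 + (norm (y - x0))\<^sup>2"
  shows "sphere_reflect y r (bubble x0 \<mu>) w = bubble x0 \<mu> w"
  unfolding sphere_reflect_bubble[OF assms(1-3)] bubble_altdef[of x0 \<mu> w] assms(4)[symmetric] using assms by simp

lemma sphere_reflect_bubble_le:
  assumes r: "0 < r" and \<mu>: "0 < \<mu>" and w: "w \<in> sphere_S e y r" and e: "e = 1 \<or> e = - 1"
    and D: "0 \<le> e * (r\<^sup>2 - (\<mu>\<^sup>2 + (norm (y - x0))\<^sup>2))"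
  shows "sphere_reflect y r (bubble x0 \<mu>) w \<le> bubble x0 \<mu> w"
proof -
  have wy: "w \<noteq> y" and we: "0 \<le> e * (r\<^sup>2 - (norm (w - y))\<^sup>2)" using w by (auto simp: sphere_S_def)
  have "0 \<le> (e * (r\<^sup>2 - (norm (w - y))\<^sup>2)) * (e * (r\<^sup>2 - (\<mu>\<^sup>2 + (norm (y - x0))\<^sup>2)))"
    using we D by (rule mult_nonneg_nonneg)
  also have "\<dots> = (e * e) * ((r\<^sup>2 - (norm (w - y))\<^sup>2) * (r\<^sup>2 - (\<mu>\<^sup>2 + (norm (y - x0))\<^sup>2)))" by (simp only: mult_ac)
  finally have P: "0 \<le> (r\<^sup>2 - (norm (w - y))\<^sup>2) * (r\<^sup>2 - (\<mu>\<^sup>2 + (norm (y - x0))\<^sup>2))" using e by auto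
  have X: "0 < (norm ((w, 0) - (x0, \<mu>)))\<^sup>2" using \<mu> by (simp add: prod_eq_iff)
  have "r\<^sup>2 * \<mu> / (r\<^sup>2 * (norm ((w, 0) - (x0, \<mu>)))\<^sup>2 + (r\<^sup>2 - (norm (w - y))\<^sup>2) * (r\<^sup>2 - (\<mu>\<^sup>2 + (norm (y - x0))\<^sup>2)))
     \<le> r\<^sup>2 * \<mu> / (r\<^sup>2 * (norm ((w, 0) - (x0, \<mu>)))\<^sup>2)"
    using P X \<mu> r by (intro divide_left_mono mult_pos_pos add_pos_nonneg) auto
  also have "\<dots> = \<mu> / (norm ((w, 0) - (x0, \<mu>)))\<^sup>2" using r by simp
  finally show ?thesis unfolding sphere_reflect_bubble[OF wy r \<mu>] bubble_altdef[of x0 \<mu> w]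
    using a_pos P X \<mu> r by (intro powr_mono2) (auto intro!: divide_nonneg_nonneg add_nonneg_nonneg)
qed

lemma plane_reflect_bubble_le:
  assumes \<mu>: "0 < \<mu>" and w: "w \<in> plane_S e i c" and e: "e = 1 \<or> e = - 1"
    and D: "0 \<le> e * (x0 \<bullet> ax i - c)"
  shows "bubble x0 \<mu> (flip (ax i) c w) \<le> bubble x0 \<mu> w"
proof -
  have "0 \<le> (e * (w \<bullet> ax i - c)) * (e * (x0 \<bullet> ax i - c))"
    using w D by (auto simp: plane_S_def intro!: mult_nonneg_nonneg)
  also have "\<dots> = (e * e) * ((w \<bullet> ax i - c) * (x0 \<bullet> ax i - c))" by (simp only: mult_ac)
  finally have P: "0 \<le> (w \<bullet> ax i - c) * (x0 \<bullet> ax i - c)" using e by auto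
  have "(norm (w - x0))\<^sup>2 \<le> (norm (flip (ax i) c w - x0))\<^sup>2"
    unfolding norm_flip_sub[OF norm_ax(1)] mult.assoc using P by linarith
  then have "\<mu> / (\<mu>\<^sup>2 + (norm (flip (ax i) c w - x0))\<^sup>2) \<le> \<mu> / (\<mu>\<^sup>2 + (norm (w - x0))\<^sup>2)"
    using \<mu> by (intro divide_left_mono mult_pos_pos add_pos_nonneg) auto
  then show ?thesis unfolding bubble_def using a_pos \<mu> by (intro powr_mono2) auto
qed

lemma U_mono:
  assumes "0 < snd x" "admissible f" "admissible g" "\<And>w. f w \<le> g w"
  shows "U f x \<le> U g x"
  unfolding U_def using assms by (intro integral_mono integrable_G_mult mult_left_mono) auto

lemma U_le_of_bounded:
  assumes x: "0 < snd x" and f: "admissible f" and le: "\<And>w. f w \<le> 1"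
  shows "U f x \<le> enn2real (\<integral>\<^sup>+w. ennreal ((1 + (norm (w::real^'n))\<^sup>2) powr (- b / 2)) \<partial>lborel) * snd x powr (a / 2)"
proof -
  let ?I = "\<integral>\<^sup>+w. ennreal ((1 + (norm (w::real^'n))\<^sup>2) powr (- b / 2)) \<partial>lborel"
  have fin: "?I < \<infinity>" using b_gt_n by (intro nn_integral_decay_finite) (simp add: n_def)
  have "ennreal (U f x) \<le> (\<integral>\<^sup>+w. ennreal (G x w) \<partial>lborel)"
    unfolding ennreal_U[OF x f] using le by (intro nn_integral_mono ennreal_leI) (simp add: mult_left_le)
  also have "\<dots> = ennreal (enn2real ?I * snd x powr (a / 2))"
    unfolding nn_integral_G_eq[OF x] using fin by (simp add: ennreal_mult mult.commute)
  finally show ?thesis by (simp add: ennreal_le_iff)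
qed

lemma nn_integral_powr_unit:
  assumes "- 1 < s" shows "(\<integral>\<^sup>+t. ennreal (t powr s) * indicator {0..1} t \<partial>lborel) < \<infinity>"
proof -
  have "((\<lambda>t. t powr s) has_integral (1 powr (s + 1) / (s + 1))) {0..1}"
    by (rule has_integral_powr_from_0) (use assms in auto)
  then have "(\<integral>\<^sup>+t. ennreal (t powr s) * indicator {0..1} t \<partial>lborel) = ennreal (1 powr (s + 1) / (s + 1))"
    by (intro nn_integral_has_integral_lebesgue') auto
  then show ?thesis by simp
qed

text \<open>The inversion in the unit sphere fixes the bubble of \<open>(0, 1)\<close> and folds the half-space onto a half-ball.
  There the potential is bounded by a multiple of \<open>x\<^sub>N\<^bsup>a/2\<^esup>\<close>, and \<open>x\<^sub>N\<^bsup>a+2\<^esup>\<close> times the hyperbolic density is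
  \<open>x\<^sub>N\<^bsup>1-2\<gamma>\<^esup>\<close>, which is integrable at \<open>0\<close> as \<open>\<gamma> < 1\<close>.\<close>

lemma E_bubble_finite: assumes \<mu>: "0 < \<mu>" shows "E (bubble x0 \<mu>) < \<infinity>"
proof -
  let ?h = "bubble 0 1 :: real^'n \<Rightarrow> real"
  interpret R: conformal_reflection \<gamma> n a b p q "TYPE('n)" "sphere_S 1 0 1" "sphere_H 1 0 1" "inversion 0 1" "inversion (0, 0) 1" "sphere_\<rho> 0 1"
    by (rule sphere_reflection) auto
  have h: "admissible ?h" by (rule admissible_bubble) simp
  have h1: "?h w \<le> 1" for w using bubble_le[of 1 0 w] by simp
  have [measurable]: "cball (0::real^'n) 1 \<in> sets borel" "{0..1::real} \<in> sets borel" by auto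
  have gm [measurable]: "(\<lambda>x :: (real^'n) \<times> real. ennreal (snd x powr (a + 2)) * indicator (cball 0 1) (fst x) * indicator {0..1} (snd x))
     \<in> borel_measurable borel"
    by measurable
  define C where "C = enn2real (\<integral>\<^sup>+w. ennreal ((1 + (norm (w::real^'n))\<^sup>2) powr (- b / 2)) \<partial>lborel)"
  have C0: "0 \<le> C" by (simp add: C_def)
  have UC: "U ?h x powr q \<le> C powr q * snd x powr (a + 2)" if "0 < snd x" for x
  proof -
    have "U ?h x powr q \<le> (C * snd x powr (a / 2)) powr q"
      using U_le_of_bounded[OF that h h1] U_nonneg[OF h] q_gt_2 unfolding C_def by (intro powr_mono2) auto
    also have "\<dots> = C powr q * snd x powr (a / 2 * q)" unfolding powr_mult powr_powr ..
    also have "a / 2 * q = a + 2" using a_times_q by simp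
    finally show ?thesis .
  qed
  have sym: "R.reflect ?h w = ?h w" if "w \<in> sphere_S 1 0 1" for w
    unfolding R.reflect_def using that by (intro sphere_reflect_bubble_eq) (auto simp: sphere_S_def)
  have "E ?h = (\<integral>\<^sup>+x. ennreal (U ?h x powr q + U ?h (inversion (0, 0) 1 x) powr q) * indicator (sphere_H 1 0 1) x \<partial>hyp)"
    by (rule R.E_fold[OF h])
  also have "\<dots> \<le> (\<integral>\<^sup>+x. ennreal (2 * C powr q) * (ennreal (snd x powr (a + 2)) * indicator (cball 0 1) (fst x) * indicator {0..1} (snd x)) \<partial>hyp)"
  proof (rule nn_integral_mono_AE)
    show "AE x in hyp. ennreal (U ?h x powr q + U ?h (inversion (0, 0) 1 x) powr q) * indicator (sphere_H 1 0 1) x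
      \<le> ennreal (2 * C powr q) * (ennreal (snd x powr (a + 2)) * indicator (cball 0 1) (fst x) * indicator {0..1} (snd x))"
      using AE_hyp
    proof eventually_elim
      case (elim x)
      show ?case
      proof (cases "x \<in> sphere_H 1 0 1")
        case True
        then have "(norm (fst x))\<^sup>2 + (snd x)\<^sup>2 < 1" by (simp add: sphere_H_def norm_prod_def)
        then have "(norm (fst x))\<^sup>2 \<le> 1\<^sup>2" "(snd x)\<^sup>2 \<le> 1\<^sup>2"
          using zero_le_power2[of "norm (fst x)"] zero_le_power2[of "snd x"] unfolding one_power2 by linarith+
        then have "norm (fst x) \<le> 1" "snd x \<le> 1"
          using power2_le_imp_le[of "norm (fst x)" 1] power2_le_imp_le[of "snd x" 1] by auto
        moreover have "U ?h (inversion (0, 0) 1 x) = U ?h x"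
          by (rule R.U_s_eq[OF elim h sym])
        ultimately show ?thesis using True elim UC[OF elim]
          by (simp add: ennreal_mult[symmetric] del: ennreal_plus)
      qed simp
    qed
  qed
  also have "\<dots> = ennreal (2 * C powr q) * (\<integral>\<^sup>+x. (ennreal (snd x powr (a + 2)) * indicator (cball 0 1) (fst x) * indicator {0..1} (snd x)) \<partial>hyp)"
    by (rule nn_integral_cmult, subst measurable_cong_sets[OF sets_hyp refl]) (rule gm)
  finally have le: "E ?h \<le> ennreal (2 * C powr q) * (\<integral>\<^sup>+x. (ennreal (snd x powr (a + 2)) * indicator (cball 0 1) (fst x) * indicator {0..1} (snd x)) \<partial>hyp)" .
  have "(\<integral>\<^sup>+x. (ennreal (snd x powr (a + 2)) * indicator (cball 0 1) (fst x) * indicator {0..1} (snd x)) \<partial>hyp)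
     \<le> (\<integral>\<^sup>+x. indicator (cball (0::real^'n) 1) (fst x) * (ennreal (snd x powr (1 - 2 * \<gamma>)) * indicator {0..1} (snd x)) \<partial>(lborel \<Otimes>\<^sub>M lborel))"
    unfolding lborel_prod
  proof (subst nn_integral_hyp, measurable, rule nn_integral_mono)
    fix x :: "(real^'n) \<times> real"
    have "snd x powr (- (n + 1)) * snd x powr (a + 2) = snd x powr (1 - 2 * \<gamma>)"
      unfolding powr_add[symmetric] by (rule arg_cong) (simp add: a_def)
    then show "ennreal (indicator {0<..} (snd x) * snd x powr (- (n + 1))) *
        (ennreal (snd x powr (a + 2)) * indicator (cball 0 1) (fst x) * indicator {0..1} (snd x))
      \<le> indicator (cball 0 1) (fst x) * (ennreal (snd x powr (1 - 2 * \<gamma>)) * indicator {0..1} (snd x))"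
      by (auto simp: indicator_def ennreal_mult[symmetric])
  qed
  also have "\<dots> = (\<integral>\<^sup>+w. (\<integral>\<^sup>+t. indicator (cball (0::real^'n) 1) w * (ennreal (t powr (1 - 2 * \<gamma>)) * indicator {0..1} t) \<partial>lborel) \<partial>lborel)"
    by (subst lborel.nn_integral_fst[symmetric]) auto
  also have "\<dots> = emeasure lborel (cball (0::real^'n) 1) * (\<integral>\<^sup>+t. ennreal (t powr (1 - 2 * \<gamma>)) * indicator {0..1} t \<partial>lborel)"
    by (simp add: nn_integral_cmult nn_integral_multc)
  also have "\<dots> < \<infinity>"
    using nn_integral_powr_unit[of "1 - 2 * \<gamma>"] \<gamma> emeasure_bounded_finite[OF bounded_cball[of "0::real^'n" 1]]
    by (simp add: ennreal_mult_less_top)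
  finally show ?thesis unfolding E_bubble_eq[OF \<mu>]
    by (intro le_less_trans[OF le]) (simp add: ennreal_mult_less_top)
qed

end

section \<open>Bisecting the mass of a function\<close>

text \<open>The infimum of all levels below which at least half of the mass lies. Level sets are null sets, so
  the distribution function does not jump there.\<close>

lemma (in finite_measure) median_exists:
  assumes [measurable]: "\<phi> \<in> borel_measurable M" and null: "\<And>c. AE w in M. \<phi> w \<noteq> c"
    and pos: "measure M (space M) > 0"
  obtains c :: real where "measure M {w \<in> space M. \<phi> w < c} = measure M {w \<in> space M. c < \<phi> w}"
    "measure M {w \<in> space M. \<phi> w < c} = measure M (space M) / 2"
proof -
  let ?T = "measure M (space M)"
  define F where "F t = measure M {w \<in> space M. \<phi> w \<le> t}" for t
  have mono: "s \<le> t \<Longrightarrow> F s \<le> F t" for s t unfolding F_def by (intro finite_measure_mono) auto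
  have "(\<lambda>k. F (real k)) \<longlonglongrightarrow> measure M (\<Union>k. {w \<in> space M. \<phi> w \<le> real k})"
    unfolding F_def by (intro finite_Lim_measure_incseq) (auto simp: incseq_def intro: order_trans)
  also have "(\<Union>k. {w \<in> space M. \<phi> w \<le> real k}) = space M" using real_arch_simple by auto
  finally have "eventually (\<lambda>k. ?T / 2 < F (real k)) sequentially" by (rule order_tendstoD(1)) (use pos in simp)
  then obtain k1 where k1: "?T / 2 < F (real k1)"
    using eventually_happens'[OF sequentially_bot] by blast
  have "(\<lambda>k. F (- real k)) \<longlonglongrightarrow> measure M (\<Inter>k. {w \<in> space M. \<phi> w \<le> - real k})"
    unfolding F_def by (intro finite_Lim_measure_decseq) (auto simp: decseq_def intro: order_trans)
  also have "(\<Inter>k. {w \<in> space M. \<phi> w \<le> - real k}) = {}"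
  proof -
    have "\<exists>k. - real k < \<phi> w" for w using reals_Archimedean2[of "- \<phi> w"] by (auto simp: algebra_simps minus_less_iff)
    then show ?thesis by (force simp: not_le[symmetric])
  qed
  finally have "eventually (\<lambda>k. F (- real k) < ?T / 2) sequentially" by (rule order_tendstoD(2)) (use pos in simp)
  then obtain k2 where k2: "F (- real k2) < ?T / 2"
    using eventually_happens'[OF sequentially_bot] by blast
  define A where "A = {t. ?T / 2 \<le> F t}"
  have ne: "real k1 \<in> A" using k1 by (simp add: A_def)
  have bd: "- real k2 \<le> t" if "t \<in> A" for t
    using mono[of t "- real k2"] k2 that by (cases "t \<le> - real k2") (auto simp: A_def)
  have bdd: "bdd_below A" using bd by (rule bdd_belowI)
  define c where "c = Inf A"
  have below: "F t < ?T / 2" if "t < c" for t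
    using cInf_lower[OF _ bdd, of t] that by (auto simp: A_def c_def not_le[symmetric])
  have above: "?T / 2 \<le> F t" if t: "c < t" for t
  proof -
    obtain u where "u \<in> A" "u < t" using t ne cInf_less_iff[of A t] bdd unfolding c_def by blast
    then show ?thesis using mono[of u t] by (simp add: A_def)
  qed
  have "(\<lambda>k. F (c - 1 / real (Suc k))) \<longlonglongrightarrow> measure M (\<Union>k. {w \<in> space M. \<phi> w \<le> c - 1 / real (Suc k)})"
    unfolding F_def
  proof (intro finite_Lim_measure_incseq)
    show "incseq (\<lambda>k. {w \<in> space M. \<phi> w \<le> c - 1 / real (Suc k)})"
    proof (rule incseq_SucI, safe)
      fix k w assume "\<phi> w \<le> c - 1 / real (Suc k)"
      moreover have "1 / real (Suc (Suc k)) \<le> 1 / real (Suc k)" by (intro divide_left_mono) auto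
      ultimately show "\<phi> w \<le> c - 1 / real (Suc (Suc k))" by linarith
    qed
  qed auto
  also have "(\<Union>k. {w \<in> space M. \<phi> w \<le> c - 1 / real (Suc k)}) = {w \<in> space M. \<phi> w < c}"
  proof safe
    fix w k assume "\<phi> w \<le> c - 1 / real (Suc k)"
    moreover have "0 < 1 / real (Suc k)" by simp
    ultimately show "\<phi> w < c" by linarith
  next
    fix w assume w: "w \<in> space M" "\<phi> w < c"
    then obtain k where "1 / real (Suc k) < c - \<phi> w" using nat_approx_posE[of "c - \<phi> w"] by auto
    then show "w \<in> (\<Union>k. {w \<in> space M. \<phi> w \<le> c - 1 / real (Suc k)})" using w by (intro UN_I[of k]) auto
  qed
  finally have lt: "measure M {w \<in> space M. \<phi> w < c} \<le> ?T / 2"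
    by (rule LIMSEQ_le_const2) (intro exI allI impI less_imp_le below, simp)
  have "(\<lambda>k. F (c + 1 / real (Suc k))) \<longlonglongrightarrow> measure M (\<Inter>k. {w \<in> space M. \<phi> w \<le> c + 1 / real (Suc k)})"
    unfolding F_def
  proof (intro finite_Lim_measure_decseq)
    show "decseq (\<lambda>k. {w \<in> space M. \<phi> w \<le> c + 1 / real (Suc k)})"
    proof (rule decseq_SucI, safe)
      fix k w assume "\<phi> w \<le> c + 1 / real (Suc (Suc k))"
      moreover have "1 / real (Suc (Suc k)) \<le> 1 / real (Suc k)" by (intro divide_left_mono) auto
      ultimately show "\<phi> w \<le> c + 1 / real (Suc k)" by linarith
    qed
  qed auto
  also have "(\<Inter>k. {w \<in> space M. \<phi> w \<le> c + 1 / real (Suc k)}) = {w \<in> space M. \<phi> w \<le> c}"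
  proof safe
    fix w assume w: "w \<in> (\<Inter>k. {w \<in> space M. \<phi> w \<le> c + 1 / real (Suc k)})"
    then show "w \<in> space M" by auto
    show "\<phi> w \<le> c"
    proof (rule ccontr)
      assume "\<not> \<phi> w \<le> c"
      then obtain k where "1 / real (Suc k) < \<phi> w - c" using nat_approx_posE[of "\<phi> w - c"] by auto
      moreover have "\<phi> w \<le> c + 1 / real (Suc k)" using w by blast
      ultimately show False by linarith
    qed
  next
    fix w k assume "\<phi> w \<le> c"
    moreover have "0 < 1 / real (Suc k)" by simp
    ultimately show "\<phi> w \<le> c + 1 / real (Suc k)" by linarith
  qed
  finally have ge: "?T / 2 \<le> measure M {w \<in> space M. \<phi> w \<le> c}"
    by (rule LIMSEQ_le_const) (intro exI allI impI above, simp)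
  have eq: "measure M {w \<in> space M. \<phi> w \<le> c} = measure M {w \<in> space M. \<phi> w < c}"
    by (rule finite_measure_eq_AE) (use null[of c] in auto)
  have "measure M {w \<in> space M. c < \<phi> w} = ?T - measure M {w \<in> space M. \<phi> w \<le> c}"
    by (subst finite_measure_compl[symmetric]) (auto intro!: arg_cong[of _ _ "measure M"])
  then show thesis using that[of c] lt ge eq by linarith
qed

context poisson_setting begin

definition one_sided :: "((real^'n \<Rightarrow> real) \<Rightarrow> real^'n \<Rightarrow> real) \<Rightarrow> (real^'n) set \<Rightarrow> (real^'n \<Rightarrow> real) \<Rightarrow> bool" where
  "one_sided T S f \<longleftrightarrow> (AE w in lborel. w \<in> S \<longrightarrow> T f w \<le> f w) \<or> (AE w in lborel. w \<in> S \<longrightarrow> f w \<le> T f w)"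

abbreviation plane_reflect :: "'n \<Rightarrow> real \<Rightarrow> (real^'n \<Rightarrow> real) \<Rightarrow> real^'n \<Rightarrow> real" where
  "plane_reflect i c f w \<equiv> f (flip (ax i) c w)"

abbreviation mass :: "(real^'n \<Rightarrow> real) \<Rightarrow> (real^'n \<Rightarrow> bool) \<Rightarrow> ennreal" where
  "mass f P \<equiv> (\<integral>\<^sup>+w. ennreal (f w powr p) * indicator {w. P w} w \<partial>lborel)"

lemma mass_cong_AE: "AE w in lborel. P w = Q w \<Longrightarrow> mass f P = mass f Q"
  by (rule nn_integral_cong_AE) (auto elim!: eventually_mono simp: indicator_def)

lemma sphere_symmetric:
  assumes f: "admissible f" and r: "0 < r" and e: "e = 1 \<or> e = - 1" and d: "one_sided (sphere_reflect y r) (sphere_S e y r) f"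
    and half: "mass f (\<lambda>w. norm (w - y) < r) = mass f (\<lambda>w. r < norm (w - y))"
  shows "AE w in lborel. f w = sphere_reflect y r f w"
proof -
  interpret R: conformal_reflection \<gamma> n a b p q "TYPE('n)" "sphere_S e y r" "sphere_H e y r" "inversion y r" "inversion (y, 0) r" "sphere_\<rho> y r"
    by (rule sphere_reflection[OF r e])
  have sq: "norm u < r \<longleftrightarrow> (norm u)\<^sup>2 < r\<^sup>2" "r < norm u \<longleftrightarrow> r\<^sup>2 < (norm u)\<^sup>2" for u :: "real^'n"
    using r by (auto simp: power2_less_imp_less intro: power2_less_imp_less power_strict_mono)
  have "AE w in lborel. (w \<in> sphere_S e y r) = (if e = 1 then norm (w - y) < r else r < norm (w - y))"
    using AE_neq[of y] by eventually_elim (use e sq in \<open>auto simp: sphere_S_def\<close>)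
  then have 1: "mass f (\<lambda>w. w \<in> sphere_S e y r) = (if e = 1 then mass f (\<lambda>w. norm (w - y) < r) else mass f (\<lambda>w. r < norm (w - y)))"
    using mass_cong_AE[of "\<lambda>w. w \<in> sphere_S e y r" _ f] by (auto split: if_splits)
  have "AE w in lborel. (w \<in> - sphere_S e y r) = (if e = 1 then r < norm (w - y) else norm (w - y) < r)"
    using AE_neq[of y] AE_norm_neq[of y r]
  proof eventually_elim
    case (elim w)
    then have "norm (w - y) < r \<or> r < norm (w - y)" by linarith
    then show ?case using elim e sq[of "w - y"] by (auto simp: sphere_S_def)
  qed
  then have 2: "mass f (\<lambda>w. w \<in> - sphere_S e y r) = (if e = 1 then mass f (\<lambda>w. r < norm (w - y)) else mass f (\<lambda>w. norm (w - y) < r))"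
    using mass_cong_AE[of "\<lambda>w. w \<in> - sphere_S e y r" _ f] by (auto split: if_splits)
  have "mass f (\<lambda>w. w \<in> sphere_S e y r) = mass f (\<lambda>w. w \<in> - sphere_S e y r)"
    unfolding 1 2 using half by auto
  then have h: "(\<integral>\<^sup>+w. ennreal (f w powr p) * indicator (sphere_S e y r) w \<partial>lborel)
       = (\<integral>\<^sup>+w. ennreal (f w powr p) * indicator (- sphere_S e y r) w \<partial>lborel)"
    by (simp only: Collect_mem_eq)
  show ?thesis using R.symmetric_if_half[OF f _ h] d unfolding R.reflect_def one_sided_def by blast
qed

lemma plane_symmetric:
  assumes f: "admissible f" and e: "e = 1 \<or> e = - 1" and d: "one_sided (plane_reflect i c) (plane_S e i c) f"
    and half: "mass f (\<lambda>w. w \<bullet> ax i < c) = mass f (\<lambda>w. c < w \<bullet> ax i)"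
  shows "AE w in lborel. f w = f (flip (ax i) c w)"
proof -
  interpret R: conformal_reflection \<gamma> n a b p q "TYPE('n)" "plane_S e i c" "plane_H e i c" "flip (ax i) c" "flip (ax i, 0) c" "\<lambda>_. 1"
    by (rule plane_reflection[OF e])
  have reflect: "R.reflect f w = f (flip (ax i) c w)" for w by (simp add: R.reflect_def)
  have 1: "mass f (\<lambda>w. w \<in> plane_S e i c) = (if e = 1 then mass f (\<lambda>w. c < w \<bullet> ax i) else mass f (\<lambda>w. w \<bullet> ax i < c))"
    using e by (auto simp: plane_S_def)
  have "AE w in lborel. (w \<in> - plane_S e i c) = (if e = 1 then w \<bullet> ax i < c else c < w \<bullet> ax i)"
    using AE_inner_neq[OF ax_Basis(1), of i c]
    by eventually_elim (use e in \<open>auto simp: plane_S_def\<close>)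
  then have 2: "mass f (\<lambda>w. w \<in> - plane_S e i c) = (if e = 1 then mass f (\<lambda>w. w \<bullet> ax i < c) else mass f (\<lambda>w. c < w \<bullet> ax i))"
    using mass_cong_AE[of "\<lambda>w. w \<in> - plane_S e i c" _ f] by (auto split: if_splits)
  have "mass f (\<lambda>w. w \<in> plane_S e i c) = mass f (\<lambda>w. w \<in> - plane_S e i c)"
    unfolding 1 2 using half by auto
  then have h: "(\<integral>\<^sup>+w. ennreal (f w powr p) * indicator (plane_S e i c) w \<partial>lborel)
       = (\<integral>\<^sup>+w. ennreal (f w powr p) * indicator (- plane_S e i c) w \<partial>lborel)"
    by (simp only: Collect_mem_eq)
  show ?thesis using R.symmetric_if_half[OF f _ h] d unfolding reflect one_sided_def by blast
qed

lemma mass_median: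
  fixes \<phi> :: "real^'n \<Rightarrow> real"
  assumes f: "admissible f" and N: "N f \<noteq> 0" and [measurable]: "\<phi> \<in> borel_measurable borel"
    and null: "\<And>c. AE w in lborel. \<phi> w \<noteq> c"
  obtains c where "mass f (\<lambda>w. \<phi> w < c) = mass f (\<lambda>w. c < \<phi> w)" "mass f (\<lambda>w. \<phi> w < c) \<noteq> 0"
proof -
  have [measurable]: "f \<in> borel_measurable borel" using f by (auto simp: admissible_def)
  define M where "M = density lborel (\<lambda>w. ennreal (f w powr p))"
  have em: "emeasure M A = (\<integral>\<^sup>+w. ennreal (f w powr p) * indicator A w \<partial>lborel)" if "A \<in> sets borel" for A
    unfolding M_def using that by (subst emeasure_density) auto
  have sp: "space M = UNIV" "sets M = sets borel" by (auto simp: M_def)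
  have tot: "emeasure M (space M) = N f" unfolding sp by (subst em) (auto simp: N_def)
  interpret M: finite_measure M by standard (use f tot in \<open>auto simp: admissible_def\<close>)
  have pos: "0 < measure M (space M)"
    using tot N f unfolding M.emeasure_eq_measure by (metis ennreal_0 measure_nonneg order_le_less)
  have [measurable]: "\<phi> \<in> borel_measurable M" by (simp add: M_def)
  have "AE w in M. \<phi> w \<noteq> c" for c
    unfolding M_def by (subst AE_density) (use null[of c] in auto)
  then obtain c where c: "measure M {w \<in> space M. \<phi> w < c} = measure M {w \<in> space M. c < \<phi> w}"
    "measure M {w \<in> space M. \<phi> w < c} = measure M (space M) / 2"
    using M.median_exists[of \<phi>] pos by auto
  have "emeasure M {w. \<phi> w < c} = mass f (\<lambda>w. \<phi> w < c)" "emeasure M {w. c < \<phi> w} = mass f (\<lambda>w. c < \<phi> w)"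
    by (rule em, measurable)+
  moreover have "0 < measure M {w. \<phi> w < c}" using c(2) pos by (simp add: sp)
  then have "emeasure M {w. \<phi> w < c} \<noteq> 0" unfolding M.emeasure_eq_measure by simp
  moreover have "emeasure M {w. \<phi> w < c} = emeasure M {w. c < \<phi> w}"
    using c(1) unfolding M.emeasure_eq_measure by (simp add: sp)
  ultimately show thesis using that[of c] by metis
qed

text \<open>In the model where \<open>\<real>\<^sup>n\<close> is a round sphere, the inversion followed by the point reflection about \<open>x0\<close>
  is the antipodal map, and spheres with \<open>r\<^sup>2 = \<mu>\<^sup>2 + \<bar>y - x0\<bar>\<^sup>2\<close> are great spheres; antipodes lie on
  different sides of a great sphere.\<close>

lemma inversion_antipode:
  assumes wx: "w \<noteq> x0" and \<mu>: "0 < \<mu>" and r: "r\<^sup>2 = \<mu>\<^sup>2 + (norm (y - x0))\<^sup>2" "0 < r"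
  shows "norm (inversion x0 \<mu> w - (2 *\<^sub>R x0 - y)) < r \<longleftrightarrow> r < norm (w - y)"
proof -
  define u v where "u = w - x0" and "v = y - x0"
  have u: "0 < (norm u)\<^sup>2" using wx by (simp add: u_def)
  have 1: "w - (2 *\<^sub>R x0 - y) = u + v" "2 *\<^sub>R x0 - y - x0 = - v" "w - y = u - v"
    by (auto simp: u_def v_def scaleR_2)
  have eX: "(norm (inversion x0 \<mu> w - (2 *\<^sub>R x0 - y)))\<^sup>2 * (norm u)\<^sup>2
    = \<mu>\<^sup>2 * (norm (u + v))\<^sup>2 + (\<mu>\<^sup>2 - (norm u)\<^sup>2) * (\<mu>\<^sup>2 - (norm v)\<^sup>2)"
    using norm_inversion_sub[OF wx, of \<mu> "2 *\<^sub>R x0 - y"] unfolding 1 u_def[symmetric] norm_minus_cancel .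
  have eP: "(norm (u + v))\<^sup>2 = (norm u)\<^sup>2 + 2 * (u \<bullet> v) + (norm v)\<^sup>2"
    and eM: "(norm (u - v))\<^sup>2 = (norm u)\<^sup>2 - 2 * (u \<bullet> v) + (norm v)\<^sup>2"
    unfolding power2_norm_eq_inner by (auto simp: algebra_simps inner_commute)
  have "((norm (inversion x0 \<mu> w - (2 *\<^sub>R x0 - y)))\<^sup>2 - r\<^sup>2) * (norm u)\<^sup>2 = \<mu>\<^sup>2 * (r\<^sup>2 - (norm (w - y))\<^sup>2)"
    unfolding r 1(3) v_def[symmetric] left_diff_distrib eX eP eM by (simp add: algebra_simps)
  moreover have "(A - r\<^sup>2) * (norm u)\<^sup>2 < 0 \<longleftrightarrow> A < r\<^sup>2" for A
    using u by (simp add: mult_less_0_iff)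
  moreover have "\<mu>\<^sup>2 * (r\<^sup>2 - B) < 0 \<longleftrightarrow> r\<^sup>2 < B" for B
    using \<mu> by (simp add: mult_less_0_iff)
  ultimately have "(norm (inversion x0 \<mu> w - (2 *\<^sub>R x0 - y)))\<^sup>2 < r\<^sup>2 \<longleftrightarrow> r\<^sup>2 < (norm (w - y))\<^sup>2" by metis
  then show ?thesis using r(2)
    by (metis norm_ge_zero less_imp_le power2_less_imp_less power_strict_mono zero_less_numeral)
qed

text \<open>Two points at different distances from \<open>x0\<close> are exchanged by the inversion in exactly one great sphere:
  on the round sphere it lies in the perpendicular bisector of the two points. Points at equal distance are exchanged by a hyperplane
  reflection only and have to be left out.\<close>

lemma great_sphere_through:
  fixes x0 w z :: "real^'n"
  assumes \<mu>: "0 < \<mu>" and ne: "norm (z - x0) \<noteq> norm (w - x0)"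
  obtains y where "y \<noteq> w" "z = y + ((\<mu>\<^sup>2 + (norm (y - x0))\<^sup>2) / (norm (w - y))\<^sup>2) *\<^sub>R (w - y)"
proof -
  define X Z where "X = w - x0" and "Z = z - x0"
  define A B D where "A = \<mu>\<^sup>2 + (norm X)\<^sup>2" and "B = \<mu>\<^sup>2 + (norm Z)\<^sup>2" and "D = (norm X)\<^sup>2 - (norm Z)\<^sup>2"
  \<comment> \<open>the centre is the point of the line through \<open>w\<close> and \<open>z\<close> whose distances to them are in the ratio \<open>A : B\<close>\<close>
  define y where "y = w - (A / D) *\<^sub>R (X - Z)"
  have D: "D \<noteq> 0" using ne by (auto simp: D_def X_def Z_def power2_eq_iff_nonneg)
  have AB: "A - B = D" by (simp add: A_def B_def D_def)
  have A: "0 < A" unfolding A_def using \<mu> by (simp add: add_pos_nonneg)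
  have XZ: "0 < (norm (X - Z))\<^sup>2" using ne by (auto simp: X_def Z_def)
  have XZ': "X \<noteq> Z" using XZ by auto
  have wy: "w - y = (A / D) *\<^sub>R (X - Z)" by (simp add: y_def)
  have nwy: "(norm (w - y))\<^sup>2 = (A / D)\<^sup>2 * (norm (X - Z))\<^sup>2"
    unfolding wy norm_scaleR power_mult_distrib power2_abs ..
  have "y - x0 = X - (A / D) *\<^sub>R (X - Z)" by (simp add: y_def X_def)
  moreover have "(norm (X - t *\<^sub>R V))\<^sup>2 = (norm X)\<^sup>2 - 2 * t * (X \<bullet> V) + t\<^sup>2 * (norm V)\<^sup>2" for t and V :: "real^'n"
    unfolding power2_norm_eq_inner
    by (simp add: inner_diff_left inner_diff_right inner_commute power2_eq_square algebra_simps)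
  ultimately have e1: "(norm (y - x0))\<^sup>2 = (norm X)\<^sup>2 - 2 * (A / D) * (X \<bullet> (X - Z)) + (A / D)\<^sup>2 * (norm (X - Z))\<^sup>2"
    by metis
  have e2: "2 * (X \<bullet> (X - Z)) = D + (norm (X - Z))\<^sup>2"
    unfolding D_def power2_norm_eq_inner by (simp add: algebra_simps inner_commute)
  have e3: "(norm (y - x0))\<^sup>2 = (norm X)\<^sup>2 - (A / D) * (D + (norm (X - Z))\<^sup>2) + (A / D)\<^sup>2 * (norm (X - Z))\<^sup>2"
    unfolding e1 e2[symmetric] by (simp only: mult_ac)
  have "\<mu>\<^sup>2 + (norm (y - x0))\<^sup>2 = A - (A / D) * (D + (norm (X - Z))\<^sup>2) + (A / D)\<^sup>2 * (norm (X - Z))\<^sup>2"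
    using e3 A_def by linarith
  also have "\<dots> = A * (A - D) / D\<^sup>2 * (norm (X - Z))\<^sup>2"
    using D by (simp add: field_simps power2_eq_square)
  also have "A - D = B" using AB by simp
  finally have r: "(\<mu>\<^sup>2 + (norm (y - x0))\<^sup>2) / (norm (w - y))\<^sup>2 = B / A"
    unfolding nwy using A XZ' D by (simp add: field_simps power2_eq_square)
  have "y + (B / A) *\<^sub>R (w - y) = w - (A / D) *\<^sub>R (X - Z) + (B / D) *\<^sub>R (X - Z)"
    unfolding wy using A by (simp add: y_def)
  also have "\<dots> = w - ((A - B) / D) *\<^sub>R (X - Z)" by (simp add: diff_divide_distrib algebra_simps)
  also have "\<dots> = z" unfolding AB using D by (simp add: X_def Z_def)
  finally have "z = y + (B / A) *\<^sub>R (w - y)" ..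
  moreover have "y \<noteq> w" using A D XZ by (auto simp: y_def)
  ultimately show thesis using that[of y] r by simp
qed

end

section \<open>One-sided functions are bubbles\<close>

lemma AE_lborel_witness:
  assumes "AE w in (lborel :: 'a::euclidean_space measure). P w" shows "\<exists>w. P w"
proof (rule ccontr)
  assume "\<not> ?thesis"
  then have "AE w in (lborel :: 'a measure). False" using assms by simp
  then show False by (auto simp: eventually_ae_filter null_sets_def dest!: top.extremum_uniqueI)
qed

context poisson_setting begin

text \<open>The point reflection is the composition of the reflections in all coordinate hyperplanes through \<open>x0\<close>;
  they are composed one at a time, because each symmetry holds only almost everywhere.\<close>

lemma point_symmetric_if_plane_symmetric:
  assumes sym: "\<And>i. AE w in lborel. f w = f (flip (ax i) (x0 $ i) w)"
  shows "AE w in lborel. f (2 *\<^sub>R x0 - w) = f w"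
proof -
  define Fl where "Fl A w = (\<chi> j. if j \<in> A then 2 * x0 $ j - w $ j else w $ j)" for A and w :: "real^'n"
  have "AE w in lborel. f (Fl A w) = f w" if "finite A" for A
    using that
  proof induction
    case empty
    have "Fl {} w = w" for w by (simp add: Fl_def vec_eq_iff)
    then show ?case by simp
  next
    case (insert i A)
    interpret R: conformal_reflection \<gamma> n a b p q "TYPE('n)" "plane_S 1 i (x0 $ i)" "plane_H 1 i (x0 $ i)"
        "flip (ax i) (x0 $ i)" "flip (ax i, 0) (x0 $ i)" "\<lambda>_. 1"
      by (rule plane_reflection) simp
    have fl: "flip (ax i) (x0 $ i) w = (\<chi> j. if j = i then 2 * x0 $ j - w $ j else w $ j)" for w
      by (simp add: vec_eq_iff flip_def inner_axis) (simp add: axis_def)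
    have "Fl (insert i A) w = Fl A (flip (ax i) (x0 $ i) w)" for w
      unfolding fl using insert(2) by (auto simp: Fl_def vec_eq_iff)
    then show ?case
      using R.AE_\<sigma>[OF insert(3)] sym[of i] by (auto elim: eventually_elim2)
  qed
  then have "AE w in lborel. f (Fl UNIV w) = f w" by simp
  moreover have "Fl UNIV w = 2 *\<^sub>R x0 - w" for w by (simp add: Fl_def vec_eq_iff)
  ultimately show ?thesis by simp
qed

lemma mass_point_reflect:
  assumes [measurable]: "f \<in> borel_measurable borel" and sym: "AE w in lborel. f (2 *\<^sub>R x0 - w) = f w"
    and [measurable]: "Measurable.pred borel P"
  shows "mass f P = mass f (\<lambda>w. P (2 *\<^sub>R x0 - w))"
proof -
  let ?g = "\<lambda>w. ennreal (f w powr p) * indicator {w. P w} w"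
  have [measurable]: "{w. P w} \<in> sets borel" by measurable
  have "mass f P = (\<integral>\<^sup>+w. ?g (2 *\<^sub>R x0 - w) \<partial>lborel)"
    by (subst lborel_affine[of "- 1" "2 *\<^sub>R x0"]) (auto simp: nn_integral_density nn_integral_distr)
  also have "\<dots> = mass f (\<lambda>w. P (2 *\<^sub>R x0 - w))"
    by (rule nn_integral_cong_AE) (use sym in \<open>auto elim!: eventually_mono simp: indicator_def\<close>)
  finally show ?thesis .
qed

lemma mass_sphere_reflect:
  assumes f: "admissible f" and \<mu>: "0 < \<mu>" and sym: "AE w in lborel. f w = sphere_reflect x0 \<mu> f w"
    and [measurable]: "Measurable.pred borel P"
  shows "mass f P = mass f (\<lambda>w. P (inversion x0 \<mu> w))"
proof -
  have [measurable]: "f \<in> borel_measurable borel" and nn: "\<And>w. 0 \<le> f w" using f by (auto simp: admissible_def)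
  interpret R: conformal_reflection \<gamma> n a b p q "TYPE('n)" "sphere_S 1 x0 \<mu>" "sphere_H 1 x0 \<mu>" "inversion x0 \<mu>" "inversion (x0, 0) \<mu>" "sphere_\<rho> x0 \<mu>"
    by (rule sphere_reflection[OF \<mu>]) simp
  let ?g = "\<lambda>w. ennreal (f w powr p) * indicator {w. P w} w"
  have [measurable]: "{w. P w} \<in> sets borel" by measurable
  have "mass f P = (\<integral>\<^sup>+w. ennreal (sphere_\<rho> x0 \<mu> w powr (2 * n)) * ?g (inversion x0 \<mu> w) \<partial>lborel)"
    by (rule R.nn_integral_\<sigma>) measurable
  also have "\<dots> = mass f (\<lambda>w. P (inversion x0 \<mu> w))"
  proof (rule nn_integral_cong_AE)
    show "AE w in lborel. ennreal (sphere_\<rho> x0 \<mu> w powr (2 * n)) * ?g (inversion x0 \<mu> w)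
      = ennreal (f w powr p) * indicator {w. P (inversion x0 \<mu> w)} w"
      using sym
    proof eventually_elim
      case (elim w)
      have "sphere_\<rho> x0 \<mu> w powr (2 * n) * f (inversion x0 \<mu> w) powr p = f w powr p"
        using R.\<rho>_powr_reflect[OF nn, of w] elim by (simp add: R.reflect_def)
      then show ?case by (auto simp: indicator_def ennreal_mult[symmetric])
    qed
  qed
  finally show ?thesis .
qed

text \<open>The antipodal map preserves the mass of \<open>f\<close> and exchanges the two sides.\<close>

lemma mass_great_sphere:
  assumes f: "admissible f" and \<mu>: "0 < \<mu>" and sph: "AE w in lborel. f w = sphere_reflect x0 \<mu> f w"
    and pt: "AE w in lborel. f (2 *\<^sub>R x0 - w) = f w"
    and r: "0 < r" "r\<^sup>2 = \<mu>\<^sup>2 + (norm (y - x0))\<^sup>2"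
  shows "mass f (\<lambda>w. norm (w - y) < r) = mass f (\<lambda>w. r < norm (w - y))"
proof -
  have [measurable]: "f \<in> borel_measurable borel" using f by (auto simp: admissible_def)
  have "mass f (\<lambda>w. norm (w - y) < r) = mass f (\<lambda>w. norm (2 *\<^sub>R x0 - w - y) < r)"
    by (rule mass_point_reflect[OF _ pt]) measurable
  also have "\<dots> = mass f (\<lambda>w. norm (2 *\<^sub>R x0 - inversion x0 \<mu> w - y) < r)"
    by (rule mass_sphere_reflect[OF f \<mu> sph]) measurable
  also have "\<dots> = mass f (\<lambda>w. r < norm (w - y))"
  proof (rule mass_cong_AE)
    show "AE w in lborel. (norm (2 *\<^sub>R x0 - inversion x0 \<mu> w - y) < r) = (r < norm (w - y))"
      using AE_neq[of x0]
    proof eventually_elim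
      case (elim w)
      have "norm (2 *\<^sub>R x0 - inversion x0 \<mu> w - y) = norm (inversion x0 \<mu> w - (2 *\<^sub>R x0 - y))"
        by (subst norm_minus_commute) (simp add: algebra_simps)
      then show ?case using inversion_antipode[OF elim \<mu> r(2,1)] by simp
    qed
  qed
  finally show ?thesis .
qed

text \<open>By Fubini there is a single point \<open>w\<close> whose images under almost all inversions in great spheres carry
  the same value of \<open>g\<close>. The images cover everything but one sphere around \<open>x0\<close>, and the image depends
  differentiably on the centre, so the null set of exceptional centres produces only a null set of
  exceptional images.\<close>

lemma constant_if_great_sphere_invariant:
  fixes g :: "real^'n \<Rightarrow> real" and x0 :: "real^'n"
  assumes [measurable]: "g \<in> borel_measurable borel" and \<mu>: "0 < \<mu>"
    and inv: "\<And>y. AE w in lborel. g (inversion y (sqrt (\<mu>\<^sup>2 + (norm (y - x0))\<^sup>2)) w) = g w"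
  obtains c where "AE w in lborel. g w = c"
proof -
  let ?r = "\<lambda>y. sqrt (\<mu>\<^sup>2 + (norm (y - x0))\<^sup>2)"
  let ?\<Phi> = "\<lambda>w y. inversion y (?r y) w"
  have [measurable]: "(\<lambda>z :: (real^'n) \<times> (real^'n). ?\<Phi> (snd z) (fst z)) \<in> borel_measurable (lborel \<Otimes>\<^sub>M lborel)"
    unfolding inversion_def by measurable
  have m: "Measurable.pred (lborel \<Otimes>\<^sub>M lborel) (\<lambda>z :: (real^'n) \<times> (real^'n). g (?\<Phi> (snd z) (fst z)) = g (snd z))"
    by measurable
  have "AE y in lborel. AE w in lborel. g (?\<Phi> w y) = g w" using inv by simp
  then have "AE w in lborel. AE y in lborel. g (?\<Phi> w y) = g w"
    by (rule iffD1[OF lborel_pair.AE_commute[OF m[unfolded pred_def]]])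
  then obtain w where w: "AE y in lborel. g (?\<Phi> w y) = g w"
    using AE_lborel_witness by blast
  define Y where "Y = {y. y \<noteq> w \<and> g (?\<Phi> w y) \<noteq> g w}"
  have [measurable]: "(\<lambda>y. ?\<Phi> w y) \<in> borel_measurable borel" unfolding inversion_def by measurable
  have [measurable]: "Y \<in> sets borel" unfolding Y_def by measurable
  have "AE y in lborel. y \<notin> Y" using w by eventually_elim (simp add: Y_def)
  then have "Y \<in> null_sets lborel" by (subst (asm) AE_iff_null_sets[symmetric]) auto
  then have negY: "negligible Y" by (simp add: negligible_iff_null_sets null_sets_completion_iff)
  have \<Phi>: "?\<Phi> w y = y + ((\<mu>\<^sup>2 + (norm (y - x0))\<^sup>2) / (norm (w - y))\<^sup>2) *\<^sub>R (w - y)" for y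
    by (simp add: inversion_def power_divide add_nonneg_nonneg)
  have eq: "?\<Phi> w = (\<lambda>y. y + ((\<mu>\<^sup>2 + (y - x0) \<bullet> (y - x0)) / ((w - y) \<bullet> (w - y))) *\<^sub>R (w - y))"
    by (rule ext, simp only: \<Phi>) (simp only: power2_norm_eq_inner)
  have "?\<Phi> w differentiable_on Y"
    unfolding eq
  proof (rule differentiable_at_imp_differentiable_on)
    fix y assume "y \<in> Y"
    then have "(w - y) \<bullet> (w - y) \<noteq> 0" by (auto simp: Y_def)
    then show "(\<lambda>y. y + ((\<mu>\<^sup>2 + (y - x0) \<bullet> (y - x0)) / ((w - y) \<bullet> (w - y))) *\<^sub>R (w - y)) differentiable (at y)"
      by (intro derivative_intros differentiable_divide) auto
  qed
  then have neg: "negligible (?\<Phi> w ` Y)"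
    using negY by (intro negligible_differentiable_image_negligible) auto
  have "{z. g z \<noteq> g w} \<subseteq> sphere x0 (norm (w - x0)) \<union> ?\<Phi> w ` Y"
  proof
    fix z assume z: "z \<in> {z. g z \<noteq> g w}"
    show "z \<in> sphere x0 (norm (w - x0)) \<union> ?\<Phi> w ` Y"
    proof (cases "norm (z - x0) = norm (w - x0)")
      case True
      then show ?thesis by (simp add: dist_norm norm_minus_commute)
    next
      case False
      obtain y where "y \<noteq> w" "z = ?\<Phi> w y"
        using great_sphere_through[OF \<mu> False] unfolding \<Phi> by blast
      then show ?thesis using z by (auto simp: Y_def)
    qed
  qed
  then have "negligible {z. g z \<noteq> g w}"
    by (rule negligible_subset[rotated]) (intro negligible_Un negligible_sphere neg)
  moreover have [measurable]: "{z. g z \<noteq> g w} \<in> sets borel" by measurable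
  ultimately have "{z. g z \<noteq> g w} \<in> null_sets lborel" by (simp add: negligible_iff_null_sets null_sets_completion_iff)
  then have "AE z in lborel. g z = g w" by (intro AE_I'[of "{z. g z \<noteq> g w}"]) auto
  then show thesis by (rule that)
qed

theorem bubble_if_one_sided:
  assumes f: "admissible f" and N: "N f \<noteq> 0"
    and SD: "\<And>y r. 0 < r \<Longrightarrow> \<exists>e. (e = 1 \<or> e = - 1) \<and> one_sided (sphere_reflect y r) (sphere_S e y r) f"
    and PD: "\<And>i c. \<exists>e. (e = 1 \<or> e = - 1) \<and> one_sided (plane_reflect i c) (plane_S e i c) f"
  obtains c x0 \<mu> where "0 < c" "0 < \<mu>" "AE w in lborel. f w = c * bubble x0 \<mu> w"
proof -
  have [measurable]: "f \<in> borel_measurable borel" and nn: "\<And>w. 0 \<le> f w" using f by (auto simp: admissible_def)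
  have "\<exists>c. AE w in lborel. f w = f (flip (ax i) c w)" for i
  proof -
    obtain c where c: "mass f (\<lambda>w. w \<bullet> ax i < c) = mass f (\<lambda>w. c < w \<bullet> ax i)"
      using mass_median[OF f N, of "\<lambda>w. w \<bullet> ax i"] AE_inner_neq[OF ax_Basis(1), of i] by auto
    obtain e where "e = 1 \<or> e = - 1" "one_sided (plane_reflect i c) (plane_S e i c) f" using PD by blast
    then show ?thesis using plane_symmetric[OF f _ _ c] by blast
  qed
  then obtain c where c: "\<And>i. AE w in lborel. f w = f (flip (ax i) (c i) w)" by metis
  define x0 where "x0 = (\<chi> i. c i)"
  have pt: "AE w in lborel. f (2 *\<^sub>R x0 - w) = f w"
    by (rule point_symmetric_if_plane_symmetric) (use c in \<open>simp add: x0_def\<close>)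
  obtain \<mu> where half: "mass f (\<lambda>w. norm (w - x0) < \<mu>) = mass f (\<lambda>w. \<mu> < norm (w - x0))"
    and nz: "mass f (\<lambda>w. norm (w - x0) < \<mu>) \<noteq> 0"
    using mass_median[OF f N, of "\<lambda>w. norm (w - x0)"] AE_norm_neq[of x0] by auto
  have \<mu>: "0 < \<mu>"
  proof (rule ccontr)
    assume "\<not> 0 < \<mu>"
    then have "{w. norm (w - x0) < \<mu>} = {}" by (auto simp: not_less intro: order_trans[OF _ norm_ge_zero])
    then show False using nz by simp
  qed
  have sph: "AE w in lborel. f w = sphere_reflect y r f w"
    if r: "0 < r" and h: "mass f (\<lambda>w. norm (w - y) < r) = mass f (\<lambda>w. r < norm (w - y))" for y r
  proof -
    obtain e where "e = 1 \<or> e = - 1" "one_sided (sphere_reflect y r) (sphere_S e y r) f" using SD[OF r] by blast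
    then show ?thesis using sphere_symmetric[OF f r _ _ h] by blast
  qed
  note sph0 = sph[OF \<mu> half]
  let ?h = "bubble x0 \<mu>"
  let ?g = "\<lambda>w. f w / ?h w"
  have h0: "0 < ?h w" for w using bubble_pos[OF \<mu>] .
  have "AE w in lborel. ?g (inversion y (sqrt (\<mu>\<^sup>2 + (norm (y - x0))\<^sup>2)) w) = ?g w" for y
  proof -
    let ?r = "sqrt (\<mu>\<^sup>2 + (norm (y - x0))\<^sup>2)"
    have r: "0 < ?r" "?r\<^sup>2 = \<mu>\<^sup>2 + (norm (y - x0))\<^sup>2" using \<mu> by (auto simp: add_pos_nonneg)
    have "AE w in lborel. f w = sphere_reflect y ?r f w"
      by (rule sph[OF r(1) mass_great_sphere[OF f \<mu> sph0 pt r]])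
    then show ?thesis using AE_neq[of y]
    proof eventually_elim
      case (elim w)
      have "?h w = sphere_reflect y ?r ?h w" using sphere_reflect_bubble_eq[OF elim(2) r(1) \<mu> r(2)] by simp
      moreover have "0 < sphere_\<rho> y ?r w"
        unfolding sphere_\<rho>_def using elim r(1) by (auto intro!: divide_pos_pos simp del: real_sqrt_gt_0_iff)
      then have "0 < sphere_\<rho> y ?r w powr a" by simp
      ultimately show ?case using elim(1) by (metis less_irrefl mult_divide_mult_cancel_left)
    qed
  qed
  then obtain c where c: "AE w in lborel. ?g w = c"
    using constant_if_great_sphere_invariant[of ?g \<mu> x0] \<mu> by auto
  then have fc: "AE w in lborel. f w = c * ?h w"
    by eventually_elim (use h0 in \<open>auto simp: field_simps less_imp_neq[symmetric]\<close>)
  have "0 < c"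
  proof (rule ccontr)
    assume nc: "\<not> 0 < c"
    have "AE w in lborel. ennreal (f w powr p) = 0"
      using fc
    proof eventually_elim
      case (elim w)
      have "c * ?h w \<le> 0" using nc h0[of w] by (simp add: mult_nonpos_nonneg)
      then have "f w = 0" using elim nn[of w] by simp
      then show ?case by simp
    qed
    then have "N f = 0" unfolding N_def by (subst nn_integral_0_iff_AE) auto
    then show False using N by simp
  qed
  then show thesis using that \<mu> fc by blast
qed

end

section \<open>Functions dominated by a bubble\<close>

context poisson_setting begin

abbreviation h :: "real^'n \<Rightarrow> real" where "h \<equiv> bubble 0 1"

lemma h_pos: "0 < h w" by (rule bubble_pos) simp

lemma admissible_h: "admissible h" by (rule admissible_bubble) simp

lemma admissible_cmult: assumes f: "admissible f" and c: "0 \<le> c" shows "admissible (\<lambda>w. c * f w)"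
proof -
  have [measurable]: "f \<in> borel_measurable borel" using f by (simp add: admissible_def)
  have "N (\<lambda>w. c * f w) = ennreal (c powr p) * N f"
    unfolding N_def by (subst nn_integral_cmult[symmetric]) (auto simp: powr_mult ennreal_mult[symmetric] intro!: nn_integral_cong)
  then show ?thesis using f c by (auto simp: admissible_def ennreal_mult_less_top)
qed

lemma N_cmult: assumes [measurable]: "f \<in> borel_measurable borel" shows "N (\<lambda>w. c * f w) = ennreal (c powr p) * N f"
  unfolding N_def by (subst nn_integral_cmult[symmetric]) (auto simp: powr_mult ennreal_mult[symmetric] intro!: nn_integral_cong)

lemma U_cmult: "U (\<lambda>w. c * f w) x = c * U f x"
  unfolding U_def by (simp add: mult.left_commute)

lemma E_cmult: assumes [measurable]: "f \<in> borel_measurable borel" shows "E (\<lambda>w. c * f w) = ennreal (c powr q) * E f"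
  unfolding E_def U_cmult
  by (subst nn_integral_cmult[symmetric])
     (auto simp: powr_mult ennreal_mult[symmetric] measurable_cong_sets[OF sets_hyp refl] intro!: nn_integral_cong)

text \<open>The functions of mass at most \<open>1\<close> below \<open>M\<close> times the standard bubble: domination by an integrable
  bound makes the class compact for the convergence of potentials.\<close>

definition capped :: "real \<Rightarrow> (real^'n \<Rightarrow> real) set" where
  "capped M = {f \<in> borel_measurable borel. (\<forall>w. 0 \<le> f w \<and> f w \<le> M * h w) \<and> N f \<le> 1}"

lemma capped_admissible: "f \<in> capped M \<Longrightarrow> admissible f"
  by (auto simp: capped_def admissible_def intro: le_less_trans)

lemma capped_le: "f \<in> capped M \<Longrightarrow> f w \<le> M * h w"
  by (auto simp: capped_def)

lemma capped_nonneg: "f \<in> capped M \<Longrightarrow> 0 \<le> f w"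
  by (auto simp: capped_def)

lemma capped_measurable: "f \<in> capped M \<Longrightarrow> f \<in> borel_measurable borel"
  by (auto simp: capped_def)

lemma zero_in_capped: "0 \<le> M \<Longrightarrow> (\<lambda>_. 0) \<in> capped M"
  using h_pos by (auto simp: capped_def N_def less_imp_le intro!: mult_nonneg_nonneg)

lemma U_le_capped: "f \<in> capped M \<Longrightarrow> 0 \<le> M \<Longrightarrow> 0 < snd x \<Longrightarrow> U f x \<le> M * U h x"
  unfolding U_cmult[symmetric] by (intro U_mono) (auto intro: capped_admissible capped_le admissible_cmult admissible_h)

text \<open>Midpoint convexity as a case of majorization: the pair with equal entries is the least spread out.\<close>

lemma midpoint_powr_le:
  fixes s t :: real assumes "0 \<le> s" "0 \<le> t" "1 < r"
  shows "((s + t) / 2) powr r \<le> (s powr r + t powr r) / 2"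
proof -
  define k where "k = (s + t) / 2"
  have "k powr r + k powr r \<le> max s t powr r + min s t powr r"
    by (rule powr_sum_majorization(1)) (use assms in \<open>auto simp: k_def max_def min_def\<close>)
  then show ?thesis by (auto simp: k_def max_def min_def split: if_splits)
qed

lemma capped_midpoint:
  assumes f: "f \<in> capped M" and g: "g \<in> capped M" shows "(\<lambda>w. (f w + g w) / 2) \<in> capped M"
proof -
  have [measurable]: "f \<in> borel_measurable borel" "g \<in> borel_measurable borel" using f g by (auto intro: capped_measurable)
  have "N (\<lambda>w. (f w + g w) / 2) \<le> (\<integral>\<^sup>+w. ennreal (1 / 2) * (ennreal (f w powr p) + ennreal (g w powr p)) \<partial>lborel)"
    unfolding N_def
  proof (rule nn_integral_mono)
    fix w
    have "((f w + g w) / 2) powr p \<le> (f w powr p + g w powr p) / 2"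
      using capped_nonneg[OF f] capped_nonneg[OF g] p_gt_2 by (intro midpoint_powr_le) auto
    then have "ennreal (((f w + g w) / 2) powr p) \<le> ennreal (1 / 2 * (f w powr p + g w powr p))"
      by (intro ennreal_leI) simp
    also have "\<dots> = ennreal (1 / 2) * (ennreal (f w powr p) + ennreal (g w powr p))"
      by (subst ennreal_mult) auto
    finally show "ennreal (((f w + g w) / 2) powr p) \<le> ennreal (1 / 2) * (ennreal (f w powr p) + ennreal (g w powr p))" .
  qed
  also have "\<dots> = ennreal (1 / 2) * (N f + N g)"
    unfolding N_def by (subst nn_integral_cmult) (auto simp: nn_integral_add)
  also have "\<dots> \<le> ennreal (1 / 2) * (1 + 1)"
    using f g by (intro mult_left_mono add_mono) (auto simp: capped_def)
  also have "\<dots> = ennreal (1 / 2) * ennreal 2" by simp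
  also have "\<dots> = 1" by (subst ennreal_mult[symmetric]) auto
  finally have N: "N (\<lambda>w. (f w + g w) / 2) \<le> 1" .
  have "(f w + g w) / 2 \<le> M * h w" for w using capped_le[OF f, of w] capped_le[OF g, of w] by simp
  then show ?thesis using N capped_nonneg[OF f] capped_nonneg[OF g] by (simp add: capped_def)
qed

text \<open>Points closer to \<open>x\<close> than half its height see every boundary point at a comparable distance; this
  supplies the dominating functions for limits \<open>x' \<longlonglongrightarrow> x\<close>.\<close>

lemma G_harnack:
  assumes x: "0 < snd x" and d: "dist x' x < snd x / 2"
  shows "0 < snd x'" "G x' w \<le> 6 powr (b / 2) * G x w"
proof -
  have sn: "\<bar>snd v\<bar> \<le> norm v" for v :: "(real^'n) \<times> real"
    using norm_snd_le[of "snd v" "fst v"] by simp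
  have "\<bar>snd x' - snd x\<bar> < snd x / 2"
    using d sn[of "x' - x"] by (simp add: dist_norm)
  then have t: "snd x / 2 < snd x'" "snd x' < 3 / 2 * snd x" by linarith+
  then show pos: "0 < snd x'" using x by linarith
  let ?A = "norm (x - (w, 0))" and ?B = "norm (x' - (w, 0))"
  have "snd x \<le> ?A" using sn[of "x - (w, 0)"] x by simp
  moreover have "?A \<le> ?B + dist x' x"
    using dist_triangle[of x "(w, 0)" x'] by (simp add: dist_norm[symmetric] dist_commute)
  ultimately have AB: "?A / 2 \<le> ?B" and A: "0 < ?A" using d x by linarith+
  then have "(?A / 2)\<^sup>2 \<le> ?B\<^sup>2" by (intro power_mono) auto
  then have "snd x' / ?B\<^sup>2 \<le> (3 / 2 * snd x) / (?A / 2)\<^sup>2"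
    using t x A by (intro frac_le) auto
  also have "\<dots> = 6 * (snd x / ?A\<^sup>2)" by (simp add: power2_eq_square)
  finally have "G x' w \<le> (6 * (snd x / ?A\<^sup>2)) powr (b / 2)"
    unfolding G_def using b_pos pos by (intro powr_mono2) auto
  then show "G x' w \<le> 6 powr (b / 2) * G x w" unfolding G_def powr_mult .
qed

lemma G_continuous: assumes x: "0 < snd x" and X: "X \<longlonglongrightarrow> x" shows "(\<lambda>k. G (X k) w) \<longlonglongrightarrow> G x w"
  unfolding G_def
proof (rule tendsto_powr)
  show "(\<lambda>k. snd (X k) / (norm (X k - (w, 0)))\<^sup>2) \<longlonglongrightarrow> snd x / (norm (x - (w, 0)))\<^sup>2"
    using X halfspace_neq[OF x, of w] by (intro tendsto_intros) auto
  show "snd x / (norm (x - (w, 0)))\<^sup>2 \<noteq> 0" using x halfspace_neq[OF x, of w] by simp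
qed simp

text \<open>The potentials of all capped functions share the modulus of continuity
  \<open>\<integral> \<bar>G x w - G x' w\<bar> M h w dw\<close>, which tends to \<open>0\<close> by dominated convergence.\<close>

lemma U_equicontinuous:
  assumes x: "0 < snd x" and X: "X \<longlonglongrightarrow> x" and e: "0 < e" and M: "0 \<le> M"
  shows "eventually (\<lambda>k. \<forall>f\<in>capped M. \<bar>U f (X k) - U f x\<bar> < e) sequentially"
proof -
  define \<Lambda> where "\<Lambda> k = (LINT w|lborel. \<bar>G (X k) w - G x w\<bar> * (M * h w))" for k
  have ev: "eventually (\<lambda>k. dist (X k) x < snd x / 2) sequentially"
    using tendstoD[OF X, of "snd x / 2"] x by simp
  then obtain K where K: "\<And>k. K \<le> k \<Longrightarrow> dist (X k) x < snd x / 2" by (auto simp: eventually_sequentially)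
  have Ah: "admissible (\<lambda>w. M * h w)" by (rule admissible_cmult[OF admissible_h M])
  have [measurable]: "h \<in> borel_measurable borel" by (rule measurable_bubble)
  have "(\<lambda>k. \<Lambda> (k + K)) \<longlonglongrightarrow> (LINT w|(lborel :: (real^'n) measure). 0)"
    unfolding \<Lambda>_def
  proof (rule integral_dominated_convergence)
    show "integrable lborel (\<lambda>w. (6 powr (b / 2) + 1) * (G x w * (M * h w)))"
      by (intro integrable_mult_right integrable_G_mult[OF x Ah])
    show "AE w in lborel. (\<lambda>k. \<bar>G (X (k + K)) w - G x w\<bar> * (M * h w)) \<longlonglongrightarrow> 0"
    proof (rule AE_I2)
      fix w
      have "(\<lambda>k. \<bar>G (X (k + K)) w - G x w\<bar> * (M * h w)) \<longlonglongrightarrow> \<bar>G x w - G x w\<bar> * (M * h w)"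
        by (intro tendsto_intros LIMSEQ_ignore_initial_segment[OF G_continuous[OF x X]])
      then show "(\<lambda>k. \<bar>G (X (k + K)) w - G x w\<bar> * (M * h w)) \<longlonglongrightarrow> 0" by simp
    qed
    show "AE w in lborel. norm (\<bar>G (X (k + K)) w - G x w\<bar> * (M * h w)) \<le> (6 powr (b / 2) + 1) * (G x w * (M * h w))" for k
    proof (rule AE_I2)
      fix w
      have Mh: "0 \<le> M * h w" using M h_pos[of w] by simp
      have "\<bar>G (X (k + K)) w - G x w\<bar> \<le> G (X (k + K)) w + G x w"
        using G_nonneg[of "X (k + K)" w] G_nonneg[of x w] by linarith
      also have "\<dots> \<le> (6 powr (b / 2) + 1) * G x w"
        using G_harnack(2)[OF x K, of "k + K" w] by (simp add: algebra_simps)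
      finally have "\<bar>G (X (k + K)) w - G x w\<bar> * (M * h w) \<le> (6 powr (b / 2) + 1) * G x w * (M * h w)"
        using Mh by (rule mult_right_mono)
      then show "norm (\<bar>G (X (k + K)) w - G x w\<bar> * (M * h w)) \<le> (6 powr (b / 2) + 1) * (G x w * (M * h w))"
        using Mh by (simp add: mult.assoc)
    qed
  qed measurable
  then have "\<Lambda> \<longlonglongrightarrow> 0" by (simp add: LIMSEQ_offset)
  then have "eventually (\<lambda>k. \<Lambda> k < e) sequentially" using e by (rule order_tendstoD(2))
  then show ?thesis using ev
  proof eventually_elim
    case (elim k)
    have x': "0 < snd (X k)" by (rule G_harnack(1)[OF x elim(2)])
    show ?case
    proof
      fix f assume f: "f \<in> capped M"
      have A: "admissible f" by (rule capped_admissible[OF f])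
      note i1 = integrable_G_mult[OF x' A] and i2 = integrable_G_mult[OF x A]
      have i3: "integrable lborel (\<lambda>w. \<bar>G (X k) w - G x w\<bar> * (M * h w))"
      proof -
        have "integrable lborel (\<lambda>w. \<bar>G (X k) w * (M * h w) - G x w * (M * h w)\<bar>)"
          by (intro integrable_abs Bochner_Integration.integrable_diff integrable_G_mult x x' Ah)
        moreover have "\<bar>G (X k) w * (M * h w) - G x w * (M * h w)\<bar> = \<bar>G (X k) w - G x w\<bar> * (M * h w)" for w
          unfolding left_diff_distrib[symmetric] abs_mult using M h_pos[of w] by (simp add: abs_mult)
        ultimately show ?thesis by simp
      qed
      have "U f (X k) - U f x = (LINT w|lborel. G (X k) w * f w - G x w * f w)"
        unfolding U_def by (rule Bochner_Integration.integral_diff[symmetric, OF i1 i2])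
      then have "\<bar>U f (X k) - U f x\<bar> \<le> (LINT w|lborel. \<bar>G (X k) w * f w - G x w * f w\<bar>)"
        using integral_abs_bound[of lborel "\<lambda>w. G (X k) w * f w - G x w * f w"] by simp
      also have "\<dots> \<le> \<Lambda> k" unfolding \<Lambda>_def
      proof (rule integral_mono)
        show "integrable lborel (\<lambda>w. \<bar>G (X k) w * f w - G x w * f w\<bar>)"
          by (intro integrable_abs Bochner_Integration.integrable_diff i1 i2)
        show "\<bar>G (X k) w * f w - G x w * f w\<bar> \<le> \<bar>G (X k) w - G x w\<bar> * (M * h w)" for w
          unfolding left_diff_distrib[symmetric] abs_mult
          using capped_nonneg[OF f, of w] capped_le[OF f, of w] by (intro mult_left_mono) auto
      qed (rule i3)
      also have "\<dots> < e" by (rule elim)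
      finally show "\<bar>U f (X k) - U f x\<bar> < e" .
    qed
  qed
qed

lemma U_tendsto_if_dense:
  assumes M: "0 \<le> M" and u: "\<And>k. u k \<in> capped M" and g: "g \<in> capped M"
    and D: "\<And>A. open A \<Longrightarrow> A \<noteq> {} \<Longrightarrow> A \<subseteq> {x. 0 < snd x} \<Longrightarrow> \<exists>y\<in>A. (\<lambda>k. U (u k) y) \<longlonglongrightarrow> U g y"
    and x: "0 < snd x"
  shows "(\<lambda>k. U (u k) x) \<longlonglongrightarrow> U g x"
proof (rule LIMSEQ_I)
  fix e :: real assume e: "0 < e"
  have "\<exists>d. \<forall>k::nat. 0 < snd (d k) \<and> dist (d k) x < 1 / real (Suc k) \<and> (\<lambda>j. U (u j) (d k)) \<longlonglongrightarrow> U g (d k)"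
  proof (rule choice, rule allI)
    fix k :: nat
    let ?A = "ball x (1 / real (Suc k)) \<inter> {x. 0 < snd x}"
    have "open ?A" by (intro open_Int open_ball open_Collect_less continuous_intros)
    moreover have "x \<in> ?A" using x by simp
    ultimately obtain y where "y \<in> ?A" "(\<lambda>k. U (u k) y) \<longlonglongrightarrow> U g y" using D[of ?A] by blast
    then show "\<exists>y. 0 < snd y \<and> dist y x < 1 / real (Suc k) \<and> (\<lambda>j. U (u j) y) \<longlonglongrightarrow> U g y"
      by (intro exI[of _ y]) (auto simp: dist_commute)
  qed
  then obtain d where d: "\<And>k::nat. dist (d k) x < 1 / real (Suc k)" "\<And>k. (\<lambda>j. U (u j) (d k)) \<longlonglongrightarrow> U g (d k)" by auto
  have "d \<longlonglongrightarrow> x"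
  proof (rule metric_LIMSEQ_I)
    fix r :: real assume "0 < r"
    then obtain K where K: "1 / real (Suc K) < r" using nat_approx_posE by blast
    have "dist (d k) x < r" if "K \<le> k" for k
    proof -
      have "1 / real (Suc k) \<le> 1 / real (Suc K)" using that by (intro divide_left_mono) auto
      then show ?thesis using d(1)[of k] K by linarith
    qed
    then show "\<exists>no. \<forall>n\<ge>no. dist (d n) x < r" by blast
  qed
  then have "eventually (\<lambda>k. \<forall>f\<in>capped M. \<bar>U f (d k) - U f x\<bar> < e / 3) sequentially"
    using e by (intro U_equicontinuous[OF x _ _ M]) auto
  then obtain k where k: "\<forall>f\<in>capped M. \<bar>U f (d k) - U f x\<bar> < e / 3"
    using eventually_happens'[OF sequentially_bot] by blast
  obtain J where J: "\<forall>j\<ge>J. norm (U (u j) (d k) - U g (d k)) < e / 3"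
    using LIMSEQ_D[OF d(2)[of k], of "e / 3"] e by auto
  have "norm (U (u j) x - U g x) < e" if "J \<le> j" for j
  proof -
    have "\<bar>U (u j) (d k) - U (u j) x\<bar> < e / 3" "\<bar>U g (d k) - U g x\<bar> < e / 3" using k u g by blast+
    moreover have "\<bar>U (u j) (d k) - U g (d k)\<bar> < e / 3" using J that by simp
    ultimately show ?thesis unfolding real_norm_def by linarith
  qed
  then show "\<exists>no. \<forall>n\<ge>no. norm (U (u n) x - U g x) < e" by blast
qed

lemma E_tendsto:
  assumes M: "0 \<le> M" and u: "\<And>k. u k \<in> capped M" and g: "g \<in> capped M"
    and c: "\<And>x. 0 < snd x \<Longrightarrow> (\<lambda>k. U (u k) x) \<longlonglongrightarrow> U g x"
  shows "(\<lambda>k. E (u k)) \<longlonglongrightarrow> E g"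
proof -
  have [measurable]: "u k \<in> borel_measurable borel" "g \<in> borel_measurable borel" for k using u g by (auto intro: capped_measurable)
  have q0: "0 < q" using q_gt_2 by simp
  show ?thesis unfolding E_def
  proof (rule nn_integral_dominated_convergence[where w = "\<lambda>x. ennreal ((M * U h x) powr q)"])
    show "AE x in hyp. ennreal (U (u k) x powr q) \<le> ennreal ((M * U h x) powr q)" for k
      using AE_hyp
      by eventually_elim (use q0 in \<open>auto intro!: ennreal_leI powr_mono2 U_nonneg[OF capped_admissible[OF u]] U_le_capped[OF u M]\<close>)
    show "AE x in hyp. (\<lambda>k. ennreal (U (u k) x powr q)) \<longlonglongrightarrow> ennreal (U g x powr q)"
      using AE_hyp
    proof eventually_elim
      case (elim x)
      show ?case
        by (intro tendsto_ennrealI tendsto_powr' c[OF elim] tendsto_const)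
           (use q0 U_nonneg[OF capped_admissible[OF u]] in auto)
    qed
    have "(\<integral>\<^sup>+x. ennreal ((M * U h x) powr q) \<partial>hyp) = E (\<lambda>w. M * h w)"
      by (simp add: E_def U_cmult)
    also have "\<dots> < \<infinity>" using E_bubble_finite[of 1 0] by (subst E_cmult) (auto simp: ennreal_mult_less_top)
    finally show "(\<integral>\<^sup>+x. ennreal ((M * U h x) powr q) \<partial>hyp) < \<infinity>" .
  qed (auto simp: measurable_cong_sets[OF sets_hyp refl])
qed

end

section \<open>Existence of a maximizer\<close>

context poisson_setting begin

text \<open>A quadratic form that is finite on capped functions. It serves to select strongly convergent sequences
  by the parallelogram identity.\<close>

definition Q :: "(real^'n \<Rightarrow> real) \<Rightarrow> real" where
  "Q f = (LINT w|lborel. (f w)\<^sup>2 * h w powr (p - 2))"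

lemma integrable_weighted:
  assumes [measurable]: "f \<in> borel_measurable borel" and le: "\<And>w. \<bar>f w\<bar> \<le> C * h w ^ k" and C: "0 \<le> C" and k: "real k + r = p"
  shows "integrable lborel (\<lambda>w. f w * h w powr r)"
proof (rule Bochner_Integration.integrable_bound)
  show "integrable lborel (\<lambda>w. C * h w powr p)" by (intro integrable_mult_right integrable_powr_p admissible_h)
  show "AE w in lborel. norm (f w * h w powr r) \<le> norm (C * h w powr p)"
  proof (rule AE_I2)
    fix w
    have "\<bar>f w\<bar> * h w powr r \<le> C * h w ^ k * h w powr r" by (intro mult_right_mono le) simp
    also have "\<dots> = C * h w powr p"
      unfolding k[symmetric] powr_add using h_pos[of w] by (simp add: powr_realpow)
    finally show "norm (f w * h w powr r) \<le> norm (C * h w powr p)" using C by (simp add: abs_mult)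
  qed
qed measurable

lemma integrable_Q:
  assumes "f \<in> borel_measurable borel" and le: "\<And>w. \<bar>f w\<bar> \<le> C * h w" and C: "0 \<le> C"
  shows "integrable lborel (\<lambda>w. (f w)\<^sup>2 * h w powr (p - 2))"
proof (rule integrable_weighted[where C = "C\<^sup>2" and k = 2])
  show "\<bar>(f w)\<^sup>2\<bar> \<le> C\<^sup>2 * h w ^ 2" for w
    using power_mono[OF le[of w], of 2] by (simp add: power_mult_distrib)
qed (use assms in auto)

lemma capped_abs_le: "f \<in> capped M \<Longrightarrow> \<bar>f w\<bar> \<le> M * h w"
  using capped_le[of f M w] capped_nonneg[of f M w] by simp

lemma capped_diff_le: "f \<in> capped M \<Longrightarrow> g \<in> capped M \<Longrightarrow> \<bar>f w - g w\<bar> \<le> M * h w"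
  using capped_le[of f M w] capped_nonneg[of f M w] capped_le[of g M w] capped_nonneg[of g M w] by (simp add: abs_le_iff)

lemma integrable_Q_capped: "f \<in> capped M \<Longrightarrow> 0 \<le> M \<Longrightarrow> integrable lborel (\<lambda>w. (f w)\<^sup>2 * h w powr (p - 2))"
  by (rule integrable_Q[OF capped_measurable capped_abs_le])

lemma Q_nonneg: "0 \<le> Q f"
  unfolding Q_def by (intro integral_nonneg_AE) auto

lemma Q_le: assumes f: "f \<in> capped M" and M: "0 \<le> M" shows "Q f \<le> M\<^sup>2 * (LINT w|lborel. h w powr p)"
proof -
  have "Q f \<le> (LINT w|lborel. M\<^sup>2 * h w powr p)" unfolding Q_def
  proof (rule integral_mono)
    show "integrable lborel (\<lambda>w. (f w)\<^sup>2 * h w powr (p - 2))"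
      by (rule integrable_Q[OF capped_measurable[OF f] capped_abs_le[OF f] M])
    show "integrable lborel (\<lambda>w. M\<^sup>2 * h w powr p)" by (intro integrable_mult_right integrable_powr_p admissible_h)
    fix w
    have "(f w)\<^sup>2 * h w powr (p - 2) \<le> (M * h w)\<^sup>2 * h w powr (p - 2)"
      using power_mono[OF capped_abs_le[OF f, of w], of 2] by (intro mult_right_mono) auto
    also have "\<dots> = M\<^sup>2 * h w powr (2 + (p - 2))"
      unfolding powr_add using h_pos[of w] by (simp add: power_mult_distrib powr_numeral)
    finally show "(f w)\<^sup>2 * h w powr (p - 2) \<le> M\<^sup>2 * h w powr p" by simp
  qed
  then show ?thesis by simp
qed

lemma Q_parallelogram:
  assumes f: "f \<in> capped M" and g: "g \<in> capped M" and M: "0 \<le> M"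
  shows "Q (\<lambda>w. f w - g w) = 2 * Q f + 2 * Q g - 4 * Q (\<lambda>w. (f w + g w) / 2)"
proof -
  note m = capped_measurable[OF f] capped_measurable[OF g]
  have i: "integrable lborel (\<lambda>w. (f w)\<^sup>2 * h w powr (p - 2))" "integrable lborel (\<lambda>w. (g w)\<^sup>2 * h w powr (p - 2))"
    "integrable lborel (\<lambda>w. ((f w + g w) / 2)\<^sup>2 * h w powr (p - 2))"
    by (rule integrable_Q_capped[OF f M], rule integrable_Q_capped[OF g M], rule integrable_Q_capped[OF capped_midpoint[OF f g] M])
  have "Q (\<lambda>w. f w - g w) = (LINT w|lborel. 2 * ((f w)\<^sup>2 * h w powr (p - 2)) + 2 * ((g w)\<^sup>2 * h w powr (p - 2))
     - 4 * (((f w + g w) / 2)\<^sup>2 * h w powr (p - 2)))"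
    unfolding Q_def by (rule Bochner_Integration.integral_cong) (auto simp: power2_eq_square field_simps)
  also have "\<dots> = 2 * Q f + 2 * Q g - 4 * Q (\<lambda>w. (f w + g w) / 2)"
    unfolding Q_def using i by simp
  finally show ?thesis .
qed

text \<open>Young's inequality \<open>d h \<le> e h\<^sup>2 + d\<^sup>2 / e\<close> under the integral, with weight \<open>h\<^bsup>p-2\<^esup>\<close>.\<close>

lemma L1_le_Q:
  assumes f: "f \<in> capped M" and g: "g \<in> capped M" and M: "0 \<le> M" and e: "0 < e"
  shows "(LINT w|lborel. norm (f w * h w powr (p - 1) - g w * h w powr (p - 1)))
     \<le> e * (LINT w|lborel. h w powr p) + Q (\<lambda>w. f w - g w) / e"
proof -
  note m [measurable] = capped_measurable[OF f] capped_measurable[OF g]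
  have i: "integrable lborel (\<lambda>w. (f w - g w)\<^sup>2 * h w powr (p - 2))"
    by (rule integrable_Q[OF _ capped_diff_le[OF f g] M]) measurable
  have ih: "integrable lborel (\<lambda>w. h w powr p)" by (intro integrable_powr_p admissible_h)
  have if': "integrable lborel (\<lambda>w. f w * h w powr (p - 1))" if "f \<in> capped M" for f
    by (rule integrable_weighted[where C = M and k = 1]) (use capped_abs_le[OF that] capped_measurable[OF that] M in auto)
  have "(LINT w|lborel. norm (f w * h w powr (p - 1) - g w * h w powr (p - 1)))
    \<le> (LINT w|lborel. e * h w powr p + (f w - g w)\<^sup>2 * h w powr (p - 2) / e)"
  proof (rule integral_mono)
    show "integrable lborel (\<lambda>w. norm (f w * h w powr (p - 1) - g w * h w powr (p - 1)))"
      by (intro integrable_norm Bochner_Integration.integrable_diff if' f g)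
    show "integrable lborel (\<lambda>w. e * h w powr p + (f w - g w)\<^sup>2 * h w powr (p - 2) / e)"
      using i ih by simp
    fix w
    define d where "d = \<bar>f w - g w\<bar>"
    have "h w powr (2 + (p - 2)) = h w ^ 2 * h w powr (p - 2)" "h w powr (1 + (p - 2)) = h w * h w powr (p - 2)"
      unfolding powr_add using h_pos[of w] by (simp_all add: powr_numeral)
    then have hp: "h w powr p = h w ^ 2 * h w powr (p - 2)" "h w powr (p - 1) = h w * h w powr (p - 2)"
      by (simp_all add: algebra_simps)
    have "d * h w \<le> e * (h w)\<^sup>2 + d\<^sup>2 / e"
    proof -
      have "0 \<le> (e * h w - d)\<^sup>2 + e * h w * d" using e h_pos[of w] by (simp add: d_def)
      then have "e * (d * h w) \<le> e * (e * (h w)\<^sup>2 + d\<^sup>2 / e)"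
        using e by (simp add: power2_eq_square algebra_simps)
      then show ?thesis using e by simp
    qed
    then have "d * h w * h w powr (p - 2) \<le> (e * (h w)\<^sup>2 + d\<^sup>2 / e) * h w powr (p - 2)"
      by (rule mult_right_mono) simp
    moreover have "norm (f w * h w powr (p - 1) - g w * h w powr (p - 1)) = d * h w * h w powr (p - 2)"
      unfolding left_diff_distrib[symmetric] hp using h_pos[of w] by (simp add: d_def abs_mult)
    moreover have "(e * (h w)\<^sup>2 + d\<^sup>2 / e) * h w powr (p - 2) = e * h w powr p + (f w - g w)\<^sup>2 * h w powr (p - 2) / e"
      unfolding hp by (simp add: d_def algebra_simps)
    ultimately show "norm (f w * h w powr (p - 1) - g w * h w powr (p - 1)) \<le> e * h w powr p + (f w - g w)\<^sup>2 * h w powr (p - 2) / e"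
      by simp
  qed
  also have "\<dots> = e * (LINT w|lborel. h w powr p) + Q (\<lambda>w. f w - g w) / e"
    unfolding Q_def using i ih by simp
  finally show ?thesis .
qed

text \<open>A sequence that is Cauchy for \<open>Q\<close> is Cauchy in a weighted \<open>L\<^sup>1\<close> space, so a subsequence converges almost
  everywhere, and all integrals converge by domination.\<close>

lemma capped_limit:
  fixes g :: "nat \<Rightarrow> real^'n \<Rightarrow> real"
  assumes M: "0 \<le> M" and g: "\<And>k. g k \<in> capped M"
    and cau: "\<And>e. 0 < e \<Longrightarrow> \<exists>K. \<forall>i\<ge>K. \<forall>j\<ge>K. Q (\<lambda>w. g i w - g j w) < e"
  obtains f r where "strict_mono r" "f \<in> capped M" "\<And>x. 0 < snd x \<Longrightarrow> (\<lambda>k. U (g (r k)) x) \<longlonglongrightarrow> U f x"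
proof -
  note m [measurable] = capped_measurable[OF g]
  let ?s = "\<lambda>k w. g k w * h w powr (p - 1)"
  define B where "B = (LINT w|lborel. h w powr p)"
  have B0: "0 \<le> B" unfolding B_def by (intro integral_nonneg_AE) auto
  have int: "integrable lborel (?s k)" for k
    by (rule integrable_weighted[where C = M and k = 1]) (use capped_abs_le[OF g] m M in auto)
  have C: "\<exists>K. \<forall>i\<ge>K. \<forall>j\<ge>K. (LINT w|lborel. norm (?s i w - ?s j w)) < e" if e: "0 < e" for e
  proof -
    \<comment> \<open>both terms of the bound in \<open>L1_le_Q\<close> become smaller than \<open>e / 2\<close>\<close>
    define d where "d = e / (2 * (B + 1))"
    have d: "0 < d" using e B0 by (simp add: d_def)
    have dB: "d * B < e / 2" using e B0 by (simp add: d_def field_simps)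
    obtain K where K: "\<forall>i\<ge>K. \<forall>j\<ge>K. Q (\<lambda>w. g i w - g j w) < d * (e / 2)"
      using cau[of "d * (e / 2)"] d e by auto
    have "(LINT w|lborel. norm (?s i w - ?s j w)) < e" if "K \<le> i" "K \<le> j" for i j
    proof -
      have "(LINT w|lborel. norm (?s i w - ?s j w)) \<le> d * B + Q (\<lambda>w. g i w - g j w) / d"
        unfolding B_def by (rule L1_le_Q[OF g g M d])
      also have "Q (\<lambda>w. g i w - g j w) / d < e / 2" using K that d by (simp add: field_simps)
      finally show ?thesis using dB by simp
    qed
    then show ?thesis by blast
  qed
  obtain r where r: "strict_mono r" and ae: "AE w in lborel. Cauchy (\<lambda>i. ?s (r i) w)"
    by (rule cauchy_L1_AE_cauchy_subseq[of lborel ?s, OF int C])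
  \<comment> \<open>clamping keeps the bounds also at the points without convergence, where \<open>lim\<close> is unspecified\<close>
  define f where "f w = max 0 (min (M * h w) (lim (\<lambda>i. g (r i) w)))" for w
  have [measurable]: "f \<in> borel_measurable borel" unfolding f_def[abs_def] by measurable
  have lim: "AE w in lborel. (\<lambda>i. g (r i) w) \<longlonglongrightarrow> f w"
    using ae
  proof eventually_elim
    case (elim w)
    then obtain l where "(\<lambda>i. ?s (r i) w) \<longlonglongrightarrow> l" by (auto simp: Cauchy_convergent_iff convergent_def)
    then have "(\<lambda>i. ?s (r i) w / h w powr (p - 1)) \<longlonglongrightarrow> l / h w powr (p - 1)"
      by (intro tendsto_divide tendsto_const) (use h_pos[of w] in auto)
    then have L: "(\<lambda>i. g (r i) w) \<longlonglongrightarrow> l / h w powr (p - 1)" using h_pos[of w] by simp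
    then have l: "lim (\<lambda>i. g (r i) w) = l / h w powr (p - 1)" by (rule limI)
    have "0 \<le> l / h w powr (p - 1)" "l / h w powr (p - 1) \<le> M * h w"
      using capped_nonneg[OF g] capped_le[OF g] by (auto intro: LIMSEQ_le_const[OF L] LIMSEQ_le_const2[OF L])
    then have "f w = l / h w powr (p - 1)" by (simp add: f_def l)
    then show ?case using L by simp
  qed
  have p0: "0 < p" using p_gt_2 by simp
  have fle: "0 \<le> f w" "f w \<le> M * h w" for w using M h_pos[of w] by (auto simp: f_def)
  have "(\<lambda>k. N (g (r k))) \<longlonglongrightarrow> N f" unfolding N_def
  proof (rule nn_integral_dominated_convergence[where w = "\<lambda>w. ennreal ((M * h w) powr p)"])
    show "AE w in lborel. ennreal (g (r k) w powr p) \<le> ennreal ((M * h w) powr p)" for k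
      using p0 capped_nonneg[OF g] capped_le[OF g] by (auto intro!: ennreal_leI powr_mono2)
    show "AE w in lborel. (\<lambda>k. ennreal (g (r k) w powr p)) \<longlonglongrightarrow> ennreal (f w powr p)"
      using lim
      by eventually_elim (intro tendsto_ennrealI tendsto_powr' tendsto_const, use p0 capped_nonneg[OF g] in auto)
    have "(\<integral>\<^sup>+w. ennreal ((M * h w) powr p) \<partial>lborel) = N (\<lambda>w. M * h w)" by (simp add: N_def)
    also have "\<dots> < \<infinity>" using admissible_cmult[OF admissible_h M] by (simp add: admissible_def)
    finally show "(\<integral>\<^sup>+w. ennreal ((M * h w) powr p) \<partial>lborel) < \<infinity>" .
  qed measurable
  moreover have "N (g (r k)) \<le> 1" for k using g[of "r k"] by (simp add: capped_def)
  ultimately have "N f \<le> 1" by (intro LIMSEQ_le_const2) auto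
  then have f: "f \<in> capped M" using fle by (simp add: capped_def)
  have "(\<lambda>k. U (g (r k)) x) \<longlonglongrightarrow> U f x" if x: "0 < snd x" for x
    unfolding U_def
  proof (rule integral_dominated_convergence)
    show "integrable lborel (\<lambda>w. G x w * (M * h w))"
      by (rule integrable_G_mult[OF x admissible_cmult[OF admissible_h M]])
    show "AE w in lborel. (\<lambda>k. G x w * g (r k) w) \<longlonglongrightarrow> G x w * f w"
      using lim by eventually_elim (intro tendsto_intros)
    show "AE w in lborel. norm (G x w * g (r k) w) \<le> G x w * (M * h w)" for k
      using capped_abs_le[OF g] by (auto simp: abs_mult intro!: mult_left_mono)
  qed measurable
  then show thesis using that[OF r f] by blast
qed

text \<open>Weak compactness by projection: the capped functions whose potentials at the first \<open>k\<close> points are within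
  \<open>1 / (k + 1)\<close> of the prescribed values form a decreasing sequence of convex sets. By the parallelogram
  identity, almost minimizers of \<open>Q\<close> in these sets form a Cauchy sequence, and its limit has the prescribed
  potentials.\<close>

lemma weak_limit_exists:
  assumes M: "0 \<le> M" and f: "\<And>k. f k \<in> capped M" and L: "\<And>i. (\<lambda>k. U (f k) (d i)) \<longlonglongrightarrow> L i"
    and d: "\<And>i::nat. 0 < snd (d i)"
  obtains g where "g \<in> capped M" "\<And>i. U g (d i) = L i"
proof -
  \<comment> \<open>the convex sets of approximate solutions\<close>
  define C where "C k = {F \<in> capped M. \<forall>i<k. \<bar>U F (d i) - L i\<bar> \<le> 1 / real (Suc k)}" for k
  have C_capped: "F \<in> C k \<Longrightarrow> F \<in> capped M" for F k by (simp add: C_def)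
  have C_ne: "C k \<noteq> {}" for k
  proof -
    have "\<forall>i<k. eventually (\<lambda>j. \<bar>U (f j) (d i) - L i\<bar> < 1 / real (Suc k)) sequentially"
      using tendstoD[OF L, of "1 / real (Suc k)"] by (simp add: dist_real_def)
    then have "eventually (\<lambda>j. \<forall>i\<in>{..<k}. \<bar>U (f j) (d i) - L i\<bar> < 1 / real (Suc k)) sequentially"
      by (intro eventually_ball_finite) auto
    then obtain j where "\<forall>i\<in>{..<k}. \<bar>U (f j) (d i) - L i\<bar> < 1 / real (Suc k)"
      using eventually_happens'[OF sequentially_bot] by blast
    then have "f j \<in> C k" using f by (auto simp: C_def intro: less_imp_le)
    then show ?thesis by blast
  qed
  have C_mono: "C j \<subseteq> C k" if "k \<le> j" for j k
  proof
    fix F assume F: "F \<in> C j"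
    have "1 / real (Suc j) \<le> 1 / real (Suc k)" using that by (intro divide_left_mono) auto
    moreover have "\<forall>i<k. \<bar>U F (d i) - L i\<bar> \<le> 1 / real (Suc j)" using F that by (auto simp: C_def)
    ultimately show "F \<in> C k" using F by (fastforce simp: C_def)
  qed
  have C_mid: "(\<lambda>w. (F w + F' w) / 2) \<in> C k" if F: "F \<in> C k" "F' \<in> C k" for F F' k
  proof -
    have mid: "U (\<lambda>w. (F w + F' w) / 2) (d i) = (U F (d i) + U F' (d i)) / 2" for i
    proof -
      have "U (\<lambda>w. (F w + F' w) / 2) (d i) = (LINT w|lborel. (G (d i) w * F w + G (d i) w * F' w) / 2)"
        unfolding U_def by (rule Bochner_Integration.integral_cong) (auto simp: algebra_simps)
      also have "\<dots> = (U F (d i) + U F' (d i)) / 2"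
        unfolding U_def using integrable_G_mult[OF d capped_admissible[OF C_capped]] F by simp
      finally show ?thesis .
    qed
    have "\<bar>U (\<lambda>w. (F w + F' w) / 2) (d i) - L i\<bar> \<le> 1 / real (Suc k)" if "i < k" for i
    proof -
      have "\<bar>U F (d i) - L i\<bar> \<le> 1 / real (Suc k)" "\<bar>U F' (d i) - L i\<bar> \<le> 1 / real (Suc k)"
        using F that by (auto simp: C_def)
      then have le: "\<bar>(U F (d i) - L i) + (U F' (d i) - L i)\<bar> \<le> 1 / real (Suc k) + 1 / real (Suc k)"
        by (intro order_trans[OF abs_triangle_ineq] add_mono)
      have eq: "(U F (d i) + U F' (d i)) / 2 - L i = ((U F (d i) - L i) + (U F' (d i) - L i)) / 2"
        by (simp add: field_simps)
      have gen: "X / 2 \<le> e" if "X \<le> e + e" for X e :: real using that by linarith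
      show ?thesis unfolding mid eq abs_divide abs_numeral by (rule gen[OF le])
    qed
    then show ?thesis using capped_midpoint[OF F[THEN C_capped]] by (simp add: C_def)
  qed
  define v where "v k = Inf (Q ` C k)" for k
  have bdd: "bdd_below (Q ` C k)" for k using Q_nonneg by (auto intro!: bdd_belowI[of _ 0])
  have v_le: "v k \<le> Q F" if "F \<in> C k" for F k unfolding v_def using bdd that by (intro cInf_lower) auto
  have "\<exists>F. F \<in> C k \<and> Q F < v k + 1 / real (Suc k)" for k
    using cInf_lessD[of "Q ` C k" "v k + 1 / real (Suc k)"] C_ne[of k] by (auto simp: v_def)
  then obtain g where gC: "\<And>k. g k \<in> C k" and gQ: "\<And>k. Q (g k) < v k + 1 / real (Suc k)" by metis
  have g: "g k \<in> capped M" for k by (rule C_capped[OF gC])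
  have v_mono: "v k \<le> v j" if "k \<le> j" for k j
    unfolding v_def using C_ne[of j] C_mono[OF that] bdd by (intro cInf_superset_mono) auto
  have "v k \<le> M\<^sup>2 * (LINT w|lborel. h w powr p)" for k
    using v_le[OF gC[of k]] Q_le[OF g[of k] M] by linarith
  then obtain l where "v \<longlonglongrightarrow> l"
    using incseq_convergent[of v] v_mono by (metis incseq_def)
  then have "convergent v" by (rule convergentI)
  then have vC: "Cauchy v" by (rule convergent_Cauchy)
  have cau: "\<exists>K. \<forall>i\<ge>K. \<forall>j\<ge>K. Q (\<lambda>w. g i w - g j w) < e" if e: "0 < e" for e
  proof -
    obtain K1 where K1: "\<And>i j. K1 \<le> i \<Longrightarrow> K1 \<le> j \<Longrightarrow> \<bar>v i - v j\<bar> < e / 8"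
      using CauchyD[OF vC, of "e / 8"] e by (auto simp: real_norm_def)
    obtain K2 where K2: "1 / real (Suc K2) < e / 8" using nat_approx_posE[of "e / 8"] e by auto
    define K where "K = max K1 K2"
    have "Q (\<lambda>w. g i w - g j w) < e" if ij: "K \<le> i" "K \<le> j" for i j
    proof -
      define k where "k = min i j"
      have k: "K \<le> k" "k \<le> i" "k \<le> j" using ij by (auto simp: k_def)
      have "g i \<in> C k" "g j \<in> C k" using gC C_mono k by blast+
      then have "v k \<le> Q (\<lambda>w. (g i w + g j w) / 2)" by (intro v_le C_mid)
      then have "Q (\<lambda>w. g i w - g j w) \<le> 2 * Q (g i) + 2 * Q (g j) - 4 * v k"
        using Q_parallelogram[OF g g M, of i j] by linarith
      moreover have "1 / real (Suc i) \<le> 1 / real (Suc K2)" "1 / real (Suc j) \<le> 1 / real (Suc K2)"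
        using ij by (auto simp: K_def intro!: divide_left_mono)
      moreover have "\<bar>v i - v k\<bar> < e / 8" "\<bar>v j - v k\<bar> < e / 8"
        using K1[of i k] K1[of j k] k ij by (auto simp: K_def)
      moreover have gen: "x < e" if "x \<le> 2 * A + 2 * B - 4 * w" "A < s + \<epsilon>1" "B < t + \<epsilon>2" "\<epsilon>1 \<le> \<epsilon>" "\<epsilon>2 \<le> \<epsilon>" "\<epsilon> < e / 8"
        "\<bar>s - w\<bar> < e / 8" "\<bar>t - w\<bar> < e / 8" for x A B w s t \<epsilon>1 \<epsilon>2 \<epsilon> :: real
        using that by linarith
      ultimately show ?thesis using gQ[of i] gQ[of j] K2 by blast
    qed
    then show ?thesis by blast
  qed
  obtain F r where r: "strict_mono r" and F: "F \<in> capped M" and lim: "\<And>x. 0 < snd x \<Longrightarrow> (\<lambda>k. U (g (r k)) x) \<longlonglongrightarrow> U F x"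
    using capped_limit[OF M g cau] by blast
  have "U F (d i) = L i" for i
  proof (rule LIMSEQ_unique[OF lim[OF d]])
    show "(\<lambda>k. U (g (r k)) (d i)) \<longlonglongrightarrow> L i"
    proof (rule LIMSEQ_I)
      fix e :: real assume "0 < e"
      then obtain K where K: "1 / real (Suc K) < e" using nat_approx_posE by blast
      have "norm (U (g (r k)) (d i) - L i) < e" if k: "max (Suc i) K \<le> k" for k
      proof -
        have rk: "k \<le> r k" using r by (rule seq_suble)
        then have "\<bar>U (g (r k)) (d i) - L i\<bar> \<le> 1 / real (Suc (r k))"
          using gC[of "r k"] k by (auto simp: C_def)
        also have "\<dots> \<le> 1 / real (Suc K)" using rk k by (intro divide_left_mono) auto
        finally show ?thesis using K by simp
      qed
      then show "\<exists>no. \<forall>n\<ge>no. norm (U (g (r n)) (d i) - L i) < e" by blast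
    qed
  qed
  then show thesis using that F by blast
qed

text \<open>A maximizing sequence has a subsequence whose potentials converge on a countable dense set. A capped
  function with the limits as its potentials exists, equicontinuity extends the convergence to all points,
  and domination by \<open>M U h\<close> carries it over to the energies.\<close>

lemma maximizer_exists:
  assumes M: "0 \<le> M"
  obtains g where "g \<in> capped M" "\<And>f. f \<in> capped M \<Longrightarrow> E f \<le> E g"
proof -
  let ?S = "SUP f\<in>capped M. E f"
  obtain V :: "nat \<Rightarrow> ennreal" where V: "incseq V" "range V \<subseteq> E ` capped M" "?S = (SUP i. V i)"
    using ennreal_Sup_countable_SUP[of "E ` capped M"] zero_in_capped[OF M] by auto
  then have "\<forall>k. \<exists>f. f \<in> capped M \<and> E f = V k" by (metis imageE rangeI subsetD)
  then obtain f where f: "\<And>k. f k \<in> capped M" "\<And>k. E (f k) = V k" by metis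
  have VS: "V \<longlonglongrightarrow> ?S" unfolding V(3) by (rule LIMSEQ_SUP[OF V(1)])
  obtain D0 :: "((real^'n) \<times> real) set" where D0: "countable D0" "\<And>X. open X \<Longrightarrow> X \<noteq> {} \<Longrightarrow> \<exists>d\<in>D0. d \<in> X"
    using countable_dense_exists by blast
  define D where "D = D0 \<inter> {x. 0 < snd x}"
  have op: "open {x :: (real^'n) \<times> real. 0 < snd x}" by (intro open_Collect_less continuous_intros)
  have D1: "\<exists>d\<in>D. d \<in> X" if "open X" "X \<noteq> {}" "X \<subseteq> {x. 0 < snd x}" for X
    using D0(2)[OF that(1,2)] that(3) by (auto simp: D_def)
  have Dne: "D \<noteq> {}"
  proof -
    have "(0, 1) \<in> {x :: (real^'n) \<times> real. 0 < snd x}" by simp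
    then show ?thesis using D1[OF op] by blast
  qed
  have Dc: "countable D" using D0(1) by (simp add: D_def)
  define d where "d = from_nat_into D"
  have rd: "range d = D" unfolding d_def using Dne Dc by (rule range_from_nat_into)
  have d: "0 < snd (d i)" for i using rd by (auto simp: D_def)
  \<comment> \<open>the diagonal subsequence makes the potentials converge at every point of the dense set\<close>
  interpret subseqs "\<lambda>i s. convergent (\<lambda>k. U (f (s k)) (d i))"
  proof
    fix i and s :: "nat \<Rightarrow> nat"
    have "U (f (s k)) (d i) \<in> {0..M * U h (d i)}" for k
      using U_nonneg[OF capped_admissible[OF f(1)]] U_le_capped[OF f(1) M d] by auto
    then obtain l r where "strict_mono r" "((\<lambda>k. U (f (s k)) (d i)) \<circ> r) \<longlonglongrightarrow> l"
      using compact_Icc[of 0 "M * U h (d i)"] unfolding compact_eq_seq_compact_metric seq_compact_def by metis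
    then show "\<exists>r'. strict_mono r' \<and> convergent (\<lambda>k. U (f ((s \<circ> r') k)) (d i))"
      by (auto simp: convergent_def o_def)
  qed
  have conv: "convergent (\<lambda>k. U (f (diagseq k)) (d i))" for i
  proof -
    have "convergent (\<lambda>k. U (f ((diagseq \<circ> (+) (Suc i)) k)) (d i))"
    proof (rule diagseq_holds)
      fix r s :: "nat \<Rightarrow> nat" and i
      assume "strict_mono r" "convergent (\<lambda>k. U (f (s k)) (d i))"
      then show "convergent (\<lambda>k. U (f ((s \<circ> r) k)) (d i))"
        using convergent_subseq_convergent[of "\<lambda>k. U (f (s k)) (d i)" r] by (simp add: o_def)
    qed
    then have "convergent (\<lambda>k. U (f (diagseq (k + Suc i))) (d i))" by (simp add: add.commute)
    then show ?thesis
      using convergent_ignore_initial_segment[of "\<lambda>k. U (f (diagseq k)) (d i)" "Suc i"] by blast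
  qed
  define L where "L i = lim (\<lambda>k. U (f (diagseq k)) (d i))" for i
  have L: "(\<lambda>k. U (f (diagseq k)) (d i)) \<longlonglongrightarrow> L i" for i
    unfolding L_def using conv by (simp add: convergent_LIMSEQ_iff)
  obtain g where g: "g \<in> capped M" "\<And>i. U g (d i) = L i"
    using weak_limit_exists[of M "\<lambda>k. f (diagseq k)" d L, OF M f(1) L d] by metis
  have "(\<lambda>k. U (f (diagseq k)) x) \<longlonglongrightarrow> U g x" if "0 < snd x" for x
  proof (rule U_tendsto_if_dense[of M "\<lambda>k. f (diagseq k)", OF M f(1) g(1) _ that])
    fix A :: "((real^'n) \<times> real) set" assume A: "open A" "A \<noteq> {}" "A \<subseteq> {x. 0 < snd x}"
    obtain y where y: "y \<in> D" "y \<in> A" using D1[OF A] by auto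
    obtain i where i: "y = d i" using y(1) unfolding rd[symmetric] by (rule rangeE)
    have "(\<lambda>k. U (f (diagseq k)) y) \<longlonglongrightarrow> U g y" using L[of i] by (simp only: i g(2))
    then show "\<exists>y\<in>A. (\<lambda>k. U (f (diagseq k)) y) \<longlonglongrightarrow> U g y" using y(2) by (rule bexI)
  qed
  then have "(\<lambda>k. E (f (diagseq k))) \<longlonglongrightarrow> E g"
    by (intro E_tendsto[of M "\<lambda>k. f (diagseq k)", OF M f(1) g(1)])
  moreover have "(\<lambda>k. E (f (diagseq k))) \<longlonglongrightarrow> ?S"
    unfolding f(2) using LIMSEQ_subseq_LIMSEQ[OF VS subseq_diagseq] by (simp add: o_def)
  ultimately have "E g = ?S" by (rule LIMSEQ_unique)
  then show thesis using that[OF g(1)] by (metis SUP_upper)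
qed

end

section \<open>The inequality for nonnegative functions\<close>

text \<open>On \<open>S\<close> the reflected copy of \<open>f \<le> M h\<close> lies below that of \<open>M h\<close>, hence below \<open>M h\<close>.\<close>

lemma (in conformal_reflection) polarize_capped:
  assumes f: "f \<in> capped M" and M: "0 \<le> M" and le: "\<And>w. w \<in> S \<Longrightarrow> reflect h w \<le> h w"
  shows "polarize f \<in> capped M"
proof -
  have [measurable]: "f \<in> borel_measurable borel" by (rule capped_measurable[OF f])
  have nn: "\<And>w. 0 \<le> f w" by (rule capped_nonneg[OF f])
  have "polarize f w \<le> M * h w" for w
  proof (cases "w \<in> S")
    case True
    have "reflect f w \<le> reflect (\<lambda>w. M * h w) w" by (rule reflect_mono) (rule capped_le[OF f])
    also have "\<dots> = M * reflect h w" by (simp add: reflect_def)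
    also have "\<dots> \<le> M * h w" using le[OF True] M by (rule mult_left_mono)
    finally show ?thesis using capped_le[OF f, of w] True by (simp add: polarize_def)
  next
    case False
    then show ?thesis using capped_le[OF f, of w] by (simp add: polarize_def min_le_iff_disj)
  qed
  moreover have "N (polarize f) \<le> 1" using N_polarize[of f] nn f by (simp add: capped_def)
  ultimately show ?thesis using polarize_nonneg[OF nn] by (simp add: capped_def)
qed

context poisson_setting begin

lemma E_capped_finite: assumes f: "f \<in> capped M" and M: "0 \<le> M" shows "E f < \<infinity>"
proof -
  have q0: "0 < q" using q_gt_2 by simp
  have "E f \<le> E (\<lambda>w. M * h w)" unfolding E_def U_cmult
  proof (rule nn_integral_mono_AE)
    show "AE x in hyp. ennreal (U f x powr q) \<le> ennreal ((M * U h x) powr q)"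
      using AE_hyp
    proof eventually_elim
      case (elim x)
      show ?case using q0 by (intro ennreal_leI powr_mono2 U_nonneg[OF capped_admissible[OF f]] U_le_capped[OF f M elim]) simp
    qed
  qed
  also have "\<dots> < \<infinity>" using E_bubble_finite[of 1 0] by (subst E_cmult) (auto simp: ennreal_mult_less_top)
  finally show ?thesis .
qed

text \<open>The sign \<open>e\<close> puts the point \<open>(0, 1)\<close>, to which \<open>h\<close> belongs, on the preferred side, so that the competitor
  obtained by polarization is again capped.\<close>

lemma maximizer_sphere_one_sided:
  assumes g: "g \<in> capped M" and M: "0 \<le> M" and max: "\<And>f. f \<in> capped M \<Longrightarrow> E f \<le> E g" and r: "0 < r"
  shows "\<exists>e. (e = 1 \<or> e = - 1) \<and> one_sided (sphere_reflect y r) (sphere_S e y r) g"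
proof -
  define e :: real where "e = (if 1 + (norm y)\<^sup>2 \<le> r\<^sup>2 then 1 else - 1)"
  have e: "e = 1 \<or> e = - 1" by (simp add: e_def)
  interpret R: conformal_reflection \<gamma> n a b p q "TYPE('n)" "sphere_S e y r" "sphere_H e y r" "inversion y r" "inversion (y, 0) r" "sphere_\<rho> y r"
    by (rule sphere_reflection[OF r e])
  have "0 \<le> e * (r\<^sup>2 - (1\<^sup>2 + (norm (y - 0))\<^sup>2))" by (simp add: e_def)
  then have "R.reflect h w \<le> h w" if "w \<in> sphere_S e y r" for w
    unfolding R.reflect_def using that by (intro sphere_reflect_bubble_le[OF r _ _ e]) auto
  then have "R.polarize g \<in> capped M" by (rule R.polarize_capped[OF g M])
  then have "E (R.polarize g) \<le> E g" by (rule max)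
  then show ?thesis
    using R.polarization_dichotomy[OF capped_admissible[OF g] E_capped_finite[OF g M]] e unfolding R.reflect_def one_sided_def by blast
qed

lemma maximizer_plane_one_sided:
  assumes g: "g \<in> capped M" and M: "0 \<le> M" and max: "\<And>f. f \<in> capped M \<Longrightarrow> E f \<le> E g"
  shows "\<exists>e. (e = 1 \<or> e = - 1) \<and> one_sided (plane_reflect i c) (plane_S e i c) g"
proof -
  define e :: real where "e = (if c \<le> 0 then 1 else - 1)"
  have e: "e = 1 \<or> e = - 1" by (simp add: e_def)
  interpret R: conformal_reflection \<gamma> n a b p q "TYPE('n)" "plane_S e i c" "plane_H e i c" "flip (ax i) c" "flip (ax i, 0) c" "\<lambda>_. 1"
    by (rule plane_reflection[OF e])
  have reflect: "R.reflect f w = f (flip (ax i) c w)" for f w by (simp add: R.reflect_def)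
  have "0 \<le> e * (0 \<bullet> ax i - c)" by (simp add: e_def)
  then have "R.reflect h w \<le> h w" if "w \<in> plane_S e i c" for w
    unfolding reflect using that by (intro plane_reflect_bubble_le[OF _ _ e]) auto
  then have "R.polarize g \<in> capped M" by (rule R.polarize_capped[OF g M])
  then have "E (R.polarize g) \<le> E g" by (rule max)
  then show ?thesis
    using R.polarization_dichotomy[OF capped_admissible[OF g] E_capped_finite[OF g M]] e unfolding reflect one_sided_def by blast
qed

lemma N_cong_AE: "AE w in lborel. f w = g w \<Longrightarrow> N f = N g"
  unfolding N_def by (rule nn_integral_cong_AE) (auto elim: eventually_mono)

lemma U_cong_AE:
  assumes [measurable]: "f \<in> borel_measurable borel" "g \<in> borel_measurable borel" and "AE w in lborel. f w = g w"
  shows "U f = U g"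
  unfolding U_def using assms(3) by (intro ext integral_cong_AE) (auto elim: eventually_mono)

lemma E_cong_AE:
  assumes "f \<in> borel_measurable borel" "g \<in> borel_measurable borel" "AE w in lborel. f w = g w"
  shows "E f = E g"
  unfolding E_def U_cong_AE[OF assms] ..

lemma N_zero_imp: assumes f: "admissible f" and N: "N f = 0" shows "AE w in lborel. f w = 0"
proof -
  have [measurable]: "f \<in> borel_measurable borel" and nn: "\<And>w. 0 \<le> f w" using f by (auto simp: admissible_def)
  have "AE w in lborel. ennreal (f w powr p) = 0" using N unfolding N_def by (subst (asm) nn_integral_0_iff_AE) auto
  then show ?thesis by eventually_elim (auto simp: ennreal_eq_0_iff powr_nonneg_iff)
qed

lemma E_zero: "E (\<lambda>_. 0) = 0"
  by (simp add: E_def U_def)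

text \<open>The value at \<open>h\<close> of the scaling-invariant quotient of \<open>E\<close> and \<open>N\<^bsup>q/p\<^esup>\<close>.\<close>

definition sharp_const :: real where
  "sharp_const = enn2real (E h) * enn2real (N h) powr (- q / p)"

lemma N_h: "N h = ennreal (enn2real (N h))" "0 < enn2real (N h)"
proof -
  have "N h < \<infinity>" using admissible_h by (simp add: admissible_def)
  then show "N h = ennreal (enn2real (N h))" by simp
  then show "0 < enn2real (N h)" using N_bubble_pos[of 1 0] by (metis ennreal_0 enn2real_nonneg less_irrefl order_le_less zero_less_one)
qed

lemma E_h: "E h = ennreal (enn2real (E h))" using E_bubble_finite[of 1 0] by simp

text \<open>The maximizer over the capped functions is a multiple of a bubble, and its mass restricts the multiple.\<close>

lemma E_capped_le:
  assumes f: "f \<in> capped M" and M: "0 \<le> M" shows "E f \<le> ennreal sharp_const"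
proof -
  obtain g where g: "g \<in> capped M" and max: "\<And>f. f \<in> capped M \<Longrightarrow> E f \<le> E g" using maximizer_exists[OF M] by blast
  have A: "admissible g" by (rule capped_admissible[OF g])
  have gm: "g \<in> borel_measurable borel" by (rule capped_measurable[OF g])
  have "E g \<le> ennreal sharp_const"
  proof (cases "N g = 0")
    case True
    then have "E g = E (\<lambda>_. 0)" by (intro E_cong_AE gm N_zero_imp[OF A]) auto
    then show ?thesis by (simp add: E_zero)
  next
    case False
    obtain c x0 \<mu> where c: "0 < c" "0 < \<mu>" and ae: "AE w in lborel. g w = c * bubble x0 \<mu> w"
      using bubble_if_one_sided[OF A False maximizer_sphere_one_sided[OF g M max] maximizer_plane_one_sided[OF g M max]] by metis
    have "N g = ennreal (c powr p) * N h" unfolding N_cong_AE[OF ae] by (subst N_cmult) (auto simp: N_bubble_eq[OF c(2)])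
    then have "ennreal (c powr p * enn2real (N h)) \<le> 1" using g N_h by (simp add: capped_def ennreal_mult)
    then have "c powr p * enn2real (N h) \<le> 1" by (simp add: ennreal_le_1)
    then have "c powr p \<le> enn2real (N h) powr (- 1)"
      using N_h(2) by (simp add: powr_minus_divide field_simps)
    then have "(c powr p) powr (q / p) \<le> (enn2real (N h) powr (- 1)) powr (q / p)"
      using p_gt_2 q_gt_2 by (intro powr_mono2) auto
    then have cq: "c powr q \<le> enn2real (N h) powr (- q / p)"
      using p_gt_2 unfolding powr_powr by simp
    have "E g = ennreal (c powr q) * E h"
      unfolding E_cong_AE[OF gm _ ae, simplified] by (subst E_cmult) (auto simp: E_bubble_eq[OF c(2)])
    also have "\<dots> = ennreal (c powr q * enn2real (E h))" using E_h by (metis ennreal_mult enn2real_nonneg powr_ge_zero)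
    also have "\<dots> \<le> ennreal sharp_const"
      unfolding sharp_const_def mult.commute[of "enn2real (E h)"] using cq by (intro ennreal_leI mult_right_mono) auto
    finally show ?thesis .
  qed
  then show ?thesis using max[OF f] by (rule order_trans[rotated])
qed

text \<open>The truncations of \<open>f\<close> at \<open>k h\<close> increase to \<open>f\<close>; Fatou's lemma passes the bound to the limit.\<close>

lemma E_le_of_N_le_1:
  assumes f: "admissible f" and N1: "N f \<le> 1" shows "E f \<le> ennreal sharp_const"
proof -
  have [measurable]: "f \<in> borel_measurable borel" and nn: "\<And>w. 0 \<le> f w" using f by (auto simp: admissible_def)
  define u where "u k w = min (f w) (real k * h w)" for k w
  have um[measurable]: "u k \<in> borel_measurable borel" for k unfolding u_def[abs_def] by measurable
  have u0: "0 \<le> u k w" "u k w \<le> f w" for k w using nn[of w] h_pos[of w] by (auto simp: u_def)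
  have q0: "0 < q" using q_gt_2 by simp
  have "N (u k) \<le> N f" for k
    unfolding N_def using u0 p_gt_2 by (intro nn_integral_mono ennreal_leI powr_mono2) auto
  then have ucls: "u k \<in> capped (real k)" for k using u0 um N1 by (auto simp: capped_def u_def intro: order_trans)
  have lim: "(\<lambda>k. U (u k) x) \<longlonglongrightarrow> U f x" if x: "0 < snd x" for x
    unfolding U_def
  proof (rule integral_dominated_convergence)
    show "integrable lborel (\<lambda>w. G x w * f w)" by (rule integrable_G_mult[OF x f])
    show "AE w in lborel. norm (G x w * u k w) \<le> G x w * f w" for k
      using u0 by (auto simp: abs_mult intro!: mult_left_mono)
    show "AE w in lborel. (\<lambda>k. G x w * u k w) \<longlonglongrightarrow> G x w * f w"
    proof (rule AE_I2)
      fix w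
      obtain K where K: "f w / h w \<le> real K" using real_arch_simple by blast
      have "u k w = f w" if "K \<le> k" for k
      proof -
        have "f w / h w \<le> real k" using K that by linarith
        then have "f w \<le> real k * h w" using h_pos[of w] by (simp add: field_simps)
        then show ?thesis by (simp add: u_def)
      qed
      then have "eventually (\<lambda>k. u k w = f w) sequentially" by (auto simp: eventually_sequentially)
      then have "(\<lambda>k. u k w) \<longlonglongrightarrow> f w" by (rule tendsto_eventually)
      then show "(\<lambda>k. G x w * u k w) \<longlonglongrightarrow> G x w * f w" by (intro tendsto_intros)
    qed
  qed measurable
  have "E f = (\<integral>\<^sup>+x. liminf (\<lambda>k. ennreal (U (u k) x powr q)) \<partial>hyp)"
    unfolding E_def
  proof (rule nn_integral_cong_AE)
    show "AE x in hyp. ennreal (U f x powr q) = liminf (\<lambda>k. ennreal (U (u k) x powr q))"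
      using AE_hyp
    proof eventually_elim
      case (elim x)
      have "(\<lambda>k. ennreal (U (u k) x powr q)) \<longlonglongrightarrow> ennreal (U f x powr q)"
        by (intro tendsto_ennrealI tendsto_powr' lim[OF elim] tendsto_const)
           (use q0 U_nonneg[OF capped_admissible[OF ucls]] in auto)
      then show ?case by (rule lim_imp_Liminf[OF sequentially_bot, symmetric])
    qed
  qed
  also have "\<dots> \<le> liminf (\<lambda>k. E (u k))" unfolding E_def
    by (rule nn_integral_liminf) (auto simp: measurable_cong_sets[OF sets_hyp refl])
  also have "\<dots> \<le> limsup (\<lambda>k. E (u k))" by (rule Liminf_le_Limsup) simp
  also have "\<dots> \<le> ennreal sharp_const"
    by (rule Limsup_bounded) (use E_capped_le[OF ucls] in simp)
  finally show ?thesis .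
qed

theorem E_le:
  assumes f: "admissible f" shows "E f \<le> ennreal (sharp_const * enn2real (N f) powr (q / p))"
proof -
  have fm: "f \<in> borel_measurable borel" using f by (simp add: admissible_def)
  define \<nu> where "\<nu> = enn2real (N f)"
  have N: "N f = ennreal \<nu>" using f by (simp add: \<nu>_def admissible_def)
  show ?thesis
  proof (cases "\<nu> = 0")
    case True
    then have "E f = E (\<lambda>_. 0)" using N by (intro E_cong_AE fm N_zero_imp[OF f]) auto
    then show ?thesis by (simp add: E_zero)
  next
    case False
    then have \<nu>: "0 < \<nu>" by (simp add: \<nu>_def order_less_le)
    define c where "c = \<nu> powr (- 1 / p)"
    have c: "0 < c" using \<nu> by (simp add: c_def)
    have "c powr p = \<nu> powr (- 1)" using p_gt_2 by (simp add: c_def powr_powr)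
    then have "c powr p * \<nu> = 1" using \<nu> by (simp add: powr_minus_divide)
    then have "N (\<lambda>w. c * f w) \<le> 1" using \<nu> by (simp add: N_cmult[OF fm] N ennreal_mult[symmetric])
    then have "E (\<lambda>w. c * f w) \<le> ennreal sharp_const"
      by (intro E_le_of_N_le_1 admissible_cmult f) (use c in simp)
    then have "ennreal (\<nu> powr (q / p)) * (ennreal (c powr q) * E f) \<le> ennreal (\<nu> powr (q / p)) * ennreal sharp_const"
      unfolding E_cmult[OF fm] by (rule mult_left_mono) simp
    moreover have "\<nu> powr (q / p) * c powr q = 1"
      using \<nu> by (simp add: c_def powr_powr powr_add[symmetric])
    then have "ennreal (\<nu> powr (q / p)) * (ennreal (c powr q) * E f) = E f"
      unfolding mult.assoc[symmetric] by (subst ennreal_mult[symmetric]) auto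
    moreover have "0 \<le> sharp_const" by (simp add: sharp_const_def)
    ultimately show ?thesis unfolding \<nu>_def[symmetric] by (simp add: ennreal_mult[symmetric] mult.commute)
  qed
qed

text \<open>Polarization cannot increase the energy of an extremal function, so the function is one-sided.\<close>

theorem bubble_if_extremal:
  assumes f: "admissible f" and N: "N f \<noteq> 0" and eq: "E f = ennreal (sharp_const * enn2real (N f) powr (q / p))"
  obtains c x0 \<mu> where "0 < c" "0 < \<mu>" "AE w in lborel. f w = c * bubble x0 \<mu> w"
proof -
  have fm: "f \<in> borel_measurable borel" and nn: "\<And>w. 0 \<le> f w" using f by (auto simp: admissible_def)
  have fin: "E f < \<infinity>" by (simp add: eq)
  have SD: "\<exists>e. (e = 1 \<or> e = - 1) \<and> one_sided (sphere_reflect y r) (sphere_S e y r) f" if r: "0 < r" for y r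
  proof -
    interpret R: conformal_reflection \<gamma> n a b p q "TYPE('n)" "sphere_S 1 y r" "sphere_H 1 y r" "inversion y r" "inversion (y, 0) r" "sphere_\<rho> y r"
      by (rule sphere_reflection[OF r]) simp
    have "E (R.polarize f) \<le> E f" using E_le[OF R.admissible_polarize[OF f]] by (simp add: R.N_polarize[OF fm nn] eq)
    then show ?thesis using R.polarization_dichotomy[OF f fin] unfolding R.reflect_def one_sided_def by blast
  qed
  have PD: "\<exists>e. (e = 1 \<or> e = - 1) \<and> one_sided (plane_reflect i c) (plane_S e i c) f" for i c
  proof -
    interpret R: conformal_reflection \<gamma> n a b p q "TYPE('n)" "plane_S 1 i c" "plane_H 1 i c" "flip (ax i) c" "flip (ax i, 0) c" "\<lambda>_. 1"
      by (rule plane_reflection) simp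
    have reflect: "R.reflect f w = f (flip (ax i) c w)" for f w by (simp add: R.reflect_def)
    have "E (R.polarize f) \<le> E f" using E_le[OF R.admissible_polarize[OF f]] by (simp add: R.N_polarize[OF fm nn] eq)
    then show ?thesis using R.polarization_dichotomy[OF f fin] unfolding reflect one_sided_def by blast
  qed
  show thesis using bubble_if_one_sided[OF f N SD PD] that by metis
qed

end

section \<open>Signed functions and the weighted norm\<close>

context poisson_setting begin

definition \<kappa> :: real where "\<kappa> = kappa CARD('n) \<gamma>"

lemma kappa_pos: "0 < \<kappa>"
  unfolding \<kappa>_def kappa_def using \<gamma> by (intro divide_pos_pos mult_pos_pos Gamma_real_pos) (auto intro: add_nonneg_pos)

lemma ext_kernel_eq:
  assumes t: "0 < snd x" shows "ext_kernel \<gamma> x w = \<kappa> * snd x powr (- a / 2) * G x w"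
proof -
  have e: "- a / 2 + b / 2 = 2 * \<gamma>" unfolding a_def b_def by (simp add: field_simps)
  have "snd x powr (2 * \<gamma>) = snd x powr (- a / 2) * snd x powr (b / 2)"
    unfolding powr_add[symmetric] e ..
  then show ?thesis unfolding ext_kernel_def G_def norm_sq_halfspace powr_divide
    by (simp add: b_def n_def \<kappa>_def)
qed

lemma harmonic_ext_eq:
  assumes f: "f \<in> borel_measurable lebesgue" and [measurable]: "g \<in> borel_measurable borel"
    and ae: "AE w in lborel. f w = g w"
  shows "harmonic_ext \<gamma> f x = (LINT w|lborel. ext_kernel \<gamma> x w * g w)"
    and "0 < snd x \<Longrightarrow> harmonic_ext \<gamma> f x = \<kappa> * snd x powr (- a / 2) * U g x"
proof -
  have [measurable]: "ext_kernel \<gamma> x \<in> borel_measurable borel" unfolding ext_kernel_def[abs_def] by measurable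
  have k: "ext_kernel \<gamma> x \<in> borel_measurable lebesgue" "g \<in> borel_measurable lebesgue"
    by (auto intro!: measurable_completion)
  have "harmonic_ext \<gamma> f x = (LINT w|lebesgue. ext_kernel \<gamma> x w * g w)"
    unfolding harmonic_ext_def
    by (rule integral_cong_AE) (use f k AE_completion[OF ae] in \<open>auto elim: eventually_mono\<close>)
  also have "\<dots> = (LINT w|lborel. ext_kernel \<gamma> x w * g w)"
    by (rule integral_completion) measurable
  finally show 1: "harmonic_ext \<gamma> f x = (LINT w|lborel. ext_kernel \<gamma> x w * g w)" .
  show "harmonic_ext \<gamma> f x = \<kappa> * snd x powr (- a / 2) * U g x" if t: "0 < snd x"
    unfolding 1 U_def ext_kernel_eq[OF t] by (simp add: mult.assoc)
qed

lemma measurable_harmonic_ext: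
  fixes g :: "real^'n \<Rightarrow> real"
  assumes f: "f \<in> borel_measurable lebesgue" and g[measurable]: "g \<in> borel_measurable borel"
    and ae: "AE w in lborel. f w = g w"
  shows "harmonic_ext \<gamma> f \<in> borel_measurable borel"
proof -
  have "harmonic_ext \<gamma> f = (\<lambda>x. LINT w|lborel. ext_kernel \<gamma> x w * g w)"
    using harmonic_ext_eq(1)[OF f g ae] by (rule ext)
  also have "\<dots> \<in> borel_measurable borel" unfolding ext_kernel_def by measurable
  finally show ?thesis .
qed

lemma borel_weighted: "g \<in> borel_measurable borel \<Longrightarrow> g \<in> borel_measurable (weighted_measure \<gamma> :: ((real^'n) \<times> real) measure)"
  unfolding weighted_measure_def by (auto intro!: measurable_restrict_space1 measurable_completion)

lemma sets_upper_half_space: "(upper_half_space :: ((real^'n) \<times> real) set) \<in> sets borel"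
proof -
  have "(upper_half_space :: ((real^'n) \<times> real) set) = {x. 0 < snd x}" by (auto simp: upper_half_space_def)
  moreover have "open {x :: (real^'n) \<times> real. 0 < snd x}" by (intro open_Collect_less continuous_intros)
  ultimately show ?thesis by (simp only: borel_open)
qed

lemma nn_integral_weighted:
  assumes [measurable]: "g \<in> borel_measurable borel"
  shows "(\<integral>\<^sup>+x. g x \<partial>(weighted_measure \<gamma> :: ((real^'n) \<times> real) measure))
    = (\<integral>\<^sup>+x. ennreal (indicator {0<..} (snd x) * snd x powr (1 - 2 * \<gamma>)) * g x \<partial>lborel)"
proof -
  let ?W = "\<lambda>x :: (real^'n) \<times> real. ennreal (snd x powr (1 - 2 * \<gamma>))"
  have [measurable]: "?W \<in> borel_measurable borel" by measurable
  note [measurable] = sets_upper_half_space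
  have "(\<integral>\<^sup>+x. g x \<partial>(weighted_measure \<gamma> :: ((real^'n) \<times> real) measure)) = (\<integral>\<^sup>+x. ?W x * g x \<partial>lebesgue_on upper_half_space)"
    unfolding weighted_measure_def
    by (rule nn_integral_density) (auto intro!: measurable_restrict_space1 measurable_completion)
  also have "\<dots> = (\<integral>\<^sup>+x. ?W x * g x * indicator upper_half_space x \<partial>lebesgue)"
    by (rule nn_integral_restrict_space) (simp add: sets_upper_half_space)
  also have "\<dots> = (\<integral>\<^sup>+x. ?W x * g x * indicator upper_half_space x \<partial>lborel)"
    by (rule nn_integral_completion)
  also have "\<dots> = (\<integral>\<^sup>+x. ennreal (indicator {0<..} (snd x) * snd x powr (1 - 2 * \<gamma>)) * g x \<partial>lborel)"
    by (rule nn_integral_cong) (auto simp: upper_half_space_def indicator_def)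
  finally show ?thesis .
qed

text \<open>The counterpart of \<open>E\<close> for functions of either sign.\<close>

definition V :: "(real^'n \<Rightarrow> real) \<Rightarrow> ennreal" where
  "V g = (\<integral>\<^sup>+x. ennreal (\<bar>U g x\<bar> powr q) \<partial>hyp)"

lemma nn_integral_harmonic_ext:
  assumes f: "f \<in> borel_measurable lebesgue" and g[measurable]: "g \<in> borel_measurable borel"
    and ae: "AE w in lborel. f w = g w"
  shows "(\<integral>\<^sup>+x. ennreal (\<bar>harmonic_ext \<gamma> f x\<bar> powr q) \<partial>weighted_measure \<gamma>) = ennreal (\<kappa> powr q) * V g"
proof -
  have [measurable]: "harmonic_ext \<gamma> f \<in> borel_measurable borel" by (rule measurable_harmonic_ext[OF f g ae])
  have "(\<integral>\<^sup>+x. ennreal (\<bar>harmonic_ext \<gamma> f x\<bar> powr q) \<partial>weighted_measure \<gamma>)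
    = (\<integral>\<^sup>+x. ennreal (indicator {0<..} (snd x) * snd x powr (1 - 2 * \<gamma>)) * ennreal (\<bar>harmonic_ext \<gamma> f x\<bar> powr q) \<partial>lborel)"
    by (rule nn_integral_weighted) measurable
  also have "\<dots> = (\<integral>\<^sup>+x. ennreal (indicator {0<..} (snd x) * snd x powr (- (n + 1))) * (ennreal (\<kappa> powr q) * ennreal (\<bar>U g x\<bar> powr q)) \<partial>lborel)"
  proof (rule nn_integral_cong)
    fix x :: "(real^'n) \<times> real"
    show "ennreal (indicator {0<..} (snd x) * snd x powr (1 - 2 * \<gamma>)) * ennreal (\<bar>harmonic_ext \<gamma> f x\<bar> powr q)
      = ennreal (indicator {0<..} (snd x) * snd x powr (- (n + 1))) * (ennreal (\<kappa> powr q) * ennreal (\<bar>U g x\<bar> powr q))"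
    proof (cases "0 < snd x")
      case True
      have m1: "\<bar>harmonic_ext \<gamma> f x\<bar> powr q = \<kappa> powr q * snd x powr (- a / 2 * q) * \<bar>U g x\<bar> powr q"
        unfolding harmonic_ext_eq(2)[OF f g ae True] abs_mult powr_mult using kappa_pos by (simp add: powr_powr)
      have "- a / 2 * q = - (a * q) / 2" by simp
      then have e: "1 - 2 * \<gamma> + - a / 2 * q = - (n + 1)" unfolding a_times_q by (simp add: a_def field_simps)
      have m2: "snd x powr (1 - 2 * \<gamma>) * snd x powr (- a / 2 * q) = snd x powr (- (n + 1))"
        unfolding powr_add[symmetric] e ..
      have "snd x powr (1 - 2 * \<gamma>) * \<bar>harmonic_ext \<gamma> f x\<bar> powr q
          = (snd x powr (1 - 2 * \<gamma>) * snd x powr (- a / 2 * q)) * (\<kappa> powr q * \<bar>U g x\<bar> powr q)"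
        unfolding m1 by (simp only: mult_ac)
      then have "snd x powr (1 - 2 * \<gamma>) * \<bar>harmonic_ext \<gamma> f x\<bar> powr q = snd x powr (- (n + 1)) * (\<kappa> powr q * \<bar>U g x\<bar> powr q)"
        unfolding m2 .
      then show ?thesis using True by (simp add: ennreal_mult[symmetric])
    qed simp
  qed
  also have "\<dots> = (\<integral>\<^sup>+x. ennreal (\<kappa> powr q) * ennreal (\<bar>U g x\<bar> powr q) \<partial>hyp)"
    by (rule nn_integral_hyp[symmetric]) measurable
  also have "\<dots> = ennreal (\<kappa> powr q) * V g"
    unfolding V_def by (rule nn_integral_cmult) (simp add: measurable_cong_sets[OF sets_hyp refl])
  finally show ?thesis .
qed

lemma abs_U_le: "\<bar>U g x\<bar> \<le> U (\<lambda>w. \<bar>g w\<bar>) x"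
  using integral_abs_bound[of lborel "\<lambda>w. G x w * g w"] by (simp add: U_def abs_mult)

lemma V_le: "V g \<le> E (\<lambda>w. \<bar>g w\<bar>)"
  unfolding V_def E_def using abs_U_le q_gt_2 by (intro nn_integral_mono ennreal_leI powr_mono2) auto

lemma V_bubble: assumes \<mu>: "0 < \<mu>" shows "V (\<lambda>w. c * bubble x0 \<mu> w) = ennreal (\<bar>c\<bar> powr q) * E h"
proof -
  have "V (\<lambda>w. c * bubble x0 \<mu> w) = E (\<lambda>w. \<bar>c\<bar> * bubble x0 \<mu> w)"
    unfolding V_def E_def U_cmult abs_mult using U_nonneg[OF admissible_bubble[OF \<mu>]] by simp
  then show ?thesis by (simp add: E_cmult E_bubble_eq[OF \<mu>])
qed

text \<open>Equality of the energies gives \<open>\<bar>U g x\<bar> = U \<bar>g\<bar> x\<close> at some point \<open>x\<close>, and at that point the kernel is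
  positive everywhere.\<close>

lemma one_sign_if_V_eq:
  assumes [measurable]: "g \<in> borel_measurable borel" and A: "admissible (\<lambda>w. \<bar>g w\<bar>)"
    and eq: "V g = E (\<lambda>w. \<bar>g w\<bar>)" and fin: "E (\<lambda>w. \<bar>g w\<bar>) < \<infinity>"
  shows "(AE w in lborel. g w = \<bar>g w\<bar>) \<or> (AE w in lborel. g w = - \<bar>g w\<bar>)"
proof -
  let ?F = "\<lambda>w. \<bar>g w\<bar>"
  have q0: "0 < q" using q_gt_2 by simp
  have le: "AE x in hyp. ennreal (\<bar>U g x\<bar> powr q) \<le> ennreal (U ?F x powr q)"
    using abs_U_le q0 by (auto intro!: ennreal_leI powr_mono2)
  have ae: "AE x in hyp. ennreal (\<bar>U g x\<bar> powr q) = ennreal (U ?F x powr q)"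
    by (rule AE_eq_if_nn_integral_eq[OF _ _ le])
       (use eq fin in \<open>auto simp: measurable_cong_sets[OF sets_hyp refl] V_def E_def\<close>)
  have "\<exists>x. 0 < snd x \<and> \<bar>U g x\<bar> = U ?F x"
  proof (rule ccontr)
    assume no: "\<not> ?thesis"
    have "AE x in hyp. \<not> 0 < snd x"
      using ae
    proof eventually_elim
      case (elim x)
      have "U ?F x \<le> \<bar>U g x\<bar>"
      proof (rule ccontr)
        assume "\<not> ?thesis"
        then have "\<bar>U g x\<bar> powr q < U ?F x powr q" using q0 by (intro powr_less_mono2) auto
        then show False using elim by simp
      qed
      then have "\<bar>U g x\<bar> = U ?F x" using abs_U_le[of g x] by (rule antisym[rotated])
      then show ?case using no by blast
    qed
    then show False using not_AE_hyp_outside by blast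
  qed
  then obtain x where x: "0 < snd x" and xe: "\<bar>U g x\<bar> = U ?F x" by blast
  have iF: "integrable lborel (\<lambda>w. G x w * ?F w)" by (rule integrable_G_mult[OF x A])
  have ig: "integrable lborel (\<lambda>w. G x w * g w)"
    by (rule Bochner_Integration.integrable_bound[OF iF]) (auto simp: abs_mult)
  have key: "AE w in lborel. \<bar>g w\<bar> = s * g w" if s: "s = 1 \<or> s = - 1" and e: "U ?F x = s * U g x" for s
  proof -
    have i: "integrable lborel (\<lambda>w. G x w * ?F w - s * (G x w * g w))" using iF ig by simp
    have "(LINT w|lborel. G x w * ?F w - s * (G x w * g w)) = 0"
      using iF ig e by (simp add: U_def)
    moreover have "0 \<le> G x w * ?F w - s * (G x w * g w)" for w
    proof -
      have "G x w * ?F w - s * (G x w * g w) = G x w * (\<bar>g w\<bar> - s * g w)" by (simp add: algebra_simps)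
      moreover have "0 \<le> \<bar>g w\<bar> - s * g w" using s by auto
      ultimately show ?thesis by simp
    qed
    ultimately have "AE w in lborel. G x w * ?F w - s * (G x w * g w) = 0"
      using integral_nonneg_eq_0_iff_AE[OF i] by simp
    then show ?thesis
    proof eventually_elim
      case (elim w)
      then have "G x w * (\<bar>g w\<bar> - s * g w) = 0" by (simp add: algebra_simps)
      then show ?case using G_pos[OF x, of w] by simp
    qed
  qed
  show ?thesis
  proof (cases "0 \<le> U g x")
    case True
    then have "AE w in lborel. \<bar>g w\<bar> = 1 * g w" by (intro key) (use xe in auto)
    then have "AE w in lborel. g w = \<bar>g w\<bar>" by eventually_elim simp
    then show ?thesis ..
  next
    case False
    then have "AE w in lborel. \<bar>g w\<bar> = - 1 * g w" by (intro key) (use xe in auto)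
    then have "AE w in lborel. g w = - \<bar>g w\<bar>" by eventually_elim simp
    then show ?thesis ..
  qed
qed

text \<open>Replaces a Lebesgue measurable function by a Borel function that agrees almost everywhere; extension
  and norm do not change.\<close>

lemma Lp_space_borel_version:
  assumes f: "f \<in> Lp_space (lebesgue :: (real^'n) measure) p"
  obtains g where "f \<in> borel_measurable lebesgue" "g \<in> borel_measurable borel" "AE w in lborel. f w = g w"
    "admissible (\<lambda>w. \<bar>g w\<bar>)" "Lp_norm lebesgue p f = enn2real (N (\<lambda>w. \<bar>g w\<bar>)) powr (1 / p)"
proof -
  have fm: "f \<in> borel_measurable lebesgue" and fi: "integrable lebesgue (\<lambda>x. \<bar>f x\<bar> powr p)"
    using f by (auto simp: Lp_space_def)
  obtain g where g: "g \<in> borel_measurable lborel" and ae: "AE w in lborel. f w = g w"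
    using completion_ex_borel_measurable_real[OF fm] by blast
  have gb[measurable]: "g \<in> borel_measurable borel" using g by simp
  have N: "N (\<lambda>w. \<bar>g w\<bar>) = (\<integral>\<^sup>+w. ennreal (\<bar>f w\<bar> powr p) \<partial>lebesgue)"
  proof -
    have "N (\<lambda>w. \<bar>g w\<bar>) = (\<integral>\<^sup>+w. ennreal (\<bar>g w\<bar> powr p) \<partial>lebesgue)"
      unfolding N_def by (rule nn_integral_completion[symmetric])
    also have "\<dots> = (\<integral>\<^sup>+w. ennreal (\<bar>f w\<bar> powr p) \<partial>lebesgue)"
      by (rule nn_integral_cong_AE) (use AE_completion[OF ae] in \<open>auto elim: eventually_mono\<close>)
    finally show ?thesis .
  qed
  have "N (\<lambda>w. \<bar>g w\<bar>) < \<infinity>" unfolding N using fi by (simp add: integrable_iff_bounded)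
  then have "admissible (\<lambda>w. \<bar>g w\<bar>)" by (simp add: admissible_def)
  moreover have "Lp_norm lebesgue p f = enn2real (N (\<lambda>w. \<bar>g w\<bar>)) powr (1 / p)"
    unfolding Lp_norm_def N using fm by (subst integral_eq_nn_integral) auto
  ultimately show thesis using that fm gb ae by blast
qed

lemma Lp_norm_harmonic_ext:
  assumes f: "f \<in> borel_measurable lebesgue" and g: "g \<in> borel_measurable borel" and ae: "AE w in lborel. f w = g w"
  shows "Lp_norm (weighted_measure \<gamma>) q (harmonic_ext \<gamma> f) = \<kappa> * enn2real (V g) powr (1 / q)"
proof -
  have [measurable]: "harmonic_ext \<gamma> f \<in> borel_measurable borel" by (rule measurable_harmonic_ext[OF f g ae])
  have "(LINT x|weighted_measure \<gamma>. \<bar>harmonic_ext \<gamma> f x\<bar> powr q) = enn2real (ennreal (\<kappa> powr q) * V g)"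
    unfolding nn_integral_harmonic_ext[OF f g ae, symmetric]
    by (rule integral_eq_nn_integral) (auto intro!: borel_weighted)
  then have "Lp_norm (weighted_measure \<gamma>) q (harmonic_ext \<gamma> f) = (\<kappa> powr q * enn2real (V g)) powr (1 / q)"
    by (simp add: Lp_norm_def enn2real_mult)
  also have "\<dots> = \<kappa> * enn2real (V g) powr (1 / q)"
    using kappa_pos q_gt_2 unfolding powr_mult powr_powr by simp
  finally show ?thesis .
qed

lemma U_h_pos: assumes x: "0 < snd x" shows "0 < U h x"
proof -
  have "U h x \<noteq> 0"
  proof
    assume "U h x = 0"
    then have "AE w in lborel. G x w * h w = 0"
      unfolding U_def using integral_nonneg_eq_0_iff_AE[OF integrable_G_mult[OF x admissible_h]] h_pos
      by (simp add: less_imp_le)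
    then obtain w where "G x w * h w = 0" using AE_lborel_witness by blast
    then show False using G_pos[OF x, of w] h_pos[of w] by simp
  qed
  then show ?thesis using U_nonneg[OF admissible_h, of x] by simp
qed

lemma sharp_const_pos: "0 < sharp_const"
proof -
  have "E h \<noteq> 0"
  proof
    assume "E h = 0"
    then have "AE x in hyp. ennreal (U h x powr q) = 0"
      unfolding E_def by (subst (asm) nn_integral_0_iff_AE) (auto simp: measurable_cong_sets[OF sets_hyp refl])
    then have "AE x in hyp. \<not> 0 < snd x"
    proof eventually_elim
      case (elim x)
      show ?case
      proof
        assume "0 < snd x"
        then have "0 < U h x powr q" using U_h_pos[of x] by simp
        then show False using elim by (simp add: ennreal_eq_0_iff)
      qed
    qed
    then show False using not_AE_hyp_outside by blast
  qed
  then have "0 < enn2real (E h)" using E_h by (metis ennreal_0 enn2real_nonneg order_le_less)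
  then show ?thesis unfolding sharp_const_def using N_h(2) by simp
qed

definition C_opt :: real where "C_opt = \<kappa> * sharp_const powr (1 / q)"

lemma C_opt_pos: "0 < C_opt"
  unfolding C_opt_def using kappa_pos sharp_const_pos by simp

lemma C_opt_root:
  assumes "0 \<le> \<nu>" shows "C_opt * \<nu> powr (1 / p) = \<kappa> * (sharp_const * \<nu> powr (q / p)) powr (1 / q)"
  unfolding C_opt_def powr_mult powr_powr using q_gt_2 by simp

lemma harmonic_ext_bound:
  assumes f: "f \<in> Lp_space (lebesgue :: (real^'n) measure) p"
  shows "harmonic_ext \<gamma> f \<in> Lp_space (weighted_measure \<gamma>) q"
    and "Lp_norm (weighted_measure \<gamma>) q (harmonic_ext \<gamma> f) \<le> C_opt * Lp_norm lebesgue p f"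
proof -
  obtain g where fm: "f \<in> borel_measurable lebesgue" and g: "g \<in> borel_measurable borel" and ae: "AE w in lborel. f w = g w"
    and A: "admissible (\<lambda>w. \<bar>g w\<bar>)" and nf: "Lp_norm lebesgue p f = enn2real (N (\<lambda>w. \<bar>g w\<bar>)) powr (1 / p)"
    by (rule Lp_space_borel_version[OF f])
  have V: "V g \<le> ennreal (sharp_const * enn2real (N (\<lambda>w. \<bar>g w\<bar>)) powr (q / p))"
    using V_le E_le[OF A] by (rule order_trans)
  have hm: "harmonic_ext \<gamma> f \<in> borel_measurable borel" by (rule measurable_harmonic_ext[OF fm g ae])
  have "integrable (weighted_measure \<gamma>) (\<lambda>x. \<bar>harmonic_ext \<gamma> f x\<bar> powr q)"
  proof (rule integrableI_nonneg)
    have "V g < \<infinity>" using V by (rule le_less_trans) simp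
    then show "(\<integral>\<^sup>+x. ennreal (\<bar>harmonic_ext \<gamma> f x\<bar> powr q) \<partial>weighted_measure \<gamma>) < \<infinity>"
      unfolding nn_integral_harmonic_ext[OF fm g ae] by (simp add: ennreal_mult_less_top)
    show "(\<lambda>x. \<bar>harmonic_ext \<gamma> f x\<bar> powr q) \<in> borel_measurable (weighted_measure \<gamma>)"
      by (rule borel_weighted) (use hm in measurable)
  qed simp
  then show "harmonic_ext \<gamma> f \<in> Lp_space (weighted_measure \<gamma>) q"
    unfolding Lp_space_def using borel_weighted[OF hm] by simp
  have "enn2real (V g) \<le> sharp_const * enn2real (N (\<lambda>w. \<bar>g w\<bar>)) powr (q / p)"
    using V sharp_const_pos by (simp add: enn2real_leI)
  then show "Lp_norm (weighted_measure \<gamma>) q (harmonic_ext \<gamma> f) \<le> C_opt * Lp_norm lebesgue p f"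
    unfolding Lp_norm_harmonic_ext[OF fm g ae] nf C_opt_root[OF enn2real_nonneg]
    using kappa_pos q_gt_2 by (intro mult_left_mono powr_mono2) auto
qed

lemma bubble_attains:
  assumes f: "f \<in> borel_measurable lebesgue" and \<mu>: "0 < \<mu>" and ae: "AE w in lborel. f w = c * bubble x0 \<mu> w"
  shows "f \<in> Lp_space lebesgue p" "Lp_norm lebesgue p f = \<bar>c\<bar> * enn2real (N h) powr (1 / p)"
    "Lp_norm (weighted_measure \<gamma>) q (harmonic_ext \<gamma> f) = C_opt * Lp_norm lebesgue p f"
proof -
  let ?g = "\<lambda>w. c * bubble x0 \<mu> w"
  have gm: "?g \<in> borel_measurable borel" by measurable
  have Ng: "N (\<lambda>w. \<bar>c\<bar> * bubble x0 \<mu> w) = ennreal (\<bar>c\<bar> powr p * enn2real (N h))"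
    by (subst N_cmult) (use N_h in \<open>auto simp: N_bubble_eq[OF \<mu>] ennreal_mult\<close>)
  have eqf: "(\<integral>\<^sup>+w. ennreal (\<bar>f w\<bar> powr p) \<partial>lebesgue) = N (\<lambda>w. \<bar>c\<bar> * bubble x0 \<mu> w)"
  proof -
    have "(\<integral>\<^sup>+w. ennreal (\<bar>f w\<bar> powr p) \<partial>lebesgue) = (\<integral>\<^sup>+w. ennreal ((\<bar>c\<bar> * bubble x0 \<mu> w) powr p) \<partial>lebesgue)"
      by (rule nn_integral_cong_AE)
         (use AE_completion[OF ae] bubble_pos[OF \<mu>, of x0] in \<open>auto elim!: eventually_mono simp: abs_mult less_imp_le\<close>)
    also have "\<dots> = N (\<lambda>w. \<bar>c\<bar> * bubble x0 \<mu> w)" unfolding N_def by (rule nn_integral_completion)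
    finally show ?thesis .
  qed
  have "integrable lebesgue (\<lambda>w. \<bar>f w\<bar> powr p)"
    by (rule integrableI_nonneg) (use f eqf Ng in auto)
  then show fL: "f \<in> Lp_space lebesgue p" using f by (simp add: Lp_space_def)
  have "(LINT w|lebesgue. \<bar>f w\<bar> powr p) = \<bar>c\<bar> powr p * enn2real (N h)"
    using f by (subst integral_eq_nn_integral) (auto simp: eqf Ng)
  then show nf: "Lp_norm lebesgue p f = \<bar>c\<bar> * enn2real (N h) powr (1 / p)"
    unfolding Lp_norm_def using p_gt_2 by (simp add: powr_mult powr_powr)
  have "V ?g = ennreal (\<bar>c\<bar> powr q * enn2real (E h))"
    unfolding V_bubble[OF \<mu>] using E_h by (metis ennreal_mult enn2real_nonneg powr_ge_zero)
  then have "Lp_norm (weighted_measure \<gamma>) q (harmonic_ext \<gamma> f) = \<kappa> * (\<bar>c\<bar> powr q * enn2real (E h)) powr (1 / q)"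
    unfolding Lp_norm_harmonic_ext[OF f gm ae] by simp
  also have "\<dots> = \<kappa> * (\<bar>c\<bar> * enn2real (E h) powr (1 / q))"
    unfolding powr_mult powr_powr using q_gt_2 by simp
  also have "enn2real (E h) powr (1 / q) = sharp_const powr (1 / q) * enn2real (N h) powr (1 / p)"
  proof -
    have "enn2real (E h) = sharp_const * enn2real (N h) powr (q / p)"
      unfolding sharp_const_def mult.assoc powr_add[symmetric] using N_h(2) by simp
    then show ?thesis using q_gt_2 by (simp add: powr_mult powr_powr)
  qed
  finally show "Lp_norm (weighted_measure \<gamma>) q (harmonic_ext \<gamma> f) = C_opt * Lp_norm lebesgue p f"
    unfolding nf C_opt_def by (simp only: mult_ac)
qed

lemma bubble_if_equality:
  assumes f: "f \<in> Lp_space (lebesgue :: (real^'n) measure) p"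
    and eq: "Lp_norm (weighted_measure \<gamma>) q (harmonic_ext \<gamma> f) = C_opt * Lp_norm lebesgue p f"
  shows "\<exists>c \<mu> x0. 0 < \<mu> \<and> (AE w in lborel. f w = c * bubble x0 \<mu> w)"
proof -
  obtain g where fm: "f \<in> borel_measurable lebesgue" and g[measurable]: "g \<in> borel_measurable borel" and ae: "AE w in lborel. f w = g w"
    and A: "admissible (\<lambda>w. \<bar>g w\<bar>)" and nf: "Lp_norm lebesgue p f = enn2real (N (\<lambda>w. \<bar>g w\<bar>)) powr (1 / p)"
    by (rule Lp_space_borel_version[OF f])
  let ?F = "\<lambda>w. \<bar>g w\<bar>"
  let ?K = "sharp_const * enn2real (N ?F) powr (q / p)"
  have K0: "0 \<le> ?K" using sharp_const_pos by simp
  show ?thesis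
  proof (cases "N ?F = 0")
    case True
    then have "AE w in lborel. \<bar>g w\<bar> = 0" by (rule N_zero_imp[OF A])
    with ae have "AE w in lborel. f w = 0 * bubble 0 1 w" by eventually_elim simp
    then show ?thesis using zero_less_one by blast
  next
    case False
    have VE: "V g \<le> E ?F" "E ?F \<le> ennreal ?K" by (rule V_le, rule E_le[OF A])
    have "E ?F < \<infinity>" by (rule le_less_trans[OF VE(2)]) simp
    then have fin: "V g < \<infinity>" "E ?F < \<infinity>" using le_less_trans[OF VE(1)] by blast+
    have "enn2real (V g) powr (1 / q) = ?K powr (1 / q)"
      using eq kappa_pos unfolding Lp_norm_harmonic_ext[OF fm g ae] nf C_opt_root[OF enn2real_nonneg] by simp
    then have "(enn2real (V g) powr (1 / q)) powr q = (?K powr (1 / q)) powr q" by simp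
    then have "enn2real (V g) = ?K" using q_gt_2 K0 by (simp add: powr_powr)
    then have VK: "V g = ennreal ?K" using fin(1) by (metis ennreal_enn2real infinity_ennreal_def)
    have EK: "E ?F = ennreal ?K" using VE VK by simp
    obtain c x0 \<mu> where c: "0 < c" "0 < \<mu>" and aeF: "AE w in lborel. ?F w = c * bubble x0 \<mu> w"
      by (rule bubble_if_extremal[OF A False EK])
    have "(AE w in lborel. g w = \<bar>g w\<bar>) \<or> (AE w in lborel. g w = - \<bar>g w\<bar>)"
      by (rule one_sign_if_V_eq[OF g A _ fin(2)]) (simp add: VK EK)
    then show ?thesis
    proof
      assume "AE w in lborel. g w = \<bar>g w\<bar>"
      with ae aeF have "AE w in lborel. f w = c * bubble x0 \<mu> w" by eventually_elim simp
      then show ?thesis using c by blast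
    next
      assume "AE w in lborel. g w = - \<bar>g w\<bar>"
      with ae aeF have "AE w in lborel. f w = (- c) * bubble x0 \<mu> w" by eventually_elim simp
      then show ?thesis using c by blast
    qed
  qed
qed

end

theorem theorem1p1:
  fixes \<gamma> n p q :: real
  assumes "0 < \<gamma>" and "\<gamma> < 1"
    and "n = real CARD('n::finite)"
    and "n > 2 * \<gamma>"
    and "p = 2 * n / (n - 2 * \<gamma>)"
    and "q = 2 * (n - 2 * \<gamma> + 2) / (n - 2 * \<gamma>)"
  shows "\<exists>C>0.
      (\<forall>f \<in> Lp_space (lebesgue :: (real ^ 'n) measure) p.
         harmonic_ext \<gamma> f \<in> Lp_space (weighted_measure \<gamma>) q \<and>
         Lp_norm (weighted_measure \<gamma>) q (harmonic_ext \<gamma> f) \<le> C * Lp_norm lebesgue p f) \<and>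
      (\<forall>C'. (\<forall>f \<in> Lp_space (lebesgue :: (real ^ 'n) measure) p.
               Lp_norm (weighted_measure \<gamma>) q (harmonic_ext \<gamma> f) \<le> C' * Lp_norm lebesgue p f)
            \<longrightarrow> C \<le> C') \<and>
      (\<forall>f \<in> Lp_space (lebesgue :: (real ^ 'n) measure) p.
         Lp_norm (weighted_measure \<gamma>) q (harmonic_ext \<gamma> f) = C * Lp_norm lebesgue p f \<longleftrightarrow>
         (\<exists>c \<mu> x\<^sub>0. \<mu> > 0 \<and>
            (AE x in lebesgue.
               f x = c * (\<mu> / (\<mu>\<^sup>2 + (norm (x - x\<^sub>0))\<^sup>2)) powr ((n - 2 * \<gamma>) / 2))))"
proof -
  interpret poisson_setting \<gamma> n "n - 2 * \<gamma>" "n + 2 * \<gamma>" p q "TYPE('n)"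
    by standard (use assms in auto)
  show ?thesis
    unfolding bubble_def[symmetric] AE_completion_iff
  proof (intro exI[of _ C_opt] conjI ballI allI impI)
    show "0 < C_opt" by (rule C_opt_pos)
    show "harmonic_ext \<gamma> f \<in> Lp_space (weighted_measure \<gamma>) q"
      "Lp_norm (weighted_measure \<gamma>) q (harmonic_ext \<gamma> f) \<le> C_opt * Lp_norm lebesgue p f"
      if "f \<in> Lp_space (lebesgue :: (real ^ 'n) measure) p" for f
      by (rule harmonic_ext_bound[OF that])+
  next
    fix C'
    assume C': "\<forall>f \<in> Lp_space (lebesgue :: (real ^ 'n) measure) p.
      Lp_norm (weighted_measure \<gamma>) q (harmonic_ext \<gamma> f) \<le> C' * Lp_norm lebesgue p f"
    have hm: "h \<in> borel_measurable lebesgue" by (auto intro!: measurable_completion)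
    note B = bubble_attains[OF hm zero_less_one, of 1 0, simplified]
    have "C_opt * Lp_norm lebesgue p h \<le> C' * Lp_norm lebesgue p h"
      using C'[rule_format, OF B(1)] B(3) by simp
    moreover have "0 < Lp_norm lebesgue p h" unfolding B(2) using N_h(2) by simp
    ultimately show "C_opt \<le> C'" by simp
  next
    fix f assume f: "f \<in> Lp_space (lebesgue :: (real ^ 'n) measure) p"
    then have fm: "f \<in> borel_measurable lebesgue" by (simp add: Lp_space_def)
    show "Lp_norm (weighted_measure \<gamma>) q (harmonic_ext \<gamma> f) = C_opt * Lp_norm lebesgue p f \<longleftrightarrow>
      (\<exists>c \<mu> x0. 0 < \<mu> \<and> (AE w in lborel. f w = c * bubble x0 \<mu> w))"
      using bubble_if_equality[OF f] bubble_attains(3)[OF fm] by blast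
  qed
qed

end
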